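(* Let $M_1$ and $M_2$ be matroids with $E(M_1)\cap E(M_2)=\{p\}$, where $p$ is neither a loop nor a coloop of $M_1$ or of $M_2$. Then $F(M_1\oplus_p M_2)\cong F(M_1)\otimes F(M_2)$.
   Context: The 2-sum $M_1\oplus_p M_2$ is the matroid on $(E(M_1)\cup E(M_2))-p$ whose circuits are the circuits of $M_1\setminus p$, the circuits of $M_2\setminus p$, and the sets $(C_1\cup C_2)-p$ where $C_i$ is a circuit of $M_i$ containing $p$. A pasture is a commutative monoid $P$ with absorbing element $0$, $P^\times=P\setminus\{0\}$, and a nullset $N_P$ of formal sums $a+b+c$ ($a,b,c\in P$) such that: $a+0+0\in N_P$ iff $a=0$; $N_P$ is closed under multiplying all terms by any $d\in P$; there is a unique $\epsilon\in P^\times$ with $1+\epsilon+0\in N_P$. Morphisms are multiplicative maps preserving $0$, $1$ and null sums. For a matroid $N$ on $E$ with hyperplanes $\mathcal H$ and a pasture $P$, a $P$-representation is a family $f_H:E\to P$ ($H\in\mathcal H$) with $f_H(e)=0$ iff $e\in H$ such that for each modular triple of hyperplanes $(H_1,H_2,H_3)$ (i.e. $H_1\cap H_2\cap H_3$ is a corank-2 flat equal to each pairwise intersection) there are $c_1,c_2,c_3\in P$ not all $0$ with $\sum_i c_if_{H_i}(e)\in N_P$ for all $e$. Two representations are rescaling equivalent if $f'_H(e)=c_Hc_ef_H(e)$ with $c_H,c_e\in P^\times$. The foundation $F(N)$ is the pasture with $\mathrm{Hom}(F(N),P)$ naturally (in $P$) in bijection with rescaling classes of $P$-representations of $N$. $A\otimes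 B$ denotes the tensor product of pastures, i.e. their coproduct in the category of pastures. *)

theory Defs
  imports "HOL-Algebra.Group" "HOL-Library.Multiset" "HOL-Library.FuncSet"
begin

text \<open>Finite matroids, presented by the axioms for their circuits.\<close>

record 'e matroid =
  ground :: "'e set"
  circuits :: "'e set set"

definition matroid :: "'e matroid \<Rightarrow> bool" where
  "matroid M \<longleftrightarrow>
     finite (ground M) \<and>
     (\<forall>C\<in>circuits M. C \<subseteq> ground M) \<and>
     {} \<notin> circuits M \<and>
     (\<forall>C\<in>circuits M. \<forall>D\<in>circuits M. C \<subseteq> D \<longrightarrow> C = D) \<and>
     (\<forall>C\<in>circuits M. \<forall>D\<in>circuits M. \<forall>e. C \<noteq> D \<and> e \<in> C \<inter> D \<longrightarrow>
        (\<exists>K\<in>circuits M. K \<subseteq> (C \<union> D) - {e}))"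

definition indep :: "'e matroid \<Rightarrow> 'e set \<Rightarrow> bool" where
  "indep M I \<longleftrightarrow> I \<subseteq> ground M \<and> (\<forall>C\<in>circuits M. \<not> C \<subseteq> I)"

definition basis :: "'e matroid \<Rightarrow> 'e set \<Rightarrow> bool" where
  "basis M B \<longleftrightarrow> indep M B \<and> (\<forall>I. indep M I \<and> B \<subseteq> I \<longrightarrow> I = B)"

definition rank :: "'e matroid \<Rightarrow> 'e set \<Rightarrow> nat" where
  "rank M X = Max {card I |I. indep M I \<and> I \<subseteq> X}"

definition loop :: "'e matroid \<Rightarrow> 'e \<Rightarrow> bool" where
  "loop M e \<longleftrightarrow> {e} \<in> circuits M"

definition coloop :: "'e matroid \<Rightarrow> 'e \<Rightarrow> bool" where
  "coloop M e \<longleftrightarrow> e \<in> ground M \<and> (\<forall>B. basis M B \<longrightarrow> e \<in> B)"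

definition flat :: "'e matroid \<Rightarrow> 'e set \<Rightarrow> bool" where
  "flat M X \<longleftrightarrow> X \<subseteq> ground M \<and> (\<forall>e\<in>ground M - X. rank M X < rank M (insert e X))"

text \<open>Corank is expressed additively to avoid truncated subtraction on \<^typ>\<open>nat\<close>.\<close>

definition corank_flat :: "'e matroid \<Rightarrow> nat \<Rightarrow> 'e set \<Rightarrow> bool" where
  "corank_flat M k X \<longleftrightarrow> flat M X \<and> rank M X + k = rank M (ground M)"

definition hyperplanes :: "'e matroid \<Rightarrow> 'e set set" where
  "hyperplanes M = {H. corank_flat M 1 H}"

definition modular_triple :: "'e matroid \<Rightarrow> 'e set \<Rightarrow> 'e set \<Rightarrow> 'e set \<Rightarrow> bool" where
  "modular_triple M H1 H2 H3 \<longleftrightarrow>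
     H1 \<in> hyperplanes M \<and> H2 \<in> hyperplanes M \<and> H3 \<in> hyperplanes M \<and>
     corank_flat M 2 (H1 \<inter> H2 \<inter> H3) \<and>
     H1 \<inter> H2 = H1 \<inter> H2 \<inter> H3 \<and> H1 \<inter> H3 = H1 \<inter> H2 \<inter> H3 \<and> H2 \<inter> H3 = H1 \<inter> H2 \<inter> H3"

definition deletion :: "'e matroid \<Rightarrow> 'e \<Rightarrow> 'e matroid" where
  "deletion M e = \<lparr>ground = ground M - {e}, circuits = {C \<in> circuits M. e \<notin> C}\<rparr>"

definition two_sum :: "'e matroid \<Rightarrow> 'e matroid \<Rightarrow> 'e \<Rightarrow> 'e matroid" where
  "two_sum M1 M2 p =
     \<lparr>ground = (ground M1 \<union> ground M2) - {p},
      circuits = circuits (deletion M1 p) \<union> circuits (deletion M2 p) \<union>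
        {(C1 \<union> C2) - {p} |C1 C2. C1 \<in> circuits M1 \<and> C2 \<in> circuits M2 \<and> p \<in> C1 \<and> p \<in> C2}\<rparr>"

text \<open>A formal sum \<open>a + b + c\<close> is the multiset \<open>{#a, b, c#}\<close>.\<close>

record 'u pasture = "'u monoid" +
  zer :: 'u
  nullset :: "'u multiset set"

text \<open>The equation for \<^const>\<open>Units\<close> says that the nonzero elements form the group of units;
  in particular \<open>0 \<noteq> 1\<close>.\<close>

definition pasture :: "'u pasture \<Rightarrow> bool" where
  "pasture P \<longleftrightarrow>
     comm_monoid P \<and>
     zer P \<in> carrier P \<and>
     (\<forall>a\<in>carrier P. zer P \<otimes>\<^bsub>P\<^esub> a = zer P) \<and>
     Units P = carrier P - {zer P} \<and>
     nullset P \<subseteq> {{#a, b, c#} |a b c. a \<in> carrier P \<and> b \<in> carrier P \<and> c \<in> carrier P} \<and>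
     (\<forall>a\<in>carrier P. {#a, zer P, zer P#} \<in> nullset P \<longleftrightarrow> a = zer P) \<and>
     (\<forall>d\<in>carrier P. \<forall>X\<in>nullset P. image_mset (\<lambda>a. d \<otimes>\<^bsub>P\<^esub> a) X \<in> nullset P) \<and>
     (\<exists>!u. u \<in> Units P \<and> {#\<one>\<^bsub>P\<^esub>, u, zer P#} \<in> nullset P)"

text \<open>Morphisms are extensional functions, so that equality of morphisms is equality in HOL;
  composition is \<^const>\<open>compose\<close>.\<close>

definition pasture_hom :: "'u pasture \<Rightarrow> 'v pasture \<Rightarrow> ('u \<Rightarrow> 'v) set" where
  "pasture_hom P Q =
     {h \<in> hom P Q. h \<in> extensional (carrier P) \<and>
        h (zer P) = zer Q \<and> h \<one>\<^bsub>P\<^esub> = \<one>\<^bsub>Q\<^esub> \<and>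
        (\<forall>X\<in>nullset P. image_mset h X \<in> nullset Q)}"

definition pasture_isomorphic :: "'u pasture \<Rightarrow> 'v pasture \<Rightarrow> bool" where
  "pasture_isomorphic P Q \<longleftrightarrow>
     (\<exists>g\<in>pasture_hom P Q. \<exists>h\<in>pasture_hom Q P.
        (\<forall>x\<in>carrier P. h (g x) = x) \<and> (\<forall>y\<in>carrier Q. g (h y) = y))"

definition representations ::
    "'e matroid \<Rightarrow> 'u pasture \<Rightarrow> ('e set \<Rightarrow> 'e \<Rightarrow> 'u) set" where
  "representations N P =
     {f \<in> hyperplanes N \<rightarrow>\<^sub>E (ground N \<rightarrow>\<^sub>E carrier P).
        (\<forall>H\<in>hyperplanes N. \<forall>e\<in>ground N. f H e = zer P \<longleftrightarrow> e \<in> H) \<and>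
        (\<forall>H1 H2 H3. modular_triple N H1 H2 H3 \<longrightarrow>
          (\<exists>c1\<in>carrier P. \<exists>c2\<in>carrier P. \<exists>c3\<in>carrier P.
             \<not> (c1 = zer P \<and> c2 = zer P \<and> c3 = zer P) \<and>
             (\<forall>e\<in>ground N.
                {#c1 \<otimes>\<^bsub>P\<^esub> f H1 e, c2 \<otimes>\<^bsub>P\<^esub> f H2 e, c3 \<otimes>\<^bsub>P\<^esub> f H3 e#} \<in> nullset P)))}"

definition rescaling_rel ::
    "'e matroid \<Rightarrow> 'u pasture \<Rightarrow> ('e set \<Rightarrow> 'e \<Rightarrow> 'u) rel" where
  "rescaling_rel N P =
     {(f, f'). f \<in> representations N P \<and> f' \<in> representations N P \<and>
        (\<exists>c d. (\<forall>H\<in>hyperplanes N. c H \<in> Units P) \<and> (\<forall>e\<in>ground N. d e \<in> Units P) \<and>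
           (\<forall>H\<in>hyperplanes N. \<forall>e\<in>ground N. f' H e = c H \<otimes>\<^bsub>P\<^esub> d e \<otimes>\<^bsub>P\<^esub> f H e))}"

definition rescaling_classes ::
    "'e matroid \<Rightarrow> 'u pasture \<Rightarrow> ('e set \<Rightarrow> 'e \<Rightarrow> 'u) set set" where
  "rescaling_classes N P = representations N P // rescaling_rel N P"

definition push_rep ::
    "'e matroid \<Rightarrow> ('u \<Rightarrow> 'v) \<Rightarrow> ('e set \<Rightarrow> 'e \<Rightarrow> 'u) \<Rightarrow> ('e set \<Rightarrow> 'e \<Rightarrow> 'v)" where
  "push_rep N h f = (\<lambda>H\<in>hyperplanes N. \<lambda>e\<in>ground N. h (f H e))"

text \<open>The map on rescaling classes induced by a morphism into \<open>Q\<close>: the image of a class need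
  not be a whole class, hence the saturation.\<close>

definition push_class ::
    "'e matroid \<Rightarrow> 'v pasture \<Rightarrow> ('u \<Rightarrow> 'v) \<Rightarrow>
     ('e set \<Rightarrow> 'e \<Rightarrow> 'u) set \<Rightarrow> ('e set \<Rightarrow> 'e \<Rightarrow> 'v) set" where
  "push_class N Q h K = rescaling_rel N Q `` (push_rep N h ` K)"

text \<open>The universal properties below are tested on the pastures whose carrier lies in the type
  \<open>'u\<close> of the pasture itself, since HOL cannot quantify over types inside a formula.  For
  infinite \<open>'u\<close> this loses nothing: the foundation of a finite matroid is countable and the
  coproduct of two pastures has at most as many elements as the product of their carriers, so both
  have copies in \<open>'u\<close>, and objects with these universal properties within \<open>'u\<close> are isomorphic
  to them.\<close>

definition is_foundation :: "'e matroid \<Rightarrow> 'u pasture \<Rightarrow> bool" where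
  "is_foundation N F \<longleftrightarrow>
     pasture F \<and>
     (\<exists>\<Phi> :: 'u pasture \<Rightarrow> ('u \<Rightarrow> 'u) \<Rightarrow> ('e set \<Rightarrow> 'e \<Rightarrow> 'u) set.
        (\<forall>P. pasture P \<longrightarrow> bij_betw (\<Phi> P) (pasture_hom F P) (rescaling_classes N P)) \<and>
        (\<forall>P Q. pasture P \<and> pasture Q \<longrightarrow>
           (\<forall>h\<in>pasture_hom P Q. \<forall>g\<in>pasture_hom F P.
              \<Phi> Q (compose (carrier F) h g) = push_class N Q h (\<Phi> P g))))"

definition is_tensor_product :: "'u pasture \<Rightarrow> 'u pasture \<Rightarrow> 'u pasture \<Rightarrow> bool" where
  "is_tensor_product A B T \<longleftrightarrow>
     pasture T \<and>
     (\<exists>i\<in>pasture_hom A T. \<exists>j\<in>pasture_hom B T.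
        \<forall>R :: 'u pasture. pasture R \<longrightarrow>
          (\<forall>f\<in>pasture_hom A R. \<forall>g\<in>pasture_hom B R.
             \<exists>!h. h \<in> pasture_hom T R \<and>
               compose (carrier A) h i = f \<and> compose (carrier B) h j = g))"

end

theory Submission
  imports Defs
begin

text \<open>
Write \<open>N\<close> for the 2-sum and \<open>E\<^sub>i\<close> for the ground set of \<open>M\<^sub>i\<close>. The hyperplanes of \<open>N\<close> are
\<open>(K \<union> E\<^sub>2) - p\<close> and \<open>(E\<^sub>1 \<union> K) - p\<close> for hyperplanes \<open>K\<close> through \<open>p\<close> of the summands, and \<open>A \<union> B\<close> for
hyperplanes \<open>A\<close>, \<open>B\<close> avoiding \<open>p\<close>. Fixing \<open>B\<close>, the hyperplanes of \<open>M\<^sub>1\<close> embed into those of \<open>N\<close>, and every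
modular triple of \<open>N\<close> is the image of a modular triple of one summand under such an embedding.
Hence a representation of \<open>N\<close> restricts to \<open>M\<^sub>1\<close> (an element of \<open>E\<^sub>2\<close> outside \<open>B\<close> and \<open>p\<close> plays the role of \<open>p\<close>)
and to \<open>M\<^sub>2\<close>. Conversely \<open>f\<^sub>1\<close> and \<open>f\<^sub>2\<close> glue to the representation whose row at \<open>A \<union> B\<close> is
\<open>f\<^sub>2 B p \<cdot> f\<^sub>1 A\<close> on \<open>E\<^sub>1\<close> and \<open>f\<^sub>1 A p \<cdot> f\<^sub>2 B\<close> on \<open>E\<^sub>2\<close>. These constructions are mutually inverse on rescaling classes.
The essential point is that the hyperplanes of a matroid avoiding \<open>p\<close> are connected through modular
triples whose third member contains \<open>p\<close>: such triples force the rows at \<open>A \<union> B\<close> and \<open>A \<union> B'\<close> to be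
proportional on \<open>E\<^sub>1\<close>, and force a representation to be determined, up to rescaling, by its values off \<open>p\<close>.
So \<open>F(N)\<close> represents the functor represented by \<open>F(M\<^sub>1) \<otimes> F(M\<^sub>2)\<close>, that is, it has the universal property of the coproduct.
\<close>

subsection \<open>Rank, flats and hyperplanes\<close>

text \<open>The part of rank theory that rests only on finiteness and on the empty set being
  independent. It is split off so that it also applies to the 2-sum, whose ranks are computed
  directly from its circuits.\<close>

locale ranked =
  fixes M :: "'e matroid"
  assumes finite_ground: "finite (ground M)"
    and empty_not_circuit: "{} \<notin> circuits M"
begin

lemma indep_empty: "indep M {}"
  using empty_not_circuit by (auto simp: indep_def)

lemma indep_subset: "indep M I \<Longrightarrow> J \<subseteq> I \<Longrightarrow> indep M J"
  unfolding indep_def by (meson subset_trans)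

lemma indep_ground: "indep M I \<Longrightarrow> I \<subseteq> ground M"
  by (auto simp: indep_def)

lemma indep_finite: "indep M I \<Longrightarrow> finite I"
  using finite_ground finite_subset indep_ground by blast

lemma finite_indep_cards: "finite {card I |I. indep M I \<and> I \<subseteq> X}"
proof (rule finite_subset)
  show "{card I |I. indep M I \<and> I \<subseteq> X} \<subseteq> card ` Pow (ground M)"
    using indep_ground by blast
qed (use finite_ground in simp)

lemma card_le_rank: "indep M I \<Longrightarrow> I \<subseteq> X \<Longrightarrow> card I \<le> rank M X"
  unfolding rank_def using finite_indep_cards by (intro Max_ge) auto

lemma rank_attained: obtains I where "indep M I" "I \<subseteq> X" "card I = rank M X"
proof -
  have "rank M X \<in> {card I |I. indep M I \<and> I \<subseteq> X}"
    unfolding rank_def using finite_indep_cards indep_empty by (intro Max_in) auto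
  then show thesis using that by auto
qed

lemma rank_le: "(\<And>I. indep M I \<Longrightarrow> I \<subseteq> X \<Longrightarrow> card I \<le> n) \<Longrightarrow> rank M X \<le> n"
  by (metis rank_attained)

lemma rank_mono: "X \<subseteq> Y \<Longrightarrow> rank M X \<le> rank M Y"
  by (meson card_le_rank order_trans rank_le)

lemma flat_psubset_rank:
  assumes "flat M X" "X \<subset> Y" "Y \<subseteq> ground M"
  shows "rank M X < rank M Y"
proof -
  obtain e where e: "e \<in> Y - X" using assms by blast
  then have "rank M X < rank M (insert e X)" using assms by (auto simp: flat_def)
  also have "\<dots> \<le> rank M Y" using e assms by (intro rank_mono) auto
  finally show ?thesis .
qed

lemma flat_eqI:
  assumes "flat M X" "X \<subseteq> Y" "Y \<subseteq> ground M" "rank M Y \<le> rank M X"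
  shows "X = Y"
  using flat_psubset_rank[OF assms(1) _ assms(3)] assms by fastforce

lemma hyperplane_subset_eq:
  assumes "H \<in> hyperplanes M" "K \<in> hyperplanes M" "H \<subseteq> K"
  shows "H = K"
  using assms by (intro flat_eqI) (auto simp: hyperplanes_def corank_flat_def flat_def)

lemma hyperplane_ground: "H \<in> hyperplanes M \<Longrightarrow> H \<subseteq> ground M"
  by (auto simp: hyperplanes_def corank_flat_def flat_def)

end

section \<open>Augmentation and submodular rank from the circuit axioms\<close>

locale circuit_matroid =
  fixes M :: "'e matroid"
  assumes matroid: "matroid M"

sublocale circuit_matroid \<subseteq> ranked
  using matroid by unfold_locales (auto simp: matroid_def)

context circuit_matroid
begin

lemma circuit_ground: "C \<in> circuits M \<Longrightarrow> C \<subseteq> ground M"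
  using matroid by (auto simp: matroid_def)

lemma circuit_elimination:
  assumes "C \<in> circuits M" "D \<in> circuits M" "C \<noteq> D" "e \<in> C" "e \<in> D"
  obtains K where "K \<in> circuits M" "K \<subseteq> (C \<union> D) - {e}"
  using matroid assms unfolding matroid_def by (meson IntI)

text \<open>The classical exchange argument: among the independent subsets of
  \<open>I \<union> J\<close> larger than \<open>I\<close>, take a \<open>K\<close> that misses as
  few elements of \<open>I\<close> as possible. Two distinct circuits inside
  \<open>insert e K\<close> then share \<open>e\<close>, and elimination leaves a circuit inside
  \<open>K\<close>.\<close>

lemma augmentation:
  assumes I: "indep M I" and J: "indep M J" and less: "card I < card J"
  obtains e where "e \<in> J - I" "indep M (insert e I)"
proof (rule ccontr)
  assume no: "\<not> thesis"
  define S where "S = {K. indep M K \<and> K \<subseteq> I \<union> J \<and> card I < card K}"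
  have "J \<in> S" using assms by (auto simp: S_def)
  then obtain K where K: "K \<in> S" and min: "\<And>L. L \<in> S \<Longrightarrow> card (I - K) \<le> card (I - L)"
    using arg_min_natI[of "\<lambda>K. K \<in> S" J "\<lambda>K. card (I - K)"]
      arg_min_nat_le[of "\<lambda>K. K \<in> S" _ "\<lambda>K. card (I - K)"] by metis
  have iK: "indep M K" and KIJ: "K \<subseteq> I \<union> J" and cK: "card I < card K"
    using K by (auto simp: S_def)
  have fin: "finite I" "finite K" using I iK indep_finite by auto
  have "\<not> K \<subseteq> I" using cK fin by (meson card_mono not_le)
  then obtain g where g: "g \<in> K - I" by blast
  have "\<not> I \<subseteq> K"
  proof
    assume "I \<subseteq> K"
    then have "indep M (insert g I)" using g iK indep_subset by (metis DiffD1 insert_subset)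
    then show False using no that g KIJ by blast
  qed
  then obtain e where e: "e \<in> I - K" by blast
  \<comment> \<open>Trading \<open>f\<close> for \<open>e\<close> keeps the size of \<open>K\<close>
    and misses fewer elements of \<open>I\<close>, so by the choice of \<open>K\<close> the result
    is dependent. Its circuit passes through \<open>e\<close> because \<open>K\<close> itself is
    independent.\<close>
  have circ: "\<exists>C\<in>circuits M. e \<in> C \<and> f \<notin> C \<and> C \<subseteq> insert e K" if f: "f \<in> K - I" for f
  proof -
    define T where "T = insert e K - {f}"
    have "card T = card K" using e f fin by (auto simp: T_def card_insert_if card_Diff_singleton_if)
    moreover have "T \<subseteq> I \<union> J" using e KIJ by (auto simp: T_def)
    moreover have "I - T \<subset> I - K" using e f by (auto simp: T_def)
    then have "card (I - T) < card (I - K)" using fin by (intro psubset_card_mono) auto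
    ultimately have "\<not> indep M T" using min[of T] cK by (auto simp: S_def)
    moreover have "T \<subseteq> ground M" using e indep_ground[OF I] indep_ground[OF iK] by (auto simp: T_def)
    ultimately obtain C where C: "C \<in> circuits M" "C \<subseteq> T" by (auto simp: indep_def)
    moreover have "e \<in> C"
    proof (rule ccontr)
      assume "e \<notin> C"
      then have "C \<subseteq> K" using C by (auto simp: T_def)
      then show False using iK C by (auto simp: indep_def)
    qed
    ultimately show ?thesis by (auto simp: T_def)
  qed
  obtain C where C: "C \<in> circuits M" "e \<in> C" "C \<subseteq> insert e K" using circ[OF g] by blast
  have "\<not> C \<subseteq> I" using I C by (auto simp: indep_def)
  then obtain h where h: "h \<in> C" "h \<in> K - I" using C e by blast
  \<comment> \<open>The circuit obtained for \<open>h\<close> avoids \<open>h\<close>, hence differs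
    from \<open>C\<close>.\<close>
  obtain D where D: "D \<in> circuits M" "e \<in> D" "h \<notin> D" "D \<subseteq> insert e K" using circ[OF h(2)] by blast
  have "C \<noteq> D" using h D by blast
  then obtain Z where "Z \<in> circuits M" "Z \<subseteq> (C \<union> D) - {e}"
    using circuit_elimination C D by metis
  moreover have "(C \<union> D) - {e} \<subseteq> K" using C D by blast
  ultimately show False using iK unfolding indep_def by (meson subset_trans)
qed

lemma indep_extend:
  assumes "indep M I" "I \<subseteq> X"
  obtains J where "indep M J" "I \<subseteq> J" "J \<subseteq> X" "card J = rank M X"
proof -
  have "\<exists>J. indep M J \<and> I \<subseteq> J \<and> J \<subseteq> X \<and> card J = rank M X"
    using assms
  proof (induction "rank M X - card I" arbitrary: I rule: less_induct)
    case less
    show ?case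
    proof (cases "card I = rank M X")
      case True
      then show ?thesis using less.prems by blast
    next
      case False
      then have lt: "card I < rank M X" using card_le_rank less.prems by (simp add: order_less_le)
      obtain K where K: "indep M K" "K \<subseteq> X" "card K = rank M X" by (rule rank_attained)
      then obtain e where e: "e \<in> K - I" "indep M (insert e I)"
        using augmentation[OF less.prems(1) K(1)] lt by metis
      have "card (insert e I) = Suc (card I)" using e less.prems indep_finite by simp
      then obtain J where "indep M J" "insert e I \<subseteq> J" "J \<subseteq> X" "card J = rank M X"
        using less.hyps[OF _ e(2)] lt e K less.prems by (metis DiffD1 Suc_diff_Suc insert_subset lessI subset_iff)
      then show ?thesis by blast
    qed
  qed
  then show thesis using that by blast
qed

lemma rank_insert_le: "rank M (insert e X) \<le> Suc (rank M X)"
proof (rule rank_le)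
  fix I assume I: "indep M I" "I \<subseteq> insert e X"
  have "card I \<le> Suc (card (I - {e}))" using card_Diff1_le[of I e] by (metis I(1) card_Suc_Diff1 indep_finite Diff_insert0 Diff_empty le_SucI order_refl)
  moreover have "card (I - {e}) \<le> rank M X"
    using I by (intro card_le_rank indep_subset[OF I(1)]) auto
  ultimately show "card I \<le> Suc (rank M X)" by simp
qed

text \<open>A maximal independent subset of \<open>X \<inter> Y\<close> extends to one of
  \<open>X \<union> Y\<close>; counting the latter inside \<open>X\<close> and inside
  \<open>Y\<close> counts its part in the intersection twice.\<close>

lemma rank_submodular: "rank M (X \<union> Y) + rank M (X \<inter> Y) \<le> rank M X + rank M Y"
proof -
  obtain I where I: "indep M I" "I \<subseteq> X \<inter> Y" "card I = rank M (X \<inter> Y)" by (rule rank_attained)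
  then obtain K where K: "indep M K" "I \<subseteq> K" "K \<subseteq> X \<union> Y" "card K = rank M (X \<union> Y)"
    using indep_extend[of I "X \<union> Y"] by blast
  have fK: "finite K" using K indep_finite by blast
  have "K = (K \<inter> X) \<union> (K \<inter> Y)" using K by blast
  then have "card K + card ((K \<inter> X) \<inter> (K \<inter> Y)) = card (K \<inter> X) + card (K \<inter> Y)"
    using card_Un_Int[of "K \<inter> X" "K \<inter> Y"] fK by simp
  moreover have "card I \<le> card ((K \<inter> X) \<inter> (K \<inter> Y))" using I K fK by (intro card_mono) auto
  moreover have "card (K \<inter> X) \<le> rank M X" "card (K \<inter> Y) \<le> rank M Y"
    using indep_subset[OF K(1)] by (auto intro!: card_le_rank)
  ultimately show ?thesis using I K by linarith
qed

text \<open>Diminishing returns, from submodularity for \<open>insert e X\<close> and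
  \<open>Y\<close>: what a set spans is spanned by every larger set.\<close>

lemma rank_insert_mono:
  assumes "X \<subseteq> Y" "rank M (insert e X) \<le> rank M X"
  shows "rank M (insert e Y) = rank M Y"
proof -
  have "rank M (insert e X \<union> Y) + rank M (insert e X \<inter> Y) \<le> rank M (insert e X) + rank M Y"
    by (rule rank_submodular)
  moreover have "insert e X \<union> Y = insert e Y" using assms by auto
  moreover have "rank M X \<le> rank M (insert e X \<inter> Y)" using assms by (intro rank_mono) auto
  moreover have "rank M Y \<le> rank M (insert e Y)" by (intro rank_mono) auto
  ultimately show ?thesis using assms by simp
qed

section \<open>The closure operator, flats and hyperplanes\<close>

definition span_of :: "'e set \<Rightarrow> 'e set" where
  "span_of X = {e \<in> ground M. rank M (insert e X) = rank M X}"

lemma subset_span: "X \<subseteq> ground M \<Longrightarrow> X \<subseteq> span_of X"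
  by (auto simp: span_of_def insert_absorb)

lemma span_ground: "span_of X \<subseteq> ground M"
  by (auto simp: span_of_def)

lemma rank_span:
  assumes "X \<subseteq> ground M"
  shows "rank M (span_of X) = rank M X"
proof -
  have "rank M (X \<union> S) = rank M X" if "finite S" "S \<subseteq> span_of X" for S
    using that
  proof (induction S)
    case (insert e S)
    then have "rank M (insert e (X \<union> S)) = rank M (X \<union> S)"
      by (intro rank_insert_mono[of X]) (auto simp: span_of_def)
    then show ?case using insert by simp
  qed simp
  from this[of "span_of X"] show ?thesis
    using subset_span[OF assms] finite_subset[OF span_ground finite_ground]
    by (simp add: Un_absorb1)
qed

lemma flat_span:
  assumes "X \<subseteq> ground M"
  shows "flat M (span_of X)"
  unfolding flat_def
proof (intro conjI ballI)
  fix e assume e: "e \<in> ground M - span_of X"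
  have "rank M X < rank M (insert e X)"
    using e rank_mono[OF subset_insertI, of X e] by (auto simp: span_of_def)
  also have "\<dots> \<le> rank M (insert e (span_of X))"
    using subset_span[OF assms] by (intro rank_mono) auto
  finally show "rank M (span_of X) < rank M (insert e (span_of X))"
    using rank_span[OF assms] by simp
qed (rule span_ground)

lemma span_subset_flat:
  assumes "flat M F" "X \<subseteq> F"
  shows "span_of X \<subseteq> F"
proof
  fix e assume e: "e \<in> span_of X"
  then have "rank M (insert e F) = rank M F"
    using assms by (intro rank_insert_mono[of X]) (auto simp: span_of_def)
  then show "e \<in> F" using assms e by (auto simp: flat_def span_of_def dest: bspec[of _ _ e])
qed

lemma flat_Int:
  assumes "flat M F" "flat M G"
  shows "flat M (F \<inter> G)"
proof -
  have FG: "F \<inter> G \<subseteq> ground M" using assms by (auto simp: flat_def)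
  have "span_of (F \<inter> G) \<subseteq> F \<inter> G"
    using assms span_subset_flat by (metis Int_lower1 Int_lower2 le_inf_iff)
  then have "F \<inter> G = span_of (F \<inter> G)" using subset_span[OF FG] by blast
  then show ?thesis using flat_span[OF FG] by simp
qed

lemma flat_ground: "flat M (ground M)"
  by (auto simp: flat_def)

lemma rank_insert_flat: "flat M F \<Longrightarrow> e \<in> ground M - F \<Longrightarrow> rank M (insert e F) = Suc (rank M F)"
  using rank_insert_le[of e F] by (force simp: flat_def)

text \<open>A maximal flat among those that contain \<open>F\<close> and avoid \<open>p\<close> is a
  hyperplane, since its closure with \<open>p\<close> is everything.\<close>

lemma hyperplane_avoiding:
  assumes F: "flat M F" and p: "p \<in> ground M - F"
  obtains H where "H \<in> hyperplanes M" "F \<subseteq> H" "p \<notin> H"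
proof -
  define S where "S = {G. flat M G \<and> F \<subseteq> G \<and> p \<notin> G}"
  have "S \<subseteq> Pow (ground M)" by (auto simp: S_def flat_def)
  then have finS: "finite S" using finite_ground finite_subset by blast
  have "F \<in> S" using assms by (auto simp: S_def)
  then obtain G where G: "G \<in> S" and max: "\<And>K. K \<in> S \<Longrightarrow> G \<subseteq> K \<Longrightarrow> G = K"
    using finS finite_has_maximal2[of S F] by metis
  have fG: "flat M G" and FG: "F \<subseteq> G" and pG: "p \<notin> G" using G by (auto simp: S_def)
  have G_ground: "G \<subseteq> ground M" using fG by (auto simp: flat_def)
  have r: "rank M (insert p G) = Suc (rank M G)" using rank_insert_flat fG pG p by simp
  have "span_of (insert p G) = ground M"
  proof (rule ccontr)
    assume "span_of (insert p G) \<noteq> ground M"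
    then obtain e where e: "e \<in> ground M" "e \<notin> span_of (insert p G)"
      using span_ground by blast
    have eG: "e \<notin> G" using e subset_span[of "insert p G"] G_ground p by auto
    have re: "rank M (insert e G) = Suc (rank M G)" using rank_insert_flat fG eG e by simp
    have "rank M (insert e (insert p G)) \<noteq> rank M (insert p G)" using e by (auto simp: span_of_def)
    \<comment> \<open>Exchange: adding both \<open>e\<close> and \<open>p\<close> to
      \<open>G\<close> raises the rank by two, so \<open>e\<close> does not span \<open>p\<close>
      over \<open>G\<close>, and the closure of \<open>insert e G\<close> is a larger flat avoiding
      \<open>p\<close>.\<close>
    then have "p \<notin> span_of (insert e G)" using r re by (auto simp: span_of_def insert_commute)
    then have "span_of (insert e G) \<in> S"
      using flat_span[of "insert e G"] subset_span[of "insert e G"] G_ground e FG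
      by (auto simp: S_def)
    moreover have "insert e G \<subseteq> span_of (insert e G)"
      using subset_span[of "insert e G"] G_ground e by blast
    ultimately show False using max eG by blast
  qed
  then have "rank M (ground M) = Suc (rank M G)"
    using rank_span[of "insert p G"] r G_ground p by auto
  then show thesis using that[of G] fG FG pG by (auto simp: hyperplanes_def corank_flat_def)
qed

section \<open>Modular triples and connectivity of the hyperplanes avoiding an element\<close>

lemma hyperplane_flat: "H \<in> hyperplanes M \<Longrightarrow> flat M H"
  and hyperplane_rank: "H \<in> hyperplanes M \<Longrightarrow> Suc (rank M H) = rank M (ground M)"
  by (auto simp: hyperplanes_def corank_flat_def)

lemma hyperplaneI: "flat M H \<Longrightarrow> Suc (rank M H) = rank M (ground M) \<Longrightarrow> H \<in> hyperplanes M"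
  by (auto simp: hyperplanes_def corank_flat_def)

lemma rank_hyperplane_Int_less:
  assumes "A \<in> hyperplanes M" "B \<in> hyperplanes M" "A \<noteq> B"
  shows "rank M (A \<inter> B) + 2 \<le> rank M (ground M)"
proof -
  have "A \<inter> B \<subset> A" using assms hyperplane_subset_eq by blast
  then have "rank M (A \<inter> B) < rank M A"
    using assms flat_psubset_rank flat_Int hyperplane_flat hyperplane_ground by metis
  then show ?thesis using hyperplane_rank[OF assms(1)] by simp
qed

text \<open>The third hyperplane is the closure of \<open>insert p (A \<inter> B)\<close>. A
  hyperplane that contains \<open>A \<inter> B\<close> and avoids \<open>p\<close> cuts it in a
  proper subflat, whose rank is at most that of \<open>A \<inter> B\<close>, hence in
  \<open>A \<inter> B\<close> itself.\<close>

lemma modular_triple_through: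
  assumes A: "A \<in> hyperplanes M" "p \<notin> A" and B: "B \<in> hyperplanes M" "p \<notin> B"
    and p: "p \<in> ground M" and r: "rank M (A \<inter> B) + 2 = rank M (ground M)"
  obtains H where "p \<in> H" "modular_triple M H A B"
proof -
  define L where "L = A \<inter> B"
  have fL: "flat M L" using A B flat_Int hyperplane_flat by (auto simp: L_def)
  have L_ground: "insert p L \<subseteq> ground M" using fL p by (auto simp: flat_def)
  define H where "H = span_of (insert p L)"
  have fH: "flat M H" using flat_span L_ground by (simp add: H_def)
  have rH: "rank M H = Suc (rank M L)"
    using rank_span[OF L_ground] rank_insert_flat[OF fL] p A by (auto simp: H_def L_def)
  have LH: "insert p L \<subseteq> H" using subset_span[OF L_ground] by (simp add: H_def)
  have *: "H \<inter> K = L" if K: "K \<in> hyperplanes M" "p \<notin> K" "L \<subseteq> K" for K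
  proof -
    have "flat M (H \<inter> K)" using fH K hyperplane_flat flat_Int by simp
    moreover have "H \<inter> K \<subset> H" using LH K by blast
    ultimately have "rank M (H \<inter> K) < rank M H"
      using flat_psubset_rank fH by (auto simp: flat_def)
    then show ?thesis
      using flat_eqI[OF fL, of "H \<inter> K"] LH K rH fH by (auto simp: flat_def)
  qed
  have "modular_triple M H A B"
    unfolding modular_triple_def
    using A B * fH fL rH r *[of A] *[of B]
    by (auto simp: corank_flat_def hyperplanes_def L_def Int_assoc)
  then show thesis using that LH by blast
qed

text \<open>Induction on the corank of \<open>A \<inter> B\<close>: if it exceeds 2, some hyperplane avoiding \<open>p\<close> meets both
  \<open>A\<close> and \<open>B\<close> in strictly larger flats.\<close>

lemma hyperplanes_avoiding_connected:
  assumes A: "A \<in> hyperplanes M" "p \<notin> A" and B: "B \<in> hyperplanes M" "p \<notin> B"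
    and p: "p \<in> ground M"
  shows "(A, B) \<in> {(K, K'). p \<notin> K \<and> p \<notin> K' \<and> (\<exists>H. p \<in> H \<and> modular_triple M H K K')}\<^sup>*"
    (is "_ \<in> ?R\<^sup>*")
  using A B
proof (induction "rank M (ground M) - rank M (A \<inter> B)" arbitrary: A B rule: less_induct)
  case less
  note A = less.prems(1,2) and B = less.prems(3,4)
  show ?case
  proof (cases "A = B")
    case False
    define L where "L = A \<inter> B"
    have fL: "flat M L" using A B flat_Int hyperplane_flat by (auto simp: L_def)
    have le: "rank M L + 2 \<le> rank M (ground M)"
      using rank_hyperplane_Int_less[OF A(1) B(1) False] by (simp add: L_def)
    show ?thesis
    proof (cases "rank M L + 2 = rank M (ground M)")
      case True
      then obtain H where "p \<in> H" "modular_triple M H A B"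
        using modular_triple_through[OF A B p] by (auto simp: L_def)
      then show ?thesis using A B by (intro r_into_rtrancl) blast
    next
      case far: False
      obtain y where y: "y \<in> B - L" using hyperplane_subset_eq[OF B(1) A(1)] False by (auto simp: L_def)
      have y_ground: "y \<in> ground M" using y B hyperplane_ground by blast
      have L_ground: "L \<subseteq> ground M" using fL by (simp add: flat_def)
      \<comment> \<open>Some hyperplane through \<open>L\<close>, \<open>x\<close> and
        \<open>y\<close> should still avoid \<open>p\<close>. If every \<open>x\<close> failed,
        exchange would put \<open>A\<close> inside the closure of
        \<open>insert p (insert y L)\<close>. As \<open>L\<close> has corank above 2, the rank of
        that closure is at most that of \<open>A\<close>, so the two would coincide and
        \<open>A\<close> would contain \<open>p\<close>.\<close>
      have "\<exists>x\<in>A - L. p \<notin> span_of (insert x (insert y L))"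
      proof (rule ccontr)
        assume "\<not> ?thesis"
        then have all: "\<And>x. x \<in> A - L \<Longrightarrow> p \<in> span_of (insert x (insert y L))" by blast
        define Z where "Z = insert p (insert y L)"
        have Zg: "Z \<subseteq> ground M" using p y_ground L_ground by (simp add: Z_def)
        have ry: "rank M (insert y L) = Suc (rank M L)" using rank_insert_flat[OF fL] y y_ground by simp
        have "p \<notin> span_of (insert y L)"
          using span_subset_flat[OF hyperplane_flat[OF B(1)], of "insert y L"] y B by (auto simp: L_def)
        then have rZ: "rank M Z = rank M L + 2"
          using ry rank_insert_le[of p "insert y L"] rank_mono[OF subset_insertI, of "insert y L" p] p
          by (auto simp: Z_def span_of_def)
        have "A \<subseteq> span_of Z"
        proof
          fix x assume x: "x \<in> A"
          show "x \<in> span_of Z"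
          proof (cases "x \<in> L")
            case True
            then show ?thesis using subset_span[OF Zg] by (auto simp: Z_def)
          next
            case False
            then have "rank M (insert p (insert x (insert y L))) = rank M (insert x (insert y L))"
              using all x by (auto simp: span_of_def)
            moreover have "\<dots> \<le> rank M L + 2" using ry rank_insert_le[of x "insert y L"] by simp
            ultimately have "rank M (insert x Z) \<le> rank M Z" using rZ by (simp add: Z_def insert_commute)
            moreover have "rank M Z \<le> rank M (insert x Z)" by (intro rank_mono) auto
            ultimately show ?thesis using x A hyperplane_ground by (auto simp: span_of_def)
          qed
        qed
        moreover have "rank M (span_of Z) \<le> rank M A"
          using rank_span[OF Zg] rZ le far hyperplane_rank[OF A(1)] by simp
        ultimately have "A = span_of Z"
          using flat_eqI hyperplane_flat[OF A(1)] span_ground by blast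
        then show False using A subset_span[OF Zg] by (auto simp: Z_def)
      qed
      then obtain x where x: "x \<in> A - L" "p \<notin> span_of (insert x (insert y L))" by blast
      let ?Y = "insert x (insert y L)"
      have Yg: "?Y \<subseteq> ground M" using x y_ground L_ground A hyperplane_ground by blast
      obtain H where H: "H \<in> hyperplanes M" "span_of ?Y \<subseteq> H" "p \<notin> H"
        using hyperplane_avoiding[OF flat_span[OF Yg]] x p by blast
      have YH: "?Y \<subseteq> H" using H subset_span[OF Yg] by blast
      have "rank M L < rank M (A \<inter> H)"
        using YH x A hyperplane_ground by (intro flat_psubset_rank[OF fL]) (auto simp: L_def)
      moreover have "rank M L < rank M (H \<inter> B)"
        using YH y B hyperplane_ground by (intro flat_psubset_rank[OF fL]) (auto simp: L_def)
      \<comment> \<open>The measure is a truncated difference of naturals; it drops strictly because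
        it is positive at \<open>L\<close>.\<close>
      moreover have "rank M L < rank M (ground M)" using le by simp
      ultimately have "(A, H) \<in> ?R\<^sup>*" "(H, B) \<in> ?R\<^sup>*"
        using less.hyps[of A H] less.hyps[of H B] A B H by (simp_all add: L_def)
      then show ?thesis by (rule rtrancl_trans)
    qed
  qed simp
qed

end

section \<open>Elements that are not loops or not coloops\<close>

context circuit_matroid
begin

text \<open>A non-coloop is missed by some basis, and augmentation makes every basis as large as the
  rank.\<close>

lemma rank_ground_minus:
  assumes "p \<in> ground M" "\<not> coloop M p"
  shows "rank M (ground M - {p}) = rank M (ground M)"
proof -
  obtain B where B: "basis M B" "p \<notin> B" using assms by (auto simp: coloop_def)
  have iB: "indep M B" using B by (simp add: basis_def)
  then obtain J where J: "indep M J" "B \<subseteq> J" "card J = rank M (ground M)"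
    using indep_extend indep_ground by metis
  then have "J = B" using B by (auto simp: basis_def)
  moreover have "card B \<le> rank M (ground M - {p})"
    using iB B indep_ground by (intro card_le_rank) auto
  ultimately show ?thesis using J rank_mono[of "ground M - {p}" "ground M"] by auto
qed

lemma indep_singleton: "p \<in> ground M \<Longrightarrow> \<not> loop M p \<Longrightarrow> indep M {p}"
  using empty_not_circuit by (auto simp: indep_def loop_def subset_singleton_iff)

text \<open>Supplies the independent sets behind the lower bound for the rank of a 2-sum:
  \<open>J\<close> leaves room for \<open>p\<close> and is as large as that permits.\<close>

lemma basis_through:
  assumes "indep M {p}" "p \<notin> X"
  obtains J where "J \<subseteq> X" "indep M (insert p J)" "Suc (card J) = rank M (insert p X)"
proof -
  obtain K where K: "indep M K" "{p} \<subseteq> K" "K \<subseteq> insert p X" "card K = rank M (insert p X)"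
    using indep_extend[OF assms(1), of "insert p X"] by auto
  show thesis
  proof (rule that[of "K - {p}"])
    show "K - {p} \<subseteq> X" using K by auto
    show "indep M (insert p (K - {p}))" using K by (simp add: insert_absorb)
    show "Suc (card (K - {p})) = rank M (insert p X)"
      using K indep_finite[OF K(1)] card_Suc_Diff1[of K p] by simp
  qed
qed

text \<open>For a non-loop the closure of the empty set is a flat avoiding \<open>p\<close>.\<close>

lemma hyperplane_avoiding_nonloop:
  assumes "p \<in> ground M" "\<not> loop M p"
  obtains H where "H \<in> hyperplanes M" "p \<notin> H"
proof -
  have "card {p} \<le> rank M {p}" using indep_singleton assms by (intro card_le_rank) auto
  moreover have "rank M {} \<le> 0" by (rule rank_le) auto
  ultimately have "p \<notin> span_of {}" by (auto simp: span_of_def)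
  then show thesis using hyperplane_avoiding[OF flat_span, of "{}" p] assms that by auto
qed

end

subsection \<open>Flats and modular triples of a 2-sum\<close>

text \<open>Together with \<open>swap\<close> below, this transfers each one-sided statement to the
  other summand.\<close>

lemma two_sum_commute: "two_sum M1 M2 p = two_sum M2 M1 p"
proof -
  have "{(C1 \<union> C2) - {p} |C1 C2. C1 \<in> circuits M1 \<and> C2 \<in> circuits M2 \<and> p \<in> C1 \<and> p \<in> C2} =
    {(C1 \<union> C2) - {p} |C1 C2. C1 \<in> circuits M2 \<and> C2 \<in> circuits M1 \<and> p \<in> C1 \<and> p \<in> C2}"
    by (metis (no_types, opaque_lifting) Un_commute)
  then show ?thesis by (simp add: two_sum_def Un_commute)
qed

text \<open>In a 2-sum with second ground set \<open>E\<close>, this embeds the lattice of flats of the first summand, sending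
  hyperplanes to hyperplanes, when \<open>B\<close> is a hyperplane of the second summand avoiding \<open>p\<close>.\<close>

definition lift_flat :: "'e set \<Rightarrow> 'e \<Rightarrow> 'e set \<Rightarrow> 'e set \<Rightarrow> 'e set" where
  "lift_flat E p B F = (if p \<in> F then (F \<union> E) - {p} else F \<union> B)"

locale two_summands =
  M1: circuit_matroid M1 + M2: circuit_matroid M2
  for M1 M2 :: "'e matroid" +
  fixes p :: 'e
  assumes ground_Int: "ground M1 \<inter> ground M2 = {p}"
    and not_loop1: "\<not> loop M1 p" and not_coloop1: "\<not> coloop M1 p"
    and not_loop2: "\<not> loop M2 p" and not_coloop2: "\<not> coloop M2 p"
begin

abbreviation "N \<equiv> two_sum M1 M2 p"
abbreviation "E1 \<equiv> ground M1"
abbreviation "E2 \<equiv> ground M2"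

lemma swap: "two_summands M2 M1 p"
  using ground_Int not_loop1 not_coloop1 not_loop2 not_coloop2
  by unfold_locales auto

lemma p_ground: "p \<in> E1" "p \<in> E2"
  using ground_Int by auto

lemma ground_N: "ground N = (E1 \<union> E2) - {p}"
  by (simp add: two_sum_def)

section \<open>Independence and rank in the 2-sum\<close>

lemma ranked_two_sum: "ranked N"
proof
  show "finite (ground N)" using M1.finite_ground M2.finite_ground by (simp add: ground_N)
  show "{} \<notin> circuits N"
  proof
    assume "{} \<in> circuits N"
    then obtain C1 C2 where "C1 \<in> circuits M1" "p \<in> C1" "C1 \<union> C2 \<subseteq> {p}"
      using M1.empty_not_circuit M2.empty_not_circuit by (auto simp: two_sum_def deletion_def)
    then have "{p} \<in> circuits M1" by (metis Un_subset_iff empty_iff subset_singletonD)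
    then show False using not_loop1 by (simp add: loop_def)
  qed
qed

sublocale N: ranked N
  by (rule ranked_two_sum)

text \<open>A circuit \<open>(C \<union> D) - {p}\<close> fits into \<open>I1 \<union> I2\<close>
  exactly when \<open>insert p I1\<close> contains \<open>C\<close> and \<open>insert p I2\<close>
  contains \<open>D\<close>. Avoiding all such circuits therefore means that at least one side stays
  independent with \<open>p\<close> adjoined.\<close>

lemma indep_two_sum:
  assumes I1: "I1 \<subseteq> E1 - {p}" and I2: "I2 \<subseteq> E2 - {p}"
  shows "indep N (I1 \<union> I2) \<longleftrightarrow>
    indep M1 I1 \<and> indep M2 I2 \<and> (indep M1 (insert p I1) \<or> indep M2 (insert p I2))"
proof -
  have c1: "C \<subseteq> I1 \<union> I2 \<longleftrightarrow> C \<subseteq> I1" if "C \<in> circuits M1" "p \<notin> C" for C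
    using M1.circuit_ground[OF that(1)] that(2) ground_Int I1 I2 by blast
  have c2: "C \<subseteq> I1 \<union> I2 \<longleftrightarrow> C \<subseteq> I2" if "C \<in> circuits M2" "p \<notin> C" for C
    using M2.circuit_ground[OF that(1)] that(2) ground_Int I1 I2 by blast
  have c3: "(C \<union> D) - {p} \<subseteq> I1 \<union> I2 \<longleftrightarrow> C \<subseteq> insert p I1 \<and> D \<subseteq> insert p I2"
    if "C \<in> circuits M1" "D \<in> circuits M2" for C D
    using M1.circuit_ground[OF that(1)] M2.circuit_ground[OF that(2)] ground_Int I1 I2 by blast
  have "indep N (I1 \<union> I2) \<longleftrightarrow> (\<forall>C\<in>circuits N. \<not> C \<subseteq> I1 \<union> I2)"
    using I1 I2 by (auto simp: indep_def ground_N)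
  also have "\<dots> \<longleftrightarrow> (\<forall>C\<in>circuits M1. p \<notin> C \<longrightarrow> \<not> C \<subseteq> I1) \<and> (\<forall>C\<in>circuits M2. p \<notin> C \<longrightarrow> \<not> C \<subseteq> I2) \<and>
    (\<forall>C\<in>circuits M1. \<forall>D\<in>circuits M2. p \<in> C \<and> p \<in> D \<longrightarrow> \<not> (C \<subseteq> insert p I1 \<and> D \<subseteq> insert p I2))"
    (is "?L \<longleftrightarrow> ?R")
  proof -
    have "?L \<longleftrightarrow> (\<forall>C\<in>circuits M1. p \<notin> C \<longrightarrow> \<not> C \<subseteq> I1 \<union> I2) \<and>
      (\<forall>C\<in>circuits M2. p \<notin> C \<longrightarrow> \<not> C \<subseteq> I1 \<union> I2) \<and>
      (\<forall>C\<in>circuits M1. \<forall>D\<in>circuits M2. p \<in> C \<and> p \<in> D \<longrightarrow> \<not> (C \<union> D) - {p} \<subseteq> I1 \<union> I2)"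
      unfolding two_sum_def deletion_def by auto
    then show ?thesis using c1 c2 c3 by simp
  qed
  also have "\<dots> \<longleftrightarrow> indep M1 I1 \<and> indep M2 I2 \<and> (indep M1 (insert p I1) \<or> indep M2 (insert p I2))"
  proof -
    have a1: "indep M1 I1 \<longleftrightarrow> (\<forall>C\<in>circuits M1. p \<notin> C \<longrightarrow> \<not> C \<subseteq> I1)"
      and a2: "indep M2 I2 \<longleftrightarrow> (\<forall>C\<in>circuits M2. p \<notin> C \<longrightarrow> \<not> C \<subseteq> I2)"
      using I1 I2 by (auto simp: indep_def)
    have b1: "indep M1 (insert p I1) \<longleftrightarrow>
        indep M1 I1 \<and> (\<forall>C\<in>circuits M1. p \<in> C \<longrightarrow> \<not> C \<subseteq> insert p I1)"
      and b2: "indep M2 (insert p I2) \<longleftrightarrow>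
        indep M2 I2 \<and> (\<forall>C\<in>circuits M2. p \<in> C \<longrightarrow> \<not> C \<subseteq> insert p I2)"
      using I1 I2 p_ground by (auto simp: indep_def subset_insert)
    show ?thesis unfolding b1 b2 a1[symmetric] a2[symmetric] by blast
  qed
  finally show ?thesis .
qed

lemma split_card:
  assumes "X1 \<subseteq> E1 - {p}" "X2 \<subseteq> E2 - {p}"
  shows "card (X1 \<union> X2) = card X1 + card X2"
proof (rule card_Un_disjoint)
  show "finite X1" "finite X2"
    using assms M1.finite_ground M2.finite_ground by (meson finite_Diff finite_subset)+
  show "X1 \<inter> X2 = {}" using assms ground_Int by blast
qed

text \<open>In the second bound, the successor comes from the side of a maximal independent set that
  tolerates \<open>p\<close>: there the rank with \<open>p\<close> exceeds the number of chosen
  elements.\<close>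

lemma rank_two_sum_le:
  assumes X1: "X1 \<subseteq> E1 - {p}" and X2: "X2 \<subseteq> E2 - {p}"
  shows "rank N (X1 \<union> X2) \<le> rank M1 X1 + rank M2 X2"
    and "Suc (rank N (X1 \<union> X2)) \<le> rank M1 (insert p X1) + rank M2 (insert p X2)"
proof -
  obtain I where I: "indep N I" "I \<subseteq> X1 \<union> X2" "card I = rank N (X1 \<union> X2)"
    by (rule N.rank_attained)
  define I1 I2 where "I1 = I \<inter> X1" and "I2 = I \<inter> X2"
  have sub: "I1 \<subseteq> E1 - {p}" "I2 \<subseteq> E2 - {p}" using X1 X2 by (auto simp: I1_def I2_def)
  then have p: "p \<notin> I1" "p \<notin> I2" by auto
  have le: "I1 \<subseteq> X1" "I2 \<subseteq> X2" by (auto simp: I1_def I2_def)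
  have eq: "I = I1 \<union> I2" using I by (auto simp: I1_def I2_def)
  have i: "indep M1 I1" "indep M2 I2" "indep M1 (insert p I1) \<or> indep M2 (insert p I2)"
    using I(1) indep_two_sum[OF sub] eq by auto
  have c: "rank N (X1 \<union> X2) = card I1 + card I2" using split_card[OF sub] eq I by simp
  have 1: "card I1 \<le> rank M1 X1" "card I2 \<le> rank M2 X2"
    using i by (auto simp: I1_def I2_def intro!: M1.card_le_rank M2.card_le_rank)
  then show "rank N (X1 \<union> X2) \<le> rank M1 X1 + rank M2 X2" using c by simp
  have 2: "card I1 \<le> rank M1 (insert p X1)" "card I2 \<le> rank M2 (insert p X2)"
    using i by (auto simp: I1_def I2_def intro!: M1.card_le_rank M2.card_le_rank)
  have "Suc (card I1) \<le> rank M1 (insert p X1)" if "indep M1 (insert p I1)"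
    using M1.card_le_rank[OF that insert_mono[OF le(1)]] p M1.indep_finite[OF i(1)] by simp
  moreover have "Suc (card I2) \<le> rank M2 (insert p X2)" if "indep M2 (insert p I2)"
    using M2.card_le_rank[OF that insert_mono[OF le(2)]] p M2.indep_finite[OF i(2)] by simp
  ultimately show "Suc (rank N (X1 \<union> X2)) \<le> rank M1 (insert p X1) + rank M2 (insert p X2)"
    using 2 i(3) c by linarith
qed

text \<open>A set that tolerates \<open>p\<close> in \<open>M1\<close> may be joined to any
  independent set of \<open>M2\<close>.\<close>

lemma rank_two_sum_ge:
  assumes X1: "X1 \<subseteq> E1 - {p}" and X2: "X2 \<subseteq> E2 - {p}"
  shows "rank M1 (insert p X1) + rank M2 X2 \<le> Suc (rank N (X1 \<union> X2))"
proof -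
  obtain J1 where J1: "J1 \<subseteq> X1" "indep M1 (insert p J1)" "Suc (card J1) = rank M1 (insert p X1)"
    using M1.basis_through[OF M1.indep_singleton[OF p_ground(1) not_loop1]] X1 by blast
  obtain J2 where J2: "indep M2 J2" "J2 \<subseteq> X2" "card J2 = rank M2 X2" by (rule M2.rank_attained)
  have "indep N (J1 \<union> J2)"
    using J1 J2 X1 X2 M1.indep_subset[OF J1(2) subset_insertI] by (subst indep_two_sum) auto
  then have "card (J1 \<union> J2) \<le> rank N (X1 \<union> X2)" using J1 J2 by (intro N.card_le_rank) auto
  moreover have "card (J1 \<union> J2) = card J1 + card J2" using J1 J2 X1 X2 by (intro split_card) auto
  ultimately show ?thesis using J1 J2 by simp
qed

lemma rank_two_sum_ge':
  assumes X1: "X1 \<subseteq> E1 - {p}" and X2: "X2 \<subseteq> E2 - {p}"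
  shows "rank M1 X1 + rank M2 (insert p X2) \<le> Suc (rank N (X1 \<union> X2))"
proof -
  interpret swap: two_summands M2 M1 p by (rule swap)
  show ?thesis using swap.rank_two_sum_ge[OF X2 X1] two_sum_commute[of M1 M2 p]
    by (simp add: Un_commute add.commute)
qed

text \<open>With \<open>rank_joined\<close> this evaluates the rank as the minimum of the two bounds
  in \<open>rank_two_sum_le\<close>. The hypotheses of the two lemmas overlap when exactly one side
  spans \<open>p\<close>, and there both formulas agree.\<close>

lemma rank_free:
  assumes X: "X1 \<subseteq> E1 - {p}" "X2 \<subseteq> E2 - {p}"
    and s: "rank M1 (insert p X1) \<noteq> rank M1 X1 \<or> rank M2 (insert p X2) \<noteq> rank M2 X2"
  shows "rank N (X1 \<union> X2) = rank M1 X1 + rank M2 X2"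
  using rank_two_sum_le(1)[OF X] rank_two_sum_ge[OF X] rank_two_sum_ge'[OF X] s
    M1.rank_mono[OF subset_insertI, of X1 p] M2.rank_mono[OF subset_insertI, of X2 p]
  by linarith

lemma rank_joined:
  assumes X: "X1 \<subseteq> E1 - {p}" "X2 \<subseteq> E2 - {p}"
    and s: "rank M1 (insert p X1) = rank M1 X1 \<or> rank M2 (insert p X2) = rank M2 X2"
  shows "Suc (rank N (X1 \<union> X2)) = rank M1 (insert p X1) + rank M2 (insert p X2)"
  using rank_two_sum_le(2)[OF X] rank_two_sum_ge[OF X] rank_two_sum_ge'[OF X] s
  by linarith

lemma rank_ground_minus1: "rank M1 (E1 - {p}) = rank M1 E1"
  using M1.rank_ground_minus p_ground not_coloop1 by simp

lemma rank_ground_minus2: "rank M2 (E2 - {p}) = rank M2 E2"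
  using M2.rank_ground_minus p_ground not_coloop2 by simp

lemma rank_N_ground: "Suc (rank N (ground N)) = rank M1 E1 + rank M2 E2"
  using rank_joined[of "E1 - {p}" "E2 - {p}"] rank_ground_minus1 p_ground
  by (simp add: ground_N insert_absorb Un_Diff)

section \<open>Flats of the 2-sum\<close>

lemma free_rank_insert:
  assumes F: "flat M1 F1" "flat M2 F2" "p \<notin> F1" "p \<notin> F2" and e: "e \<in> E1 - {p} - F1"
  shows "rank N (F1 \<union> F2) < rank N (insert e (F1 \<union> F2))"
proof -
  have sub: "F1 \<subseteq> E1 - {p}" "insert e F1 \<subseteq> E1 - {p}" "F2 \<subseteq> E2 - {p}"
    using F e by (auto simp: flat_def)
  have s: "rank M2 (insert p F2) \<noteq> rank M2 F2" using F p_ground by (force simp: flat_def)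
  have "rank N (insert e F1 \<union> F2) = rank M1 (insert e F1) + rank M2 F2"
    using sub s by (intro rank_free) auto
  moreover have "rank N (F1 \<union> F2) = rank M1 F1 + rank M2 F2" using sub s by (intro rank_free) auto
  moreover have "rank M1 F1 < rank M1 (insert e F1)" using F e by (auto simp: flat_def)
  ultimately show ?thesis by simp
qed

text \<open>As \<open>F2\<close> is a flat without \<open>p\<close>, the second side does not span
  \<open>p\<close>. Ranks therefore add both before and after an element of \<open>E1\<close> is
  adjoined, even if that element makes the first side span \<open>p\<close>.\<close>

lemma free_flat:
  assumes F: "flat M1 F1" "flat M2 F2" "p \<notin> F1" "p \<notin> F2"
  shows "flat N (F1 \<union> F2)" "rank N (F1 \<union> F2) = rank M1 F1 + rank M2 F2"
proof -
  interpret swap: two_summands M2 M1 p by (rule swap)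
  show "flat N (F1 \<union> F2)"
    using F free_rank_insert[OF F] swap.free_rank_insert[OF F(2,1,4,3)] two_sum_commute[of M1 M2 p]
    unfolding flat_def ground_N by (auto simp: Un_commute)
  show "rank N (F1 \<union> F2) = rank M1 F1 + rank M2 F2"
    using F p_ground by (intro rank_free) (force simp: flat_def)+
qed

lemma joined_rank_insert:
  assumes F: "flat M1 (insert p X1)" and X: "X1 \<subseteq> E1 - {p}" "X2 \<subseteq> E2 - {p}"
    and s: "rank M1 (insert p X1) = rank M1 X1 \<or> rank M2 (insert p X2) = rank M2 X2"
    and e: "e \<in> E1 - {p} - X1"
  shows "rank N (X1 \<union> X2) < rank N (insert e (X1 \<union> X2))"
proof -
  \<comment> \<open>Spanning \<open>p\<close> is inherited by the larger set, so
    \<open>rank_joined\<close> applies before and after adjoining \<open>e\<close>.\<close>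
  have "rank M1 (insert p (insert e X1)) = rank M1 (insert e X1) \<or>
      rank M2 (insert p X2) = rank M2 X2"
    using s M1.rank_insert_mono[OF subset_insertI, of p X1 e] by auto
  then have "Suc (rank N (insert e X1 \<union> X2)) =
      rank M1 (insert p (insert e X1)) + rank M2 (insert p X2)"
    using X e by (intro rank_joined) auto
  moreover have "rank M1 (insert p X1) < rank M1 (insert e (insert p X1))"
    using F e by (auto simp: flat_def)
  ultimately show ?thesis using rank_joined[OF X s] by (simp add: insert_commute)
qed

text \<open>The last hypothesis says that \<open>F1 - {p}\<close> or \<open>F2 - {p}\<close> still
  spans \<open>p\<close>, so that \<open>p\<close> can be removed and \<open>rank_joined\<close>
  applies.\<close>

lemma joined_flat:
  assumes F: "flat M1 F1" "flat M2 F2" "p \<in> F1" "p \<in> F2"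
    and s: "rank M1 F1 = rank M1 (F1 - {p}) \<or> rank M2 F2 = rank M2 (F2 - {p})"
  shows "flat N ((F1 \<union> F2) - {p})" "Suc (rank N ((F1 \<union> F2) - {p})) = rank M1 F1 + rank M2 F2"
proof -
  interpret swap: two_summands M2 M1 p by (rule swap)
  have ins: "insert p (F1 - {p}) = F1" "insert p (F2 - {p}) = F2" using F by auto
  have X: "F1 - {p} \<subseteq> E1 - {p}" "F2 - {p} \<subseteq> E2 - {p}" using F by (auto simp: flat_def)
  have eq: "(F1 \<union> F2) - {p} = (F1 - {p}) \<union> (F2 - {p})" by auto
  show "Suc (rank N ((F1 \<union> F2) - {p})) = rank M1 F1 + rank M2 F2"
    unfolding eq using rank_joined[OF X] s ins by simp
  have "rank N ((F1 - {p}) \<union> (F2 - {p})) < rank N (insert e ((F1 - {p}) \<union> (F2 - {p})))"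
    if e: "e \<in> ground N - ((F1 \<union> F2) - {p})" for e
  proof (cases "e \<in> E1")
    case True
    then show ?thesis using e ins s F X by (intro joined_rank_insert) (auto simp: ground_N)
  next
    case False
    then have "rank N ((F2 - {p}) \<union> (F1 - {p})) < rank N (insert e ((F2 - {p}) \<union> (F1 - {p})))"
      unfolding two_sum_commute[of M1 M2 p]
      using e ins s F X by (intro swap.joined_rank_insert) (auto simp: ground_N)
    then show ?thesis by (simp add: Un_commute)
  qed
  moreover have "(F1 \<union> F2) - {p} \<subseteq> ground N" using X by (auto simp: ground_N)
  ultimately show "flat N ((F1 \<union> F2) - {p})" unfolding flat_def eq by blast
qed

lemma flat_N_free:
  assumes X: "flat N X" and s: "rank M1 (insert p (X \<inter> E1)) \<noteq> rank M1 (X \<inter> E1)"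
    "rank M2 (insert p (X \<inter> E2)) \<noteq> rank M2 (X \<inter> E2)"
  shows "flat M1 (X \<inter> E1)"
  unfolding flat_def
proof (intro conjI ballI)
  have sub: "X \<inter> E1 \<subseteq> E1 - {p}" "X \<inter> E2 \<subseteq> E2 - {p}" and eq: "X = (X \<inter> E1) \<union> (X \<inter> E2)"
    using X by (auto simp: flat_def ground_N)
  fix e assume e: "e \<in> E1 - X \<inter> E1"
  show "rank M1 (X \<inter> E1) < rank M1 (insert e (X \<inter> E1))"
  proof (cases "e = p")
    case True
    then show ?thesis using s M1.rank_mono[OF subset_insertI, of "X \<inter> E1" p] by simp
  next
    case False
    have "rank N ((X \<inter> E1) \<union> (X \<inter> E2)) < rank N (insert e (X \<inter> E1) \<union> (X \<inter> E2))"
      using X e False eq by (auto simp: flat_def ground_N)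
    then show ?thesis using rank_free[OF sub] rank_free[of "insert e (X \<inter> E1)" "X \<inter> E2"] s sub e False
      by auto
  qed
qed auto

lemma flat_N_joined:
  assumes X: "flat N X" and s: "rank M1 (insert p (X \<inter> E1)) = rank M1 (X \<inter> E1) \<or>
    rank M2 (insert p (X \<inter> E2)) = rank M2 (X \<inter> E2)"
  shows "flat M1 (insert p (X \<inter> E1))"
  unfolding flat_def
proof (intro conjI ballI)
  have sub: "X \<inter> E1 \<subseteq> E1 - {p}" "X \<inter> E2 \<subseteq> E2 - {p}" and eq: "X = (X \<inter> E1) \<union> (X \<inter> E2)"
    using X by (auto simp: flat_def ground_N)
  fix e assume e: "e \<in> E1 - insert p (X \<inter> E1)"
  have "rank M1 (insert p (insert e (X \<inter> E1))) = rank M1 (insert e (X \<inter> E1)) \<or>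
      rank M2 (insert p (X \<inter> E2)) = rank M2 (X \<inter> E2)"
    using s M1.rank_insert_mono[OF subset_insertI, of p "X \<inter> E1" e] by auto
  then have "Suc (rank N (insert e (X \<inter> E1) \<union> (X \<inter> E2))) =
      rank M1 (insert p (insert e (X \<inter> E1))) + rank M2 (insert p (X \<inter> E2))"
    using sub e by (intro rank_joined) auto
  moreover have "rank N ((X \<inter> E1) \<union> (X \<inter> E2)) < rank N (insert e (X \<inter> E1) \<union> (X \<inter> E2))"
    using X e eq by (auto simp: flat_def ground_N)
  ultimately show "rank M1 (insert p (X \<inter> E1)) < rank M1 (insert e (insert p (X \<inter> E1)))"
    using rank_joined[OF sub s] by (simp add: insert_commute)
qed (use p_ground in auto)

text \<open>The cases are told apart by whether some side of \<open>X\<close> spans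
  \<open>p\<close>. If none does, the traces of \<open>X\<close> on \<open>E1\<close> and
  \<open>E2\<close> are flats; otherwise they become flats once \<open>p\<close> is adjoined to
  both.\<close>

lemma flat_N_cases:
  assumes X: "flat N X"
  obtains
    (free) F1 F2 where "flat M1 F1" "flat M2 F2" "p \<notin> F1" "p \<notin> F2" "X = F1 \<union> F2"
      "rank N X = rank M1 F1 + rank M2 F2"
  | (joined) F1 F2 where "flat M1 F1" "flat M2 F2" "p \<in> F1" "p \<in> F2" "X = (F1 \<union> F2) - {p}"
      "Suc (rank N X) = rank M1 F1 + rank M2 F2"
      "rank M1 F1 = rank M1 (F1 - {p}) \<or> rank M2 F2 = rank M2 (F2 - {p})"
proof -
  interpret swap: two_summands M2 M1 p by (rule swap)
  have X': "flat (two_sum M2 M1 p) X" using X two_sum_commute[of M1 M2 p] by simp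
  have pX: "p \<notin> X" and eq: "X = (X \<inter> E1) \<union> (X \<inter> E2)" using X by (auto simp: flat_def ground_N)
  show thesis
  proof (cases "rank M1 (insert p (X \<inter> E1)) \<noteq> rank M1 (X \<inter> E1) \<and>
      rank M2 (insert p (X \<inter> E2)) \<noteq> rank M2 (X \<inter> E2)")
    case True
    then have f: "flat M1 (X \<inter> E1)" "flat M2 (X \<inter> E2)"
      using flat_N_free[OF X] swap.flat_N_free[OF X'] by auto
    show thesis by (rule free[OF f]) (use pX eq free_flat(2)[OF f] in auto)
  next
    case False
    then have f: "flat M1 (insert p (X \<inter> E1))" "flat M2 (insert p (X \<inter> E2))"
      using flat_N_joined[OF X] swap.flat_N_joined[OF X'] by auto
    have *: "insert p (X \<inter> E1) - {p} = X \<inter> E1" "insert p (X \<inter> E2) - {p} = X \<inter> E2"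
      "(insert p (X \<inter> E1) \<union> insert p (X \<inter> E2)) - {p} = X"
      using pX eq by auto
    show thesis by (rule joined[OF f]) (use False joined_flat(2)[OF f] * in auto)
  qed
qed

section \<open>Embedding the flats of one summand\<close>

abbreviation lift1 :: "'e set \<Rightarrow> 'e set \<Rightarrow> 'e set" where
  "lift1 \<equiv> lift_flat E2 p"
abbreviation lift2 :: "'e set \<Rightarrow> 'e set \<Rightarrow> 'e set" where
  "lift2 \<equiv> lift_flat E1 p"

lemma lift1_Int:
  assumes "B \<subseteq> E2" "p \<notin> B" "F \<subseteq> E1" "G \<subseteq> E1"
  shows "lift1 B F \<inter> lift1 B G = lift1 B (F \<inter> G)"
  using assms ground_Int unfolding lift_flat_def by (simp split: if_split) blast

text \<open>Membership of \<open>p\<close> is visible on \<open>E2\<close>, since \<open>B\<close>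
  is different from \<open>E2 - {p}\<close>; the rest of the set is its trace on
  \<open>E1\<close>.\<close>

lemma lift1_inject:
  assumes "B \<in> hyperplanes M2" "p \<notin> B" "F \<subseteq> E1" "G \<subseteq> E1" "lift1 B F = lift1 B G"
  shows "F = G"
proof -
  have B: "B \<subseteq> E2" using assms M2.hyperplane_ground by simp
  have ne: "B \<noteq> E2 - {p}"
    using M2.hyperplane_rank[OF assms(1)] rank_ground_minus2 by auto
  have p1: "lift1 B K \<inter> E2 = (if p \<in> K then E2 - {p} else B)" if "K \<subseteq> E1" for K
    using that assms(2) B ground_Int by (auto simp: lift_flat_def)
  have p2: "lift1 B K \<inter> E1 = K - {p}" if "K \<subseteq> E1" for K
    using that assms(2) B ground_Int by (auto simp: lift_flat_def)
  have "p \<in> F \<longleftrightarrow> p \<in> G" using p1[of F] p1[of G] assms ne by (auto split: if_splits)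
  moreover have "F - {p} = G - {p}" using p2[of F] p2[of G] assms by auto
  ultimately show ?thesis by blast
qed

text \<open>The rank shifts by the same constant in both branches: when \<open>p \<in> F\<close>,
  the unit lost in \<open>joined_flat\<close> is made up by \<open>E2\<close> having rank one more
  than \<open>B\<close>. Hence coranks are preserved.\<close>

lemma lift1_flat:
  assumes B: "B \<in> hyperplanes M2" "p \<notin> B" and F: "flat M1 F"
  shows "flat N (lift1 B F)" "rank N (lift1 B F) = rank M1 F + rank M2 B"
proof -
  have *: "flat N (lift1 B F) \<and> rank N (lift1 B F) = rank M1 F + rank M2 B"
  proof (cases "p \<in> F")
    case True
    then show ?thesis
      using joined_flat[OF F M2.flat_ground True p_ground(2)] rank_ground_minus2
        M2.hyperplane_rank[OF B(1)]
      by (simp add: lift_flat_def)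
  next
    case False
    then show ?thesis using free_flat[OF F M2.hyperplane_flat[OF B(1)] False B(2)]
      by (simp add: lift_flat_def)
  qed
  then show "flat N (lift1 B F)" "rank N (lift1 B F) = rank M1 F + rank M2 B" by auto
qed

lemma lift1_corank:
  assumes B: "B \<in> hyperplanes M2" "p \<notin> B" and F: "flat M1 F"
  shows "corank_flat N k (lift1 B F) \<longleftrightarrow> corank_flat M1 k F"
  using lift1_flat[OF assms] F rank_N_ground M2.hyperplane_rank[OF B(1)]
  unfolding corank_flat_def by auto

lemma lift1_hyperplane:
  assumes "B \<in> hyperplanes M2" "p \<notin> B" "K \<in> hyperplanes M1"
  shows "lift1 B K \<in> hyperplanes N"
  using lift1_corank[OF assms(1,2), of K 1] assms(3)
  by (auto simp: hyperplanes_def corank_flat_def)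

text \<open>Modularity is phrased through intersections, equality and corank, all of which the lift
  preserves and reflects.\<close>

lemma lift1_modular_triple:
  assumes B: "B \<in> hyperplanes M2" "p \<notin> B"
    and K: "K1 \<in> hyperplanes M1" "K2 \<in> hyperplanes M1" "K3 \<in> hyperplanes M1"
  shows "modular_triple N (lift1 B K1) (lift1 B K2) (lift1 B K3) \<longleftrightarrow> modular_triple M1 K1 K2 K3"
proof -
  have B': "B \<subseteq> E2" using B M2.hyperplane_ground by simp
  have K': "K1 \<subseteq> E1" "K2 \<subseteq> E1" "K3 \<subseteq> E1" using K M1.hyperplane_ground by auto
  have int: "lift1 B F \<inter> lift1 B G = lift1 B (F \<inter> G)" if "F \<subseteq> E1" "G \<subseteq> E1" for F G
    using lift1_Int B' B that by simp
  have eq: "lift1 B F = lift1 B G \<longleftrightarrow> F = G" if "F \<subseteq> E1" "G \<subseteq> E1" for F G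
    using lift1_inject[OF B that] by blast
  have g: "K1 \<inter> K2 \<subseteq> E1" "K1 \<inter> K3 \<subseteq> E1" "K2 \<inter> K3 \<subseteq> E1" "K1 \<inter> K2 \<inter> K3 \<subseteq> E1" using K' by auto
  have "corank_flat N 2 (lift1 B (K1 \<inter> K2 \<inter> K3)) \<longleftrightarrow> corank_flat M1 2 (K1 \<inter> K2 \<inter> K3)"
    using K by (intro lift1_corank[OF B] M1.flat_Int M1.hyperplane_flat)
  then show ?thesis
    using K lift1_hyperplane[OF B]
    by (simp only: modular_triple_def int[OF K'(1,2)] int[OF K'(1,3)] int[OF K'(2,3)]
        int[OF g(1) K'(3)] eq[OF g(1) g(4)] eq[OF g(2) g(4)] eq[OF g(3) g(4)])
qed

section \<open>Hyperplanes and modular triples of the 2-sum\<close>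

lemma hyperplane_N_cases:
  assumes "H \<in> hyperplanes N"
  obtains (left) K where "K \<in> hyperplanes M1" "p \<in> K" "H = (K \<union> E2) - {p}"
  | (right) K where "K \<in> hyperplanes M2" "p \<in> K" "H = (E1 \<union> K) - {p}"
  | (both) A B where "A \<in> hyperplanes M1" "B \<in> hyperplanes M2" "p \<notin> A" "p \<notin> B" "H = A \<union> B"
proof -
  have flat: "flat N H" and rank: "Suc (rank N H) = rank N (ground N)"
    using assms by (auto simp: hyperplanes_def corank_flat_def)
  show thesis
    using flat
  proof (cases rule: flat_N_cases)
    case (free F1 F2)
    \<comment> \<open>Neither flat contains \<open>p\<close>, so each misses at least one unit of
      rank; together they miss exactly two, as the rank of the 2-sum is one less than the sum of the
      ranks.\<close>
    have "rank M1 F1 < rank M1 E1" "rank M2 F2 < rank M2 E2"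
      using free p_ground
      by (auto intro!: M1.flat_psubset_rank M2.flat_psubset_rank simp: flat_def)
    then have "Suc (rank M1 F1) = rank M1 E1" "Suc (rank M2 F2) = rank M2 E2"
      using free rank rank_N_ground by linarith+
    then show thesis using both[of F1 F2] free M1.hyperplaneI M2.hyperplaneI by simp
  next
    case (joined F1 F2)
    have g: "F1 \<subseteq> E1" "F2 \<subseteq> E2" using joined by (auto simp: flat_def)
    have le: "rank M1 F1 \<le> rank M1 E1" "rank M2 F2 \<le> rank M2 E2"
      using g by (auto intro!: M1.rank_mono M2.rank_mono)
    \<comment> \<open>With \<open>p\<close> on both sides only one unit is missing in total, and a
      flat of full rank is the whole ground set.\<close>
    have "Suc (rank M1 F1) = rank M1 E1 \<and> rank M2 F2 = rank M2 E2 \<or>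
        rank M1 F1 = rank M1 E1 \<and> Suc (rank M2 F2) = rank M2 E2"
      using joined(6) rank rank_N_ground le by linarith
    then show thesis
      using left[of F1] right[of F2] joined g M1.hyperplaneI M2.hyperplaneI
        M1.flat_eqI[of F1 E1] M2.flat_eqI[of F2 E2]
      by auto
  qed
qed

text \<open>On \<open>E2\<close>, such an \<open>H\<close> is either all of \<open>E2 - {p}\<close>
  or exactly \<open>F2\<close>, the two branches of the lift. The remaining kind would give a
  hyperplane through \<open>p\<close> containing \<open>F2\<close>.\<close>

lemma hyperplane_N_above_free:
  assumes F: "F1 \<subseteq> E1" "F2 \<in> hyperplanes M2" "p \<notin> F2" and H: "H \<in> hyperplanes N" "F1 \<union> F2 \<subseteq> H"
  obtains K where "K \<in> hyperplanes M1" "H = lift1 F2 K"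
  using H(1)
proof (cases rule: hyperplane_N_cases)
  case (left K)
  then show thesis using that[of K] by (simp add: lift_flat_def)
next
  case (right K)
  have "F2 \<subseteq> K" using F right H ground_Int M2.hyperplane_ground[OF F(2)] by blast
  then show thesis using M2.hyperplane_subset_eq[OF F(2) right(1)] F(3) right(2) by simp
next
  case (both A B)
  have "A \<inter> F2 \<subseteq> {p}"
    using ground_Int M2.hyperplane_ground[OF F(2)] M1.hyperplane_ground[OF both(1)] by blast
  then have "F2 \<subseteq> B" using F(3) both(5) H(2) by blast
  then have "F2 = B" using M2.hyperplane_subset_eq[OF F(2) both(2)] by simp
  then show thesis using that[of A] both by (simp add: lift_flat_def)
qed

lemma hyperplane_N_above_joined:
  assumes F: "F1 \<subseteq> E1" and H: "H \<in> hyperplanes N" "(F1 \<union> E2) - {p} \<subseteq> H"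
  obtains K where "K \<in> hyperplanes M1" "p \<in> K" "H = (K \<union> E2) - {p}"
  using H(1)
proof (cases rule: hyperplane_N_cases)
  case (left K)
  then show thesis using that[of K] by simp
next
  case (right K)
  have "E2 \<subseteq> K" using right H ground_Int by blast
  then show thesis
    using M2.rank_mono[of E2 K] M2.hyperplane_rank[OF right(1)] by simp
next
  case (both A B)
  have "E2 - {p} \<subseteq> B" using both H ground_Int M1.hyperplane_ground[OF both(1)] by blast
  then show thesis
    using M2.rank_mono[of "E2 - {p}" B] M2.hyperplane_rank[OF both(2)] rank_ground_minus2 by simp
qed

lemma modular_triple_N_free:
  assumes m: "modular_triple N H1 H2 H3" and F: "F1 \<subseteq> E1" "F2 \<in> hyperplanes M2" "p \<notin> F2"
    "H1 \<inter> H2 \<inter> H3 = F1 \<union> F2"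
  obtains B K1 K2 K3 where "B \<in> hyperplanes M2" "p \<notin> B" "modular_triple M1 K1 K2 K3"
    "H1 = lift1 B K1" "H2 = lift1 B K2" "H3 = lift1 B K3"
proof -
  have H: "H1 \<in> hyperplanes N" "H2 \<in> hyperplanes N" "H3 \<in> hyperplanes N"
    using m by (auto simp: modular_triple_def)
  obtain K1 where 1: "K1 \<in> hyperplanes M1" "H1 = lift1 F2 K1"
    using hyperplane_N_above_free[OF F(1-3) H(1)] F(4) by blast
  obtain K2 where 2: "K2 \<in> hyperplanes M1" "H2 = lift1 F2 K2"
    using hyperplane_N_above_free[OF F(1-3) H(2)] F(4) by blast
  obtain K3 where 3: "K3 \<in> hyperplanes M1" "H3 = lift1 F2 K3"
    using hyperplane_N_above_free[OF F(1-3) H(3)] F(4) by blast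
  show thesis
    using that[OF F(2,3) _ 1(2) 2(2) 3(2)] lift1_modular_triple[OF F(2,3) 1(1) 2(1) 3(1)] m 1 2 3
    by simp
qed

lemma modular_triple_N_joined:
  assumes m: "modular_triple N H1 H2 H3" and F: "F1 \<subseteq> E1" "H1 \<inter> H2 \<inter> H3 = (F1 \<union> E2) - {p}"
  obtains B K1 K2 K3 where "B \<in> hyperplanes M2" "p \<notin> B" "modular_triple M1 K1 K2 K3"
    "H1 = lift1 B K1" "H2 = lift1 B K2" "H3 = lift1 B K3"
proof -
  have H: "H1 \<in> hyperplanes N" "H2 \<in> hyperplanes N" "H3 \<in> hyperplanes N"
    using m by (auto simp: modular_triple_def)
  \<comment> \<open>Lifts of sets through \<open>p\<close> do not depend on \<open>B\<close>, so any
    choice serves.\<close>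
  obtain B where B: "B \<in> hyperplanes M2" "p \<notin> B"
    using M2.hyperplane_avoiding_nonloop[OF p_ground(2) not_loop2] by blast
  obtain K1 where 1: "K1 \<in> hyperplanes M1" "H1 = lift1 B K1"
    using hyperplane_N_above_joined[OF F(1) H(1)] F(2) unfolding lift_flat_def by (metis Int_lower1 Int_lower2 inf.coboundedI1)
  obtain K2 where 2: "K2 \<in> hyperplanes M1" "H2 = lift1 B K2"
    using hyperplane_N_above_joined[OF F(1) H(2)] F(2) unfolding lift_flat_def by (metis Int_lower1 Int_lower2 inf.coboundedI1)
  obtain K3 where 3: "K3 \<in> hyperplanes M1" "H3 = lift1 B K3"
    using hyperplane_N_above_joined[OF F(1) H(3)] F(2) unfolding lift_flat_def by (metis Int_lower1 Int_lower2 inf.coboundedI1)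
  show thesis
    using that[OF B _ 1(2) 2(2) 3(2)] lift1_modular_triple[OF B 1(1) 2(1) 3(1)] m 1 2 3
    by simp
qed

text \<open>At most two hyperplanes lie above such a set, so it is not the intersection of a modular
  triple. One of the form \<open>A \<union> B\<close> is impossible, because by the rank condition
  \<open>A\<close> or \<open>B\<close> would span \<open>p\<close>.\<close>

lemma hyperplane_N_above_two_hyperplanes:
  assumes F: "F1 \<in> hyperplanes M1" "F2 \<in> hyperplanes M2" "p \<in> F1" "p \<in> F2"
    and s: "rank M1 F1 = rank M1 (F1 - {p}) \<or> rank M2 F2 = rank M2 (F2 - {p})"
    and H: "H \<in> hyperplanes N" "(F1 \<union> F2) - {p} \<subseteq> H"
  shows "H = (F1 \<union> E2) - {p} \<or> H = (E1 \<union> F2) - {p}"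
  using H(1)
proof (cases rule: hyperplane_N_cases)
  case (left K)
  have "F1 \<subseteq> K" using left H F M1.hyperplane_ground[OF F(1)] ground_Int by blast
  then show ?thesis using M1.hyperplane_subset_eq[OF F(1) left(1)] left by simp
next
  case (right K)
  have "F2 \<subseteq> K" using right H F M2.hyperplane_ground[OF F(2)] ground_Int by blast
  then show ?thesis using M2.hyperplane_subset_eq[OF F(2) right(1)] right by simp
next
  case (both A B)
  have g: "F1 \<subseteq> E1" "A \<subseteq> E1" "F2 \<subseteq> E2" "B \<subseteq> E2"
    using F both M1.hyperplane_ground M2.hyperplane_ground by auto
  have sub: "F1 - {p} \<subseteq> A" "F2 - {p} \<subseteq> B" using both H g ground_Int by blast+
  have ins: "insert p (F1 - {p}) = F1" "insert p (F2 - {p}) = F2" using F by auto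
  have "rank M1 (insert p A) = rank M1 A \<or> rank M2 (insert p B) = rank M2 B"
    using s M1.rank_insert_mono[OF sub(1), of p] M2.rank_insert_mono[OF sub(2), of p] ins by auto
  then show ?thesis
    using M1.rank_insert_flat[OF M1.hyperplane_flat[OF both(1)], of p]
      M2.rank_insert_flat[OF M2.hyperplane_flat[OF both(2)], of p] both p_ground by simp
qed

lemma modular_triple_distinct:
  assumes "modular_triple N H1 H2 H3"
  shows "H1 \<noteq> H2" "H1 \<noteq> H3" "H2 \<noteq> H3"
proof -
  define L where "L = H1 \<inter> H2 \<inter> H3"
  have L: "L \<notin> hyperplanes N"
    using assms unfolding L_def modular_triple_def hyperplanes_def corank_flat_def mem_Collect_eq
    by linarith
  have H: "H1 \<in> hyperplanes N" "H2 \<in> hyperplanes N" "H1 \<inter> H2 = L" "H1 \<inter> H3 = L" "H2 \<inter> H3 = L"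
    using assms unfolding modular_triple_def L_def by metis+
  show "H1 \<noteq> H2" "H1 \<noteq> H3" "H2 \<noteq> H3" using L H by force+
qed

text \<open>The missing rank of the intersection is distributed over the summands. In the free case
  the flats miss three units together and at least one each, so one of them is a hyperplane to lift
  along. In the joined case they miss two: either one flat is its whole ground set, or both are
  hyperplanes through \<open>p\<close>, which the previous lemmas exclude.\<close>

lemma modular_triple_N_cases:
  assumes m: "modular_triple N H1 H2 H3"
  obtains (left) B K1 K2 K3 where "B \<in> hyperplanes M2" "p \<notin> B" "modular_triple M1 K1 K2 K3"
      "H1 = lift1 B K1" "H2 = lift1 B K2" "H3 = lift1 B K3"
    | (right) B K1 K2 K3 where "B \<in> hyperplanes M1" "p \<notin> B" "modular_triple M2 K1 K2 K3"
      "H1 = lift2 B K1" "H2 = lift2 B K2" "H3 = lift2 B K3"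
proof -
  interpret swap: two_summands M2 M1 p by (rule swap)
  have m': "modular_triple (two_sum M2 M1 p) H1 H2 H3" using m two_sum_commute[of M1 M2 p] by simp
  have "flat N (H1 \<inter> H2 \<inter> H3)" and rank: "rank N (H1 \<inter> H2 \<inter> H3) + 2 = rank N (ground N)"
    using m by (auto simp: modular_triple_def corank_flat_def)
  then show thesis
  proof (cases rule: flat_N_cases)
    case (free F1 F2)
    have g: "F1 \<subseteq> E1" "F2 \<subseteq> E2" using free by (auto simp: flat_def)
    have "rank M1 F1 < rank M1 E1" "rank M2 F2 < rank M2 E2"
      using free p_ground
      by (auto intro!: M1.flat_psubset_rank M2.flat_psubset_rank simp: flat_def)
    then have "Suc (rank M2 F2) = rank M2 E2 \<or> Suc (rank M1 F1) = rank M1 E1"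
      using free(6) rank rank_N_ground by linarith
    then show thesis
    proof
      assume "Suc (rank M2 F2) = rank M2 E2"
      then have "F2 \<in> hyperplanes M2" using free M2.hyperplaneI by simp
      then show thesis using modular_triple_N_free[OF m g(1) _ free(4,5)] left by blast
    next
      assume "Suc (rank M1 F1) = rank M1 E1"
      then have "F1 \<in> hyperplanes M1" using free M1.hyperplaneI by simp
      moreover have "H1 \<inter> H2 \<inter> H3 = F2 \<union> F1" using free by auto
      ultimately show thesis using swap.modular_triple_N_free[OF m' g(2) _ free(3)] right by blast
    qed
  next
    case (joined F1 F2)
    have g: "F1 \<subseteq> E1" "F2 \<subseteq> E2" using joined by (auto simp: flat_def)
    have le: "rank M1 F1 \<le> rank M1 E1" "rank M2 F2 \<le> rank M2 E2"
      using g by (auto intro!: M1.rank_mono M2.rank_mono)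
    have "rank M2 E2 \<le> rank M2 F2 \<or> rank M1 E1 \<le> rank M1 F1 \<or>
        Suc (rank M1 F1) = rank M1 E1 \<and> Suc (rank M2 F2) = rank M2 E2"
      using joined(6) rank rank_N_ground le by linarith
    then show thesis
    proof (elim disjE conjE)
      assume "rank M2 E2 \<le> rank M2 F2"
      then have "F2 = E2" using M2.flat_eqI joined g by blast
      then show thesis using modular_triple_N_joined[OF m g(1)] joined(5) left by blast
    next
      assume "rank M1 E1 \<le> rank M1 F1"
      then have "F1 = E1" using M1.flat_eqI joined g by blast
      then have "H1 \<inter> H2 \<inter> H3 = (F2 \<union> E1) - {p}" using joined by auto
      then show thesis using swap.modular_triple_N_joined[OF m' g(2)] right by blast
    next
      assume "Suc (rank M1 F1) = rank M1 E1" "Suc (rank M2 F2) = rank M2 E2"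
      then have F: "F1 \<in> hyperplanes M1" "F2 \<in> hyperplanes M2"
        using joined M1.hyperplaneI M2.hyperplaneI by auto
      have H: "H1 \<in> hyperplanes N" "H2 \<in> hyperplanes N" "H3 \<in> hyperplanes N"
        using m by (simp_all add: modular_triple_def)
      have above: "H = (F1 \<union> E2) - {p} \<or> H = (E1 \<union> F2) - {p}"
        if "H \<in> hyperplanes N" "H1 \<inter> H2 \<inter> H3 \<subseteq> H" for H
        using hyperplane_N_above_two_hyperplanes[OF F joined(3,4,7) that(1)] that(2)
        unfolding joined(5) by blast
      have "H1 = H2 \<or> H1 = H3 \<or> H2 = H3"
        using above[OF H(1)] above[OF H(2)] above[OF H(3)] by (metis Int_lower1 Int_lower2 inf.coboundedI1)
      then show thesis using modular_triple_distinct[OF m] by blast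
    qed
  qed
qed

end

subsection \<open>Representations over a pasture\<close>

text \<open>Representations are extensional, so a family given by a formula is cut down before it
  can belong to \<open>representations\<close>.\<close>

definition restrict_family :: "'e matroid \<Rightarrow> ('e set \<Rightarrow> 'e \<Rightarrow> 'u) \<Rightarrow> 'e set \<Rightarrow> 'e \<Rightarrow> 'u" where
  "restrict_family M f = (\<lambda>H\<in>hyperplanes M. \<lambda>e\<in>ground M. f H e)"

section \<open>Arithmetic in a pasture\<close>

locale pasture_struct =
  fixes P :: "'u pasture" (structure)
  assumes pasture: "pasture P"

sublocale pasture_struct \<subseteq> comm_monoid P
  using pasture by (simp add: pasture_def)

context pasture_struct
begin

declare Units_closed [simp]

lemma zer_closed [simp]: "zer P \<in> carrier P"
  using pasture by (simp add: pasture_def)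

lemma l_zer [simp]: "a \<in> carrier P \<Longrightarrow> zer P \<otimes> a = zer P"
  using pasture by (simp add: pasture_def)

lemma r_zer [simp]: "a \<in> carrier P \<Longrightarrow> a \<otimes> zer P = zer P"
  using l_zer m_comm by simp

lemma Units_iff: "a \<in> Units P \<longleftrightarrow> a \<in> carrier P \<and> a \<noteq> zer P"
  using pasture by (simp add: pasture_def)

lemma mult_eq_zer_iff [simp]:
  assumes "a \<in> carrier P" "b \<in> carrier P"
  shows "a \<otimes> b = zer P \<longleftrightarrow> a = zer P \<or> b = zer P"
  using assms Units_m_closed[of a b] by (auto simp: Units_iff simp del: Units_closed)

lemma mult_cancel:
  assumes "u \<in> Units P" "x \<in> carrier P" "y \<in> carrier P" "u \<otimes> x = u \<otimes> y"
  shows "x = y"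
  using assms Units_l_cancel by blast

lemma Units_cancel_inv:
  assumes "u \<in> Units P" "a \<in> carrier P" "b \<in> carrier P"
  shows "(a \<otimes> inv u) \<otimes> (u \<otimes> b) = a \<otimes> b"
proof -
  have "(a \<otimes> inv u) \<otimes> (u \<otimes> b) = a \<otimes> (inv u \<otimes> u) \<otimes> b"
    using assms by (simp add: m_assoc del: Units_l_inv)
  then show ?thesis using assms by simp
qed

lemma null_sum_scale:
  assumes "{#a, b, c#} \<in> nullset P" "d \<in> carrier P"
  shows "{#d \<otimes> a, d \<otimes> b, d \<otimes> c#} \<in> nullset P"
proof -
  have "image_mset (\<lambda>a. d \<otimes> a) {#a, b, c#} \<in> nullset P"
    using assms pasture unfolding pasture_def by blast
  then show ?thesis by simp
qed

lemma null_sum_zer: "a \<in> carrier P \<Longrightarrow> {#a, zer P, zer P#} \<in> nullset P \<longleftrightarrow> a = zer P"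
  using pasture by (simp add: pasture_def)

text \<open>The factor is \<epsilon>: dividing by a nonzero \<open>a\<close> turns the sum into one
  starting with \<open>\<one>\<close>, where the uniqueness of \<epsilon> applies.\<close>

lemma additive_inverse:
  obtains u where "u \<in> Units P"
    "\<And>a b. a \<in> carrier P \<Longrightarrow> b \<in> carrier P \<Longrightarrow> {#a, b, zer P#} \<in> nullset P \<Longrightarrow> b = u \<otimes> a"
proof -
  obtain u where u: "u \<in> Units P"
    and uniq: "\<And>v. v \<in> Units P \<Longrightarrow> {#\<one>, v, zer P#} \<in> nullset P \<Longrightarrow> v = u"
    using pasture unfolding pasture_def by metis
  have "b = u \<otimes> a"
    if ab: "a \<in> carrier P" "b \<in> carrier P" "{#a, b, zer P#} \<in> nullset P" for a b
  proof (cases "a = zer P")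
    case True
    then have "{#b, zer P, zer P#} \<in> nullset P" using ab by (simp add: add_mset_commute)
    then show ?thesis using True ab u null_sum_zer by simp
  next
    case False
    then have a: "a \<in> Units P" using ab by (simp add: Units_iff del: Units_closed)
    then have n: "{#\<one>, inv a \<otimes> b, zer P#} \<in> nullset P"
      using null_sum_scale[OF ab(3), of "inv a"] by simp
    have "\<one> \<noteq> zer P" using Units_one_closed Units_iff by blast
    then have "inv a \<otimes> b \<noteq> zer P" using n null_sum_zer[of \<one>] by auto
    then have "inv a \<otimes> b \<in> Units P" using a ab unfolding Units_iff[of "inv a \<otimes> b"] by simp
    then have "inv a \<otimes> b = u" using uniq n by simp
    then have "u \<otimes> a = (b \<otimes> inv a) \<otimes> (a \<otimes> \<one>)" using a ab by (simp add: m_comm[of b "inv a"])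
    also have "\<dots> = b" using a ab by (subst Units_cancel_inv) auto
    finally show ?thesis by simp
  qed
  then show thesis using that u by blast
qed

lemma null_pair_zer:
  assumes "a \<in> carrier P" "b \<in> carrier P" "{#a, b, zer P#} \<in> nullset P"
  shows "a = zer P \<longleftrightarrow> b = zer P"
proof -
  obtain u where u: "u \<in> Units P" and n: "\<And>a b. a \<in> carrier P \<Longrightarrow> b \<in> carrier P \<Longrightarrow>
      {#a, b, zer P#} \<in> nullset P \<Longrightarrow> b = u \<otimes> a"
    by (rule additive_inverse) (rule that)
  have "b = u \<otimes> a" by (rule n[OF assms])
  note u = u this
  then show ?thesis using assms(1) by (auto simp: Units_iff simp del: Units_closed)
qed

section \<open>Entries, coefficients and rescaling of representations\<close>

lemma rep_closed: "f \<in> representations M P \<Longrightarrow> H \<in> hyperplanes M \<Longrightarrow> e \<in> ground M \<Longrightarrow> f H e \<in> carrier P"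
  by (auto simp: representations_def PiE_def Pi_def)

lemma rep_zer_iff: "f \<in> representations M P \<Longrightarrow> H \<in> hyperplanes M \<Longrightarrow> e \<in> ground M \<Longrightarrow>
    f H e = zer P \<longleftrightarrow> e \<in> H"
  by (auto simp: representations_def)

lemma rep_Units: "f \<in> representations M P \<Longrightarrow> H \<in> hyperplanes M \<Longrightarrow> e \<in> ground M \<Longrightarrow> e \<notin> H \<Longrightarrow>
    f H e \<in> Units P"
  by (simp add: Units_iff rep_closed rep_zer_iff del: Units_closed)

text \<open>The definition only asks that the coefficients are not all zero. An element of exactly
  one of the hyperplanes kills one row and leaves a two-term relation, so the other two coefficients
  vanish together; two such elements tie all three.\<close>

lemma modular_triple_coefficients_Units:
  assumes M: "ranked M" and f: "f \<in> representations M P" and m: "modular_triple M H1 H2 H3"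
  obtains c1 c2 c3 where "c1 \<in> Units P" "c2 \<in> Units P" "c3 \<in> Units P"
    "\<And>e. e \<in> ground M \<Longrightarrow> {#c1 \<otimes> f H1 e, c2 \<otimes> f H2 e, c3 \<otimes> f H3 e#} \<in> nullset P"
proof -
  obtain c1 c2 c3 where c: "c1 \<in> carrier P" "c2 \<in> carrier P" "c3 \<in> carrier P"
    and nz: "\<not> (c1 = zer P \<and> c2 = zer P \<and> c3 = zer P)"
    and null: "\<And>e. e \<in> ground M \<Longrightarrow> {#c1 \<otimes> f H1 e, c2 \<otimes> f H2 e, c3 \<otimes> f H3 e#} \<in> nullset P"
  proof -
    have "\<exists>c1\<in>carrier P. \<exists>c2\<in>carrier P. \<exists>c3\<in>carrier P.
        \<not> (c1 = zer P \<and> c2 = zer P \<and> c3 = zer P) \<and>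
        (\<forall>e\<in>ground M. {#c1 \<otimes> f H1 e, c2 \<otimes> f H2 e, c3 \<otimes> f H3 e#} \<in> nullset P)"
      using f m by (simp add: representations_def)
    then show thesis by (elim bexE conjE) (rule that, assumption+, erule bspec)
  qed
  have H: "H1 \<in> hyperplanes M" "H2 \<in> hyperplanes M" "H3 \<in> hyperplanes M"
    and int: "H1 \<inter> H3 = H1 \<inter> H2" "H2 \<inter> H3 = H1 \<inter> H2"
    and corank: "corank_flat M 2 (H1 \<inter> H2)"
    using m unfolding modular_triple_def by metis+
  have "H1 \<inter> H2 \<notin> hyperplanes M" using corank by (auto simp: hyperplanes_def corank_flat_def)
  then have "\<not> H1 \<subseteq> H2" "\<not> H2 \<subseteq> H1"
    using H ranked.hyperplane_subset_eq[OF M] by (metis Int_absorb)+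
  then obtain x y where x: "x \<in> H1" "x \<notin> H2" and y: "y \<in> H2" "y \<notin> H1" by blast
  have xy: "x \<in> ground M" "y \<in> ground M"
    using x y H ranked.hyperplane_ground[OF M] by blast+
  have x3: "x \<notin> H3" and y3: "y \<notin> H3" using x y int by blast+
  have "f H1 x = zer P" "f H2 x \<noteq> zer P" "f H3 x \<noteq> zer P"
    "f H2 y = zer P" "f H1 y \<noteq> zer P" "f H3 y \<noteq> zer P"
    using rep_zer_iff[OF f] H xy x y x3 y3 by blast+
  note [simp] = this rep_closed[OF f] H xy c
  have "{#c2 \<otimes> f H2 x, c3 \<otimes> f H3 x, zer P#} \<in> nullset P"
    using null[OF xy(1)] by (simp add: add_mset_commute)
  then have "c2 = zer P \<longleftrightarrow> c3 = zer P" using null_pair_zer[of "c2 \<otimes> f H2 x" "c3 \<otimes> f H3 x"] by simp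
  moreover have "{#c1 \<otimes> f H1 y, c3 \<otimes> f H3 y, zer P#} \<in> nullset P"
    using null[OF xy(2)] by (simp add: add_mset_commute)
  then have "c1 = zer P \<longleftrightarrow> c3 = zer P" using null_pair_zer[of "c1 \<otimes> f H1 y" "c3 \<otimes> f H3 y"] by simp
  ultimately show thesis using that[of c1 c2 c3] nz null by (simp add: Units_iff del: Units_closed)
qed

lemma representationI:
  assumes "\<And>H e. H \<in> hyperplanes M \<Longrightarrow> e \<in> ground M \<Longrightarrow> f H e \<in> carrier P"
    and "\<And>H e. H \<in> hyperplanes M \<Longrightarrow> e \<in> ground M \<Longrightarrow> f H e = zer P \<longleftrightarrow> e \<in> H"
    and "\<And>H1 H2 H3. modular_triple M H1 H2 H3 \<Longrightarrow> \<exists>c1\<in>Units P. \<exists>c2\<in>Units P. \<exists>c3\<in>Units P.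
      \<forall>e\<in>ground M. {#c1 \<otimes> f H1 e, c2 \<otimes> f H2 e, c3 \<otimes> f H3 e#} \<in> nullset P"
  shows "restrict_family M f \<in> representations M P"
  unfolding representations_def
proof (intro CollectI conjI allI impI)
  show "restrict_family M f \<in> hyperplanes M \<rightarrow>\<^sub>E (ground M \<rightarrow>\<^sub>E carrier P)"
    using assms(1) by (auto simp: restrict_family_def)
  show "\<forall>H\<in>hyperplanes M. \<forall>e\<in>ground M. (restrict_family M f H e = zer P) = (e \<in> H)"
    using assms(2) by (simp add: restrict_family_def)
  fix H1 H2 H3 assume m: "modular_triple M H1 H2 H3"
  then have H: "H1 \<in> hyperplanes M" "H2 \<in> hyperplanes M" "H3 \<in> hyperplanes M"
    by (auto simp: modular_triple_def)
  obtain c1 c2 c3 where c: "c1 \<in> Units P" "c2 \<in> Units P" "c3 \<in> Units P"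
    "\<forall>e\<in>ground M. {#c1 \<otimes> f H1 e, c2 \<otimes> f H2 e, c3 \<otimes> f H3 e#} \<in> nullset P"
    using assms(3)[OF m] by blast
  show "\<exists>c1\<in>carrier P. \<exists>c2\<in>carrier P. \<exists>c3\<in>carrier P. \<not> (c1 = zer P \<and> c2 = zer P \<and> c3 = zer P) \<and>
      (\<forall>e\<in>ground M. {#c1 \<otimes> restrict_family M f H1 e, c2 \<otimes> restrict_family M f H2 e,
        c3 \<otimes> restrict_family M f H3 e#} \<in> nullset P)"
    by (rule bexI[of _ c1], rule bexI[of _ c2], rule bexI[of _ c3])
      (use c H in \<open>auto simp: restrict_family_def Units_iff simp del: Units_closed\<close>)
qed

lemma rescalingI:
  assumes f: "f \<in> representations M P" and g: "g \<in> representations M P"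
    and d: "\<And>e. e \<in> ground M \<Longrightarrow> d e \<in> Units P"
    and c: "\<And>H. H \<in> hyperplanes M \<Longrightarrow>
      \<exists>c\<in>Units P. \<forall>e\<in>ground M. g H e = c \<otimes> d e \<otimes> f H e"
  shows "(f, g) \<in> rescaling_rel M P"
proof -
  obtain c' where "\<And>H. H \<in> hyperplanes M \<Longrightarrow>
      c' H \<in> Units P \<and> (\<forall>e\<in>ground M. g H e = c' H \<otimes> d e \<otimes> f H e)"
    using c by metis
  then show ?thesis using f g d unfolding rescaling_rel_def by blast
qed

lemma rescalingE:
  assumes "(f, g) \<in> rescaling_rel M P"
  obtains c d where "f \<in> representations M P" "g \<in> representations M P"
    "\<forall>H\<in>hyperplanes M. c H \<in> Units P" "\<forall>e\<in>ground M. d e \<in> Units P"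
    "\<forall>H\<in>hyperplanes M. \<forall>e\<in>ground M. g H e = c H \<otimes> d e \<otimes> f H e"
  using assms unfolding rescaling_rel_def by blast

lemma equiv_rescaling: "equiv (representations M P) (rescaling_rel M P)"
proof (rule equivI)
  show "rescaling_rel M P \<subseteq> representations M P \<times> representations M P"
    by (auto simp: rescaling_rel_def)
  show "refl_on (representations M P) (rescaling_rel M P)"
  proof (rule refl_onI)
    fix f assume f: "f \<in> representations M P"
    show "(f, f) \<in> rescaling_rel M P"
      by (rule rescalingI[OF f f, of "\<lambda>_. \<one>"]) (auto intro!: bexI[of _ \<one>] simp: rep_closed[OF f])
  qed
  show "sym (rescaling_rel M P)"
  proof (rule symI)
    fix f g assume "(f, g) \<in> rescaling_rel M P"
    then obtain c d where r: "f \<in> representations M P" "g \<in> representations M P"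
      and cd: "\<forall>H\<in>hyperplanes M. c H \<in> Units P" "\<forall>e\<in>ground M. d e \<in> Units P"
        "\<forall>H\<in>hyperplanes M. \<forall>e\<in>ground M. g H e = c H \<otimes> d e \<otimes> f H e"
      by (rule rescalingE)
    note u = cd(1,2)[rule_format] and eq = cd(3)[rule_format]
    have "f H e = inv c H \<otimes> inv d e \<otimes> g H e" if He: "H \<in> hyperplanes M" "e \<in> ground M" for H e
    proof -
      note [simp] = u(1)[OF He(1)] u(2)[OF He(2)] rep_closed[OF r(1) He]
      have "inv c H \<otimes> inv d e \<otimes> g H e = (inv d e \<otimes> inv c H) \<otimes> (c H \<otimes> (d e \<otimes> f H e))"
        using eq[OF He] by (simp add: m_comm[of "inv c H" "inv d e"] m_assoc[of "c H"])
      also have "\<dots> = (\<one> \<otimes> inv d e) \<otimes> (d e \<otimes> f H e)"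
        by (subst Units_cancel_inv) auto
      also have "\<dots> = f H e" by (subst Units_cancel_inv) auto
      finally show ?thesis by simp
    qed
    then show "(g, f) \<in> rescaling_rel M P"
      using u by (intro rescalingI[OF r(2,1), of "\<lambda>e. inv d e"]) blast+
  qed
  show "trans (rescaling_rel M P)"
  proof (rule transI)
    fix f g h assume "(f, g) \<in> rescaling_rel M P" "(g, h) \<in> rescaling_rel M P"
    then obtain c d c' d' where r: "f \<in> representations M P" "h \<in> representations M P"
      and cd: "\<forall>H\<in>hyperplanes M. c H \<in> Units P" "\<forall>e\<in>ground M. d e \<in> Units P"
        "\<forall>H\<in>hyperplanes M. c' H \<in> Units P" "\<forall>e\<in>ground M. d' e \<in> Units P"
      and cd_eq: "\<forall>H\<in>hyperplanes M. \<forall>e\<in>ground M. g H e = c H \<otimes> d e \<otimes> f H e"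
        "\<forall>H\<in>hyperplanes M. \<forall>e\<in>ground M. h H e = c' H \<otimes> d' e \<otimes> g H e"
      by (elim rescalingE)
    note u = cd[rule_format] and eq = cd_eq[rule_format]
    have "h H e = (c' H \<otimes> c H) \<otimes> (d' e \<otimes> d e) \<otimes> f H e"
      if He: "H \<in> hyperplanes M" "e \<in> ground M" for H e
      using eq He u(1,3)[OF He(1)] u(2,4)[OF He(2)] rep_closed[OF r(1) He]
      by (simp add: m_ac)
    then show "(f, h) \<in> rescaling_rel M P"
      using u by (intro rescalingI[OF r, of "\<lambda>e. d' e \<otimes> d e"]) blast+
  qed
qed

end

section \<open>Cross ratios and the column of a fixed element\<close>

context pasture_struct
begin

text \<open>The element \<epsilon> of the pasture, chosen by the property it is used for: turning a
  two-term null sum into an equation.\<close>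

definition minus_one :: 'u where
  "minus_one = (SOME u. u \<in> Units P \<and>
    (\<forall>a\<in>carrier P. \<forall>b\<in>carrier P. {#a, b, zer P#} \<in> nullset P \<longrightarrow> b = u \<otimes> a))"

lemma minus_one_Units [simp]: "minus_one \<in> Units P"
  and null_pair: "a \<in> carrier P \<Longrightarrow> b \<in> carrier P \<Longrightarrow> {#a, b, zer P#} \<in> nullset P \<Longrightarrow>
    b = minus_one \<otimes> a"
proof -
  have "\<exists>u. u \<in> Units P \<and>
      (\<forall>a\<in>carrier P. \<forall>b\<in>carrier P. {#a, b, zer P#} \<in> nullset P \<longrightarrow> b = u \<otimes> a)"
    by (rule additive_inverse) blast
  from someI_ex[OF this, folded minus_one_def]
  show "minus_one \<in> Units P"
    and "a \<in> carrier P \<Longrightarrow> b \<in> carrier P \<Longrightarrow> {#a, b, zer P#} \<in> nullset P \<Longrightarrow>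
      b = minus_one \<otimes> a"
    by blast+
qed

text \<open>At each of \<open>p\<close>, \<open>x\<close>, \<open>y\<close> one row vanishes.
  Eliminating the coefficients from the three resulting two-term relations leaves an identity
  between entries alone.\<close>

lemma modular_triple_cross_ratio:
  assumes M: "ranked M" and f: "f \<in> representations M P" and m: "modular_triple M H A A'"
    and p: "p \<in> H" "p \<notin> A" "p \<notin> A'" and x: "x \<in> A - A'" and y: "y \<in> A' - A"
  shows "minus_one \<otimes> (f A p \<otimes> f A' x \<otimes> f H y) = f A' p \<otimes> f A y \<otimes> f H x"
proof -
  obtain c1 c2 c3 where c: "c1 \<in> Units P" "c2 \<in> Units P" "c3 \<in> Units P"
    and null: "\<And>e. e \<in> ground M \<Longrightarrow> {#c1 \<otimes> f H e, c2 \<otimes> f A e, c3 \<otimes> f A' e#} \<in> nullset P"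
    using modular_triple_coefficients_Units[OF M f m] by metis
  have H: "H \<in> hyperplanes M" "A \<in> hyperplanes M" "A' \<in> hyperplanes M"
    using m by (auto simp: modular_triple_def)
  have g: "p \<in> ground M" "x \<in> ground M" "y \<in> ground M"
    using p x y H ranked.hyperplane_ground[OF M] by blast+
  have z: "f H p = zer P" "f A x = zer P" "f A' y = zer P"
    using rep_zer_iff[OF f] H g p x y by blast+
  note [simp] = c rep_closed[OF f] H g
  have e1: "c3 \<otimes> f A' p = minus_one \<otimes> (c2 \<otimes> f A p)"
    using null[OF g(1)] z by (intro null_pair) (auto simp: add_mset_commute)
  have e2: "c3 \<otimes> f A' x = minus_one \<otimes> (c1 \<otimes> f H x)"
    using null[OF g(2)] z by (intro null_pair) (auto simp: add_mset_commute)
  have e3: "c2 \<otimes> f A y = minus_one \<otimes> (c1 \<otimes> f H y)"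
    using null[OF g(3)] z by (intro null_pair) (auto simp: add_mset_commute)
  show ?thesis
  proof (rule mult_cancel[of "c1 \<otimes> c2 \<otimes> c3"])
    have "(c1 \<otimes> c2 \<otimes> c3) \<otimes> (minus_one \<otimes> (f A p \<otimes> f A' x \<otimes> f H y)) =
        minus_one \<otimes> (c2 \<otimes> f A p) \<otimes> (c1 \<otimes> f H y) \<otimes> (c3 \<otimes> f A' x)"
      by (simp add: m_ac)
    also have "\<dots> = (minus_one \<otimes> (c2 \<otimes> f A p)) \<otimes> (minus_one \<otimes> (c1 \<otimes> f H y)) \<otimes> (c1 \<otimes> f H x)"
      unfolding e2 by (simp add: m_ac)
    also have "\<dots> = (c3 \<otimes> f A' p) \<otimes> (c2 \<otimes> f A y) \<otimes> (c1 \<otimes> f H x)"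
      unfolding e1 e3 ..
    also have "\<dots> = (c1 \<otimes> c2 \<otimes> c3) \<otimes> (f A' p \<otimes> f A y \<otimes> f H x)"
      by (simp add: m_ac)
    finally show "(c1 \<otimes> c2 \<otimes> c3) \<otimes> (minus_one \<otimes> (f A p \<otimes> f A' x \<otimes> f H y)) =
        (c1 \<otimes> c2 \<otimes> c3) \<otimes> (f A' p \<otimes> f A y \<otimes> f H x)" .
  qed simp_all
qed

text \<open>Cross-multiplied form of: the ratio of \<open>g A p\<close> to
  \<open>s A \<otimes> f A p\<close> is the same for all hyperplanes avoiding \<open>p\<close>, so
  the column of \<open>p\<close> also changes by a single factor. Comparing cross ratios proves it
  for neighbours in a modular triple through \<open>p\<close>; connectivity does the rest.\<close>

lemma rep_determined_off_element:
  assumes M: "circuit_matroid M" and f: "f \<in> representations M P" and g: "g \<in> representations M P"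
    and s: "\<And>H. H \<in> hyperplanes M \<Longrightarrow> s H \<in> Units P"
    and eq: "\<And>H e. H \<in> hyperplanes M \<Longrightarrow> e \<in> ground M \<Longrightarrow> e \<noteq> p \<Longrightarrow> g H e = s H \<otimes> f H e"
    and p: "p \<in> ground M"
    and A: "A \<in> hyperplanes M" "p \<notin> A" and A': "A' \<in> hyperplanes M" "p \<notin> A'"
  shows "g A p \<otimes> s A' \<otimes> f A' p = g A' p \<otimes> s A \<otimes> f A p"
proof -
  have M': "ranked M" proof -
    interpret circuit_matroid M by (rule M)
    show ?thesis by unfold_locales
  qed
  have adj: "g K p \<otimes> s K' \<otimes> f K' p = g K' p \<otimes> s K \<otimes> f K p"
    if m: "modular_triple M H K K'" and pH: "p \<in> H" "p \<notin> K" "p \<notin> K'" for H K K'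
  proof -
    have H: "H \<in> hyperplanes M" "K \<in> hyperplanes M" "K' \<in> hyperplanes M"
      and int: "H \<inter> K = K \<inter> K'" "H \<inter> K' = K \<inter> K'" and corank: "corank_flat M 2 (K \<inter> K')"
      using m unfolding modular_triple_def by metis+
    have "K \<inter> K' \<notin> hyperplanes M" using corank by (auto simp: hyperplanes_def corank_flat_def)
    then have "\<not> K \<subseteq> K'" "\<not> K' \<subseteq> K"
      using H ranked.hyperplane_subset_eq[OF M'] by (metis Int_absorb)+
    \<comment> \<open>Both elements differ from \<open>p\<close>, so the hypothesis on
      \<open>g\<close> and \<open>f\<close> applies to every entry at \<open>x\<close> and
      \<open>y\<close> in the cross ratio.\<close>
    then obtain x y where x: "x \<in> K - K'" and y: "y \<in> K' - K" by blast
    have xy: "x \<in> ground M" "y \<in> ground M" "x \<noteq> p" "y \<noteq> p"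
      using x y H pH ranked.hyperplane_ground[OF M'] by blast+
    have "x \<notin> H" using x int by blast
    then have u: "f H x \<in> Units P" "f K y \<in> Units P"
      using rep_Units[OF f] H xy y by blast+
    note [simp] = u rep_closed[OF f] rep_closed[OF g] s H xy p
    have qf: "minus_one \<otimes> (f K p \<otimes> f K' x \<otimes> f H y) = f K' p \<otimes> f K y \<otimes> f H x"
      by (rule modular_triple_cross_ratio[OF M' f m pH x y])
    have "minus_one \<otimes> (g K p \<otimes> g K' x \<otimes> g H y) = g K' p \<otimes> g K y \<otimes> g H x"
      by (rule modular_triple_cross_ratio[OF M' g m pH x y])
    then have qg: "minus_one \<otimes> (g K p \<otimes> (s K' \<otimes> f K' x) \<otimes> (s H \<otimes> f H y)) =
        g K' p \<otimes> (s K \<otimes> f K y) \<otimes> (s H \<otimes> f H x)"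
      by (simp only: eq[OF H(3) xy(1,3)] eq[OF H(1) xy(2,4)] eq[OF H(2) xy(2,4)] eq[OF H(1) xy(1,3)])
    show ?thesis
    proof (rule mult_cancel[of "f H x \<otimes> f K y \<otimes> s H"])
      have "(f H x \<otimes> f K y \<otimes> s H) \<otimes> (g K p \<otimes> s K' \<otimes> f K' p) =
          g K p \<otimes> s K' \<otimes> s H \<otimes> (f K' p \<otimes> f K y \<otimes> f H x)"
        by (simp add: m_ac)
      also have "\<dots> = minus_one \<otimes> (g K p \<otimes> (s K' \<otimes> f K' x) \<otimes> (s H \<otimes> f H y)) \<otimes> f K p"
        unfolding qf[symmetric] by (simp add: m_ac)
      also have "\<dots> = (f H x \<otimes> f K y \<otimes> s H) \<otimes> (g K' p \<otimes> s K \<otimes> f K p)"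
        unfolding qg by (simp add: m_ac)
      finally show "(f H x \<otimes> f K y \<otimes> s H) \<otimes> (g K p \<otimes> s K' \<otimes> f K' p) =
          (f H x \<otimes> f K y \<otimes> s H) \<otimes> (g K' p \<otimes> s K \<otimes> f K p)" .
    qed simp_all
  qed
  have "(A, A') \<in> {(K, K'). p \<notin> K \<and> p \<notin> K' \<and> (\<exists>H. p \<in> H \<and> modular_triple M H K K')}\<^sup>*"
    by (rule circuit_matroid.hyperplanes_avoiding_connected[OF M A A' p])
  then show ?thesis
  proof (induction rule: rtrancl_induct)
    case (step K K')
    then obtain H where m: "modular_triple M H K K'" and pH: "p \<in> H" "p \<notin> K" "p \<notin> K'" by blast
    have K: "K \<in> hyperplanes M" "K' \<in> hyperplanes M" using m by (auto simp: modular_triple_def)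
    have u: "f K p \<in> Units P" using rep_Units[OF f K(1) p] pH by blast
    note [simp] = u rep_closed[OF f] rep_closed[OF g] s K A p

    show ?case
    \<comment> \<open>Chaining two cross-multiplied ratios leaves the unit of the middle hyperplane
      to be cancelled.\<close>
    proof (rule mult_cancel[of "s K \<otimes> f K p"])
      have "(s K \<otimes> f K p) \<otimes> (g A p \<otimes> s K' \<otimes> f K' p) = (g A p \<otimes> s K \<otimes> f K p) \<otimes> (s K' \<otimes> f K' p)"
        by (simp add: m_ac)
      also have "\<dots> = (g K p \<otimes> s K' \<otimes> f K' p) \<otimes> (s A \<otimes> f A p)"
        unfolding step.IH by (simp add: m_ac)
      also have "\<dots> = (s K \<otimes> f K p) \<otimes> (g K' p \<otimes> s A \<otimes> f A p)"
        unfolding adj[OF m pH] by (simp add: m_ac)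
      finally show "(s K \<otimes> f K p) \<otimes> (g A p \<otimes> s K' \<otimes> f K' p) =
          (s K \<otimes> f K p) \<otimes> (g K' p \<otimes> s A \<otimes> f A p)" .
    qed simp_all
  qed simp
qed

end

section \<open>Pushing representations forward along morphisms\<close>

locale pasture_map =
  P: pasture_struct P + Q: pasture_struct Q for P :: "'u pasture" and Q :: "'v pasture" +
  fixes h
  assumes hom: "h \<in> pasture_hom P Q"
begin

lemma closed [simp]: "x \<in> carrier P \<Longrightarrow> h x \<in> carrier Q"
  using hom by (auto simp: pasture_hom_def hom_def)

lemma mult: "x \<in> carrier P \<Longrightarrow> y \<in> carrier P \<Longrightarrow> h (x \<otimes>\<^bsub>P\<^esub> y) = h x \<otimes>\<^bsub>Q\<^esub> h y"
  using hom by (auto simp: pasture_hom_def hom_def)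

lemma zer: "h (zer P) = zer Q" and one: "h \<one>\<^bsub>P\<^esub> = \<one>\<^bsub>Q\<^esub>"
  using hom by (auto simp: pasture_hom_def)

lemma null: "{#a, b, c#} \<in> nullset P \<Longrightarrow> {#h a, h b, h c#} \<in> nullset Q"
  using hom unfolding pasture_hom_def by fastforce

lemma Units:
  assumes "x \<in> Units P"
  shows "h x \<in> Units Q"
proof -
  have "h x \<otimes>\<^bsub>Q\<^esub> h (inv\<^bsub>P\<^esub> x) = \<one>\<^bsub>Q\<^esub>" using assms mult[of x "inv\<^bsub>P\<^esub> x"] one by simp
  moreover have "\<one>\<^bsub>Q\<^esub> \<noteq> zer Q" using Q.Units_one_closed Q.Units_iff by blast
  ultimately have "h x \<noteq> zer Q" using assms by force
  then show ?thesis using assms Q.Units_iff by simp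
qed

lemma zer_iff: "x \<in> carrier P \<Longrightarrow> h x = zer Q \<longleftrightarrow> x = zer P"
  using Units[of x] P.Units_iff Q.Units_iff zer by auto

lemma push_rep_eq: "push_rep N h f = restrict_family N (\<lambda>H e. h (f H e))"
  by (simp add: push_rep_def restrict_family_def)

text \<open>Morphisms preserve units, so both the zero pattern of the rows and the nonvanishing of
  the coefficients survive.\<close>

lemma push_representation:
  assumes N: "ranked N" and f: "f \<in> representations N P"
  shows "push_rep N h f \<in> representations N Q"
  unfolding push_rep_eq
proof (rule Q.representationI)
  show "h (f H e) \<in> carrier Q" "h (f H e) = zer Q \<longleftrightarrow> e \<in> H"
    if "H \<in> hyperplanes N" "e \<in> ground N" for H e
    using that P.rep_closed[OF f] P.rep_zer_iff[OF f] zer_iff by auto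
  fix H1 H2 H3 assume m: "modular_triple N H1 H2 H3"
  then obtain c1 c2 c3 where c: "c1 \<in> Units P" "c2 \<in> Units P" "c3 \<in> Units P"
    and nl: "\<And>e. e \<in> ground N \<Longrightarrow>
      {#c1 \<otimes>\<^bsub>P\<^esub> f H1 e, c2 \<otimes>\<^bsub>P\<^esub> f H2 e, c3 \<otimes>\<^bsub>P\<^esub> f H3 e#} \<in> nullset P"
    using P.modular_triple_coefficients_Units[OF N f] by metis
  have H: "H1 \<in> hyperplanes N" "H2 \<in> hyperplanes N" "H3 \<in> hyperplanes N"
    using m by (auto simp: modular_triple_def)
  have "{#h c1 \<otimes>\<^bsub>Q\<^esub> h (f H1 e), h c2 \<otimes>\<^bsub>Q\<^esub> h (f H2 e), h c3 \<otimes>\<^bsub>Q\<^esub> h (f H3 e)#} \<in> nullset Q"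
    if e: "e \<in> ground N" for e
    using null[OF nl[OF e]] c P.rep_closed[OF f _ e] H by (simp add: mult)
  then show "\<exists>c1\<in>Units Q. \<exists>c2\<in>Units Q. \<exists>c3\<in>Units Q. \<forall>e\<in>ground N.
      {#c1 \<otimes>\<^bsub>Q\<^esub> h (f H1 e), c2 \<otimes>\<^bsub>Q\<^esub> h (f H2 e), c3 \<otimes>\<^bsub>Q\<^esub> h (f H3 e)#} \<in> nullset Q"
    using c Units by blast
qed

lemma push_rescaling:
  assumes N: "ranked N" and fg: "(f, g) \<in> rescaling_rel N P"
  shows "(push_rep N h f, push_rep N h g) \<in> rescaling_rel N Q"
proof -
  obtain c d where r: "f \<in> representations N P" "g \<in> representations N P"
    and cd: "\<forall>H\<in>hyperplanes N. c H \<in> Units P" "\<forall>e\<in>ground N. d e \<in> Units P"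
      "\<forall>H\<in>hyperplanes N. \<forall>e\<in>ground N. g H e = c H \<otimes>\<^bsub>P\<^esub> d e \<otimes>\<^bsub>P\<^esub> f H e"
    using fg by (rule P.rescalingE)
  have "push_rep N h g H e = h (c H) \<otimes>\<^bsub>Q\<^esub> h (d e) \<otimes>\<^bsub>Q\<^esub> push_rep N h f H e"
    if "H \<in> hyperplanes N" "e \<in> ground N" for H e
    using that cd P.rep_closed[OF r(1)] by (simp add: push_rep_def mult)
  then show ?thesis
    using cd Units push_representation[OF N] r
    by (intro Q.rescalingI[where d="\<lambda>e. h (d e)"]) blast+
qed

end

lemma push_rep_compose:
  assumes "pasture P" "f \<in> representations N P"
  shows "push_rep N (compose (carrier P) h g) f = push_rep N h (push_rep N g f)"
proof -
  interpret pasture_struct P using assms by unfold_locales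
  show ?thesis using rep_closed[OF assms(2)]
    by (auto simp: push_rep_def compose_def fun_eq_iff restrict_def)
qed

section \<open>Pulling representations back along embeddings of hyperplanes\<close>

definition hyperplane_embedding ::
    "'e matroid \<Rightarrow> 'e matroid \<Rightarrow> ('e set \<Rightarrow> 'e set) \<Rightarrow> ('e \<Rightarrow> 'e) \<Rightarrow> bool" where
  "hyperplane_embedding M N \<sigma> \<tau> \<longleftrightarrow>
     (\<forall>H\<in>hyperplanes M. \<sigma> H \<in> hyperplanes N) \<and> (\<forall>e\<in>ground M. \<tau> e \<in> ground N) \<and>
     (\<forall>H\<in>hyperplanes M. \<forall>e\<in>ground M. \<tau> e \<in> \<sigma> H \<longleftrightarrow> e \<in> H) \<and>
     (\<forall>H1 H2 H3. modular_triple M H1 H2 H3 \<longrightarrow> modular_triple N (\<sigma> H1) (\<sigma> H2) (\<sigma> H3))"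

definition pull_rep ::
    "'e matroid \<Rightarrow> ('e set \<Rightarrow> 'e set) \<Rightarrow> ('e \<Rightarrow> 'e) \<Rightarrow> ('e set \<Rightarrow> 'e \<Rightarrow> 'u) \<Rightarrow> 'e set \<Rightarrow> 'e \<Rightarrow> 'u" where
  "pull_rep M \<sigma> \<tau> f = restrict_family M (\<lambda>H e. f (\<sigma> H) (\<tau> e))"

lemma pull_rep_apply: "H \<in> hyperplanes M \<Longrightarrow> e \<in> ground M \<Longrightarrow> pull_rep M \<sigma> \<tau> f H e = f (\<sigma> H) (\<tau> e)"
  by (simp add: pull_rep_def restrict_family_def)

lemma push_pull_rep:
  "hyperplane_embedding M N \<sigma> \<tau> \<Longrightarrow> push_rep M h (pull_rep M \<sigma> \<tau> f) = pull_rep M \<sigma> \<tau> (push_rep N h f)"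
  by (auto simp: push_rep_def pull_rep_def restrict_family_def hyperplane_embedding_def fun_eq_iff restrict_def)

context pasture_struct
begin

lemma pull_representation:
  assumes N: "ranked N" and emb: "hyperplane_embedding M N \<sigma> \<tau>" and f: "f \<in> representations N P"
  shows "pull_rep M \<sigma> \<tau> f \<in> representations M P"
  unfolding pull_rep_def
proof (rule representationI)
  show "f (\<sigma> H) (\<tau> e) \<in> carrier P" "f (\<sigma> H) (\<tau> e) = zer P \<longleftrightarrow> e \<in> H"
    if "H \<in> hyperplanes M" "e \<in> ground M" for H e
    using that rep_closed[OF f] rep_zer_iff[OF f] emb by (auto simp: hyperplane_embedding_def)
  fix H1 H2 H3 assume m: "modular_triple M H1 H2 H3"
  then have "modular_triple N (\<sigma> H1) (\<sigma> H2) (\<sigma> H3)" using emb by (simp add: hyperplane_embedding_def)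
  then obtain c1 c2 c3 where c: "c1 \<in> Units P" "c2 \<in> Units P" "c3 \<in> Units P"
    and nl: "\<And>e. e \<in> ground N \<Longrightarrow>
      {#c1 \<otimes> f (\<sigma> H1) e, c2 \<otimes> f (\<sigma> H2) e, c3 \<otimes> f (\<sigma> H3) e#} \<in> nullset P"
    using modular_triple_coefficients_Units[OF N f] by metis
  have "\<forall>e\<in>ground M. \<tau> e \<in> ground N" using emb by (simp add: hyperplane_embedding_def)
  then show "\<exists>c1\<in>Units P. \<exists>c2\<in>Units P. \<exists>c3\<in>Units P. \<forall>e\<in>ground M.
      {#c1 \<otimes> f (\<sigma> H1) (\<tau> e), c2 \<otimes> f (\<sigma> H2) (\<tau> e), c3 \<otimes> f (\<sigma> H3) (\<tau> e)#} \<in> nullset P"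
    using c nl by blast
qed

lemma pull_rescaling:
  assumes N: "ranked N" and emb: "hyperplane_embedding M N \<sigma> \<tau>" and fg: "(f, g) \<in> rescaling_rel N P"
  shows "(pull_rep M \<sigma> \<tau> f, pull_rep M \<sigma> \<tau> g) \<in> rescaling_rel M P"
proof -
  obtain c d where r: "f \<in> representations N P" "g \<in> representations N P"
    and cd: "\<forall>H\<in>hyperplanes N. c H \<in> Units P" "\<forall>e\<in>ground N. d e \<in> Units P"
      "\<forall>H\<in>hyperplanes N. \<forall>e\<in>ground N. g H e = c H \<otimes> d e \<otimes> f H e"
    using fg by (rule rescalingE)
  have e: "\<forall>H\<in>hyperplanes M. \<sigma> H \<in> hyperplanes N" "\<forall>e\<in>ground M. \<tau> e \<in> ground N"
    using emb by (simp_all add: hyperplane_embedding_def)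
  have "pull_rep M \<sigma> \<tau> g H e = c (\<sigma> H) \<otimes> d (\<tau> e) \<otimes> pull_rep M \<sigma> \<tau> f H e"
    if "H \<in> hyperplanes M" "e \<in> ground M" for H e
    using that cd e by (simp add: pull_rep_apply)
  then show ?thesis
    using cd e pull_representation[OF N emb] r
    by (intro rescalingI[where d="\<lambda>e. d (\<tau> e)"]) blast+
qed

end

subsection \<open>Foundations and tensor products\<close>

lemma nullset_carrier:
  assumes "pasture P" "X \<in> nullset P"
  shows "set_mset X \<subseteq> carrier P"
proof -
  have "nullset P \<subseteq> {{#a, b, c#} |a b c. a \<in> carrier P \<and> b \<in> carrier P \<and> c \<in> carrier P}"
    using assms(1) by (simp add: pasture_def)
  then obtain a b c where "X = {#a, b, c#}" "a \<in> carrier P" "b \<in> carrier P" "c \<in> carrier P"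
    using assms(2) by blast
  then show ?thesis by simp
qed

lemma pasture_hom_compose:
  assumes "pasture P" "pasture Q" "pasture R" "g \<in> pasture_hom P Q" "h \<in> pasture_hom Q R"
  shows "compose (carrier P) h g \<in> pasture_hom P R"
proof -
  interpret g: pasture_map P Q g using assms by unfold_locales
  interpret h: pasture_map Q R h using assms by unfold_locales
  have "image_mset (compose (carrier P) h g) X \<in> nullset R" if X: "X \<in> nullset P" for X
  proof -
    have "set_mset X \<subseteq> carrier P" using nullset_carrier assms(1) X by blast
    then have "image_mset (compose (carrier P) h g) X = image_mset h (image_mset g X)"
      unfolding image_mset.compositionality by (intro image_mset_cong) (auto simp: compose_def)
    moreover have "image_mset g X \<in> nullset Q" using X assms(4) by (simp add: pasture_hom_def)
    ultimately show ?thesis using assms(5) by (simp add: pasture_hom_def)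
  qed
  then show ?thesis
    by (auto simp: pasture_hom_def hom_def compose_def g.mult h.mult g.zer h.zer g.one h.one)
qed

lemma pasture_hom_id:
  assumes "pasture F"
  shows "(\<lambda>x\<in>carrier F. x) \<in> pasture_hom F F"
proof -
  interpret pasture_struct F using assms by unfold_locales
  have "image_mset (\<lambda>x\<in>carrier F. x) X = X" if "X \<in> nullset F" for X
  proof -
    have "set_mset X \<subseteq> carrier F" using nullset_carrier assms that by blast
    then have "image_mset (\<lambda>x\<in>carrier F. x) X = image_mset (\<lambda>x. x) X"
      by (intro image_mset_cong) auto
    then show ?thesis by simp
  qed
  then show ?thesis by (auto simp: pasture_hom_def hom_def)
qed

text \<open>Used to evaluate \<open>push_class\<close> on a class by pushing one
  representative.\<close>

lemma equiv_class_image: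
  assumes r: "equiv A r" and s: "equiv B s" and a: "a \<in> A"
    and \<phi>: "\<And>x y. (x, y) \<in> r \<Longrightarrow> (\<phi> x, \<phi> y) \<in> s"
  shows "s `` (\<phi> ` (r `` {a})) = s `` {\<phi> a}"
proof (intro equalityI subsetI)
  fix z assume "z \<in> s `` (\<phi> ` (r `` {a}))"
  then obtain x where "(a, x) \<in> r" "(\<phi> x, z) \<in> s" by blast
  then show "z \<in> s `` {\<phi> a}" using \<phi> s by (meson ImageI equivE singletonI transD)
next
  fix z assume z: "z \<in> s `` {\<phi> a}"
  have "(a, a) \<in> r" using r a by (meson equivE refl_onD)
  then show "z \<in> s `` (\<phi> ` (r `` {a}))" using z by blast
qed

text \<open>The Yoneda argument: the class belonging to the identity of \<open>F\<close> is
  universal, and \<open>u\<close> is a representative of it.\<close>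

lemma foundation_universal:
  fixes N :: "'e matroid" and F :: "'u pasture"
  assumes F: "is_foundation N F" and N: "ranked N"
  obtains u where "u \<in> representations N F"
    "\<And>(R :: 'u pasture) f. pasture R \<Longrightarrow> f \<in> representations N R \<Longrightarrow>
      \<exists>!h. h \<in> pasture_hom F R \<and> (push_rep N h u, f) \<in> rescaling_rel N R"
proof -
  have pF: "pasture F" using F by (simp add: is_foundation_def)
  obtain \<Phi> :: "'u pasture \<Rightarrow> ('u \<Rightarrow> 'u) \<Rightarrow> ('e set \<Rightarrow> 'e \<Rightarrow> 'u) set"
    where bij: "\<And>P. pasture P \<Longrightarrow> bij_betw (\<Phi> P) (pasture_hom F P) (rescaling_classes N P)"
    and nat: "\<And>P Q h g. pasture P \<Longrightarrow> pasture Q \<Longrightarrow> h \<in> pasture_hom P Q \<Longrightarrow> g \<in> pasture_hom F P \<Longrightarrow>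
      \<Phi> Q (compose (carrier F) h g) = push_class N Q h (\<Phi> P g)"
    using F unfolding is_foundation_def by blast
  interpret F: pasture_struct F by unfold_locales (rule pF)
  define i where "i = (\<lambda>x\<in>carrier F. x)"
  have i: "i \<in> pasture_hom F F" unfolding i_def by (rule pasture_hom_id[OF pF])
  have "\<Phi> F i \<in> rescaling_classes N F" using bij[OF pF] i by (auto simp: bij_betw_def)
  then obtain u where u: "u \<in> representations N F" "\<Phi> F i = rescaling_rel N F `` {u}"
    unfolding rescaling_classes_def by (rule quotientE)
  have \<Phi>: "\<Phi> R h = rescaling_rel N R `` {push_rep N h u}"
    if R: "pasture R" and h: "h \<in> pasture_hom F R" for R :: "'u pasture" and h
  proof -
    interpret R: pasture_struct R by unfold_locales (rule R)
    interpret h: pasture_map F R h by unfold_locales (rule h)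
    \<comment> \<open>Since \<open>h\<close> factors through the identity \<open>i\<close>,
      naturality expresses its class by that of \<open>i\<close>.\<close>
    have "h = compose (carrier F) h i"
      using h by (auto simp: pasture_hom_def compose_def i_def extensional_def fun_eq_iff)
    then have "\<Phi> R h = push_class N R h (\<Phi> F i)" using nat[OF pF R h i] by simp
    also have "\<dots> = rescaling_rel N R `` {push_rep N h u}"
      unfolding push_class_def u(2)
      by (rule equiv_class_image[OF F.equiv_rescaling R.equiv_rescaling u(1) h.push_rescaling[OF N]])
    finally show ?thesis .
  qed
  show thesis
  proof (rule that[OF u(1)])
    fix R :: "'u pasture" and f assume R: "pasture R" and f: "f \<in> representations N R"
    interpret R: pasture_struct R by unfold_locales (rule R)
    have eq: "\<Phi> R h = rescaling_rel N R `` {f} \<longleftrightarrow> (push_rep N h u, f) \<in> rescaling_rel N R"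
      if h: "h \<in> pasture_hom F R" for h
    proof -
      interpret h: pasture_map F R h by unfold_locales (rule h)
      show ?thesis using \<Phi>[OF R h] eq_equiv_class_iff[OF R.equiv_rescaling
            h.push_representation[OF N u(1)] f] by simp
    qed
    have "rescaling_rel N R `` {f} \<in> rescaling_classes N R"
      unfolding rescaling_classes_def using f by (rule quotientI)
    then obtain h where h: "h \<in> pasture_hom F R" "\<Phi> R h = rescaling_rel N R `` {f}"
      using bij[OF R] by (metis bij_betw_imp_surj_on imageE)
    show "\<exists>!h. h \<in> pasture_hom F R \<and> (push_rep N h u, f) \<in> rescaling_rel N R"
    proof (rule ex1I[of _ h])
      show "h \<in> pasture_hom F R \<and> (push_rep N h u, f) \<in> rescaling_rel N R" using h eq by simp
      fix k assume k: "k \<in> pasture_hom F R \<and> (push_rep N k u, f) \<in> rescaling_rel N R"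
      then have "\<Phi> R k = \<Phi> R h" using h eq[of k] by simp
      then show "k = h" using bij[OF R] k h by (meson bij_betw_imp_inj_on inj_onD)
    qed
  qed
qed

lemma ex1_unique: "\<exists>!x. Q x \<Longrightarrow> Q a \<Longrightarrow> Q b \<Longrightarrow> a = b"
  by blast

text \<open>Uniqueness of coproducts: all pastures here share the type \<open>'u\<close>, so each of
  \<open>S\<close> and \<open>T\<close> is a test object for the other.\<close>

lemma tensor_product_unique:
  fixes A B S T :: "'u pasture"
  assumes S: "is_tensor_product A B S" and T: "is_tensor_product A B T"
    and A: "pasture A" and B: "pasture B"
  shows "pasture_isomorphic S T"
proof -
  obtain i j where pS: "pasture S" and ij: "i \<in> pasture_hom A S" "j \<in> pasture_hom B S"
    and allS: "\<forall>R :: 'u pasture. pasture R \<longrightarrow> (\<forall>f\<in>pasture_hom A R. \<forall>g\<in>pasture_hom B R.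
      \<exists>!h. h \<in> pasture_hom S R \<and> compose (carrier A) h i = f \<and> compose (carrier B) h j = g)"
    using S unfolding is_tensor_product_def by (elim conjE bexE) (rule that)
  note uS = allS[rule_format]
  obtain k l where pT: "pasture T" and kl: "k \<in> pasture_hom A T" "l \<in> pasture_hom B T"
    and allT: "\<forall>R :: 'u pasture. pasture R \<longrightarrow> (\<forall>f\<in>pasture_hom A R. \<forall>g\<in>pasture_hom B R.
      \<exists>!h. h \<in> pasture_hom T R \<and> compose (carrier A) h k = f \<and> compose (carrier B) h l = g)"
    using T unfolding is_tensor_product_def by (elim conjE bexE) (rule that)
  note uT = allT[rule_format]
  obtain g where g: "g \<in> pasture_hom S T" "compose (carrier A) g i = k" "compose (carrier B) g j = l"
    using uS[OF pT kl] by blast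
  obtain h where h: "h \<in> pasture_hom T S" "compose (carrier A) h k = i" "compose (carrier B) h l = j"
    using uT[OF pS ij] by blast
  have c: "compose (carrier X) (compose (carrier Y) b a) f = compose (carrier X) b (compose (carrier X) a f)"
    if "f \<in> pasture_hom X Y" for X Y :: "'u pasture" and a b f
  proof -
    have "\<And>x. x \<in> carrier X \<Longrightarrow> f x \<in> carrier Y" using that by (auto simp: pasture_hom_def hom_def)
    then show ?thesis by (auto simp: compose_def fun_eq_iff)
  qed
  have idc: "compose (carrier X) (\<lambda>x\<in>carrier Y. x) f = f"
    if "f \<in> pasture_hom X Y" for X Y :: "'u pasture" and f
    using that by (auto simp: pasture_hom_def hom_def compose_def extensional_def fun_eq_iff)
  have hg: "compose (carrier S) h g = (\<lambda>x\<in>carrier S. x)"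
  proof (rule ex1_unique[OF uS[OF pS ij]]; intro conjI)
    show "compose (carrier S) h g \<in> pasture_hom S S" by (rule pasture_hom_compose[OF pS pT pS g(1) h(1)])
    show "(\<lambda>x\<in>carrier S. x) \<in> pasture_hom S S" by (rule pasture_hom_id[OF pS])
  qed (simp_all only: c[OF ij(1)] c[OF ij(2)] idc[OF ij(1)] idc[OF ij(2)] g h)
  have gh: "compose (carrier T) g h = (\<lambda>x\<in>carrier T. x)"
  proof (rule ex1_unique[OF uT[OF pT kl]]; intro conjI)
    show "compose (carrier T) g h \<in> pasture_hom T T" by (rule pasture_hom_compose[OF pT pS pT h(1) g(1)])
    show "(\<lambda>x\<in>carrier T. x) \<in> pasture_hom T T" by (rule pasture_hom_id[OF pT])
  qed (simp_all only: c[OF kl(1)] c[OF kl(2)] idc[OF kl(1)] idc[OF kl(2)] g h)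
  have "h (g x) = x" if "x \<in> carrier S" for x
    using fun_cong[OF hg, of x] that by (simp add: compose_def)
  moreover have "g (h y) = y" if "y \<in> carrier T" for y
    using fun_cong[OF gh, of y] that by (simp add: compose_def)
  ultimately show ?thesis unfolding pasture_isomorphic_def using g(1) h(1) by blast
qed

subsection \<open>Representations of a 2-sum\<close>

context two_summands
begin

text \<open>As \<open>p\<close> is not a coloop, every hyperplane misses an element other than
  \<open>p\<close>; such an element can stand in for \<open>p\<close> in the 2-sum.\<close>

lemma hyperplane_not_all2: "B \<in> hyperplanes M2 \<Longrightarrow> \<not> E2 - {p} \<subseteq> B"
  using M2.rank_mono[of "E2 - {p}" B] M2.hyperplane_rank[of B] rank_ground_minus2 by auto

lemma hyperplane_not_all1: "A \<in> hyperplanes M1 \<Longrightarrow> \<not> E1 - {p} \<subseteq> A"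
  using M1.rank_mono[of "E1 - {p}" A] M1.hyperplane_rank[of A] rank_ground_minus1 by auto

text \<open>The element \<open>y\<close> plays the role of \<open>p\<close>: lying in
  \<open>E2\<close> but outside \<open>B\<close>, it belongs to a lift exactly when \<open>p\<close>
  belongs to the original hyperplane.\<close>

lemma embedding1:
  assumes B: "B \<in> hyperplanes M2" "p \<notin> B" and y: "y \<in> E2 - B" "y \<noteq> p"
  shows "hyperplane_embedding M1 N (lift1 B) (\<lambda>e. if e = p then y else e)"
proof -
  have yE: "y \<notin> E1" using y ground_Int by blast
  have BE: "B \<subseteq> E2" using B M2.hyperplane_ground by simp
  have "(if e = p then y else e) \<in> lift1 B H \<longleftrightarrow> e \<in> H" if "H \<in> hyperplanes M1" "e \<in> E1" for H e
    using that M1.hyperplane_ground[OF that(1)] y yE B(2) BE ground_Int by (auto simp: lift_flat_def)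
  moreover have "modular_triple N (lift1 B H1) (lift1 B H2) (lift1 B H3)"
    if "modular_triple M1 H1 H2 H3" for H1 H2 H3
  proof -
    have "H1 \<in> hyperplanes M1" "H2 \<in> hyperplanes M1" "H3 \<in> hyperplanes M1"
      using that by (simp_all add: modular_triple_def)
    then show ?thesis using lift1_modular_triple[OF B] that by blast
  qed
  ultimately show ?thesis
    using lift1_hyperplane[OF B] y ground_Int by (auto simp: hyperplane_embedding_def ground_N)
qed

end

section \<open>Gluing representations of the summands\<close>

locale two_summands_pasture =
  two_summands M1 M2 p + pasture_struct P
  for M1 M2 :: "'e matroid" and p :: 'e and P :: "'u pasture" (structure)
begin

text \<open>The inclusion tests recover the kind of hyperplane, and the traces, completed by
  \<open>p\<close> where necessary, recover its parts. On \<open>A \<union> B\<close> the cross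
  factors are chosen so that both formulas would take the same value at \<open>p\<close>.\<close>

definition glue :: "('e set \<Rightarrow> 'e \<Rightarrow> 'u) \<Rightarrow> ('e set \<Rightarrow> 'e \<Rightarrow> 'u) \<Rightarrow> 'e set \<Rightarrow> 'e \<Rightarrow> 'u" where
  "glue f1 f2 H e =
     (if E2 - {p} \<subseteq> H then (if e \<in> E1 then f1 (insert p (H \<inter> E1)) e else zer P)
      else if E1 - {p} \<subseteq> H then (if e \<in> E1 then zer P else f2 (insert p (H \<inter> E2)) e)
      else if e \<in> E1 then f2 (H \<inter> E2) p \<otimes> f1 (H \<inter> E1) e
      else f1 (H \<inter> E1) p \<otimes> f2 (H \<inter> E2) e)"

lemma swap_pasture: "two_summands_pasture M2 M1 p P"
  using swap pasture_struct_axioms by (simp add: two_summands_pasture_def)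

lemma glue_left:
  assumes "K \<in> hyperplanes M1" "p \<in> K"
  shows "glue f1 f2 ((K \<union> E2) - {p}) e = (if e \<in> E1 then f1 K e else zer P)"
proof -
  have "insert p (((K \<union> E2) - {p}) \<inter> E1) = K"
    using assms M1.hyperplane_ground[OF assms(1)] ground_Int by blast
  moreover have "E2 - {p} \<subseteq> (K \<union> E2) - {p}" by blast
  ultimately show ?thesis by (simp add: glue_def)
qed

lemma glue_right:
  assumes "K \<in> hyperplanes M2" "p \<in> K"
  shows "glue f1 f2 ((E1 \<union> K) - {p}) e = (if e \<in> E1 then zer P else f2 K e)"
proof -
  have "insert p (((E1 \<union> K) - {p}) \<inter> E2) = K"
    using assms M2.hyperplane_ground[OF assms(1)] ground_Int by blast
  moreover have "E1 - {p} \<subseteq> (E1 \<union> K) - {p}" by blast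
  moreover have "\<not> E2 - {p} \<subseteq> (E1 \<union> K) - {p}"
    using hyperplane_not_all2[OF assms(1)] ground_Int by blast
  ultimately show ?thesis by (simp add: glue_def)
qed

lemma glue_both:
  assumes A: "A \<in> hyperplanes M1" "p \<notin> A" and B: "B \<in> hyperplanes M2" "p \<notin> B"
  shows "glue f1 f2 (A \<union> B) e = (if e \<in> E1 then f2 B p \<otimes> f1 A e else f1 A p \<otimes> f2 B e)"
proof -
  have g: "A \<subseteq> E1" "B \<subseteq> E2" using A B M1.hyperplane_ground M2.hyperplane_ground by auto
  have "A \<inter> E2 \<subseteq> {p}" "B \<inter> E1 \<subseteq> {p}" using g ground_Int by auto
  then have "A \<inter> E2 = {}" "B \<inter> E1 = {}" using A(2) B(2) by auto
  then have "(A \<union> B) \<inter> E1 = A" "(A \<union> B) \<inter> E2 = B" using g by blast+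
  moreover have "\<not> E1 - {p} \<subseteq> A \<union> B"
    using hyperplane_not_all1[OF A(1)] g ground_Int by blast
  moreover have "\<not> E2 - {p} \<subseteq> A \<union> B"
    using hyperplane_not_all2[OF B(1)] g ground_Int by blast
  ultimately show ?thesis by (simp add: glue_def)
qed

lemma ground_N_cases:
  assumes "e \<in> ground N"
  obtains "e \<in> E1" "e \<notin> E2" "e \<noteq> p" | "e \<notin> E1" "e \<in> E2" "e \<noteq> p"
  using assms ground_Int by (auto simp: ground_N)

lemma glue_swap:
  assumes H: "H \<in> hyperplanes N" and e: "e \<in> ground N"
  shows "two_summands_pasture.glue M2 M1 p P f2 f1 H e = glue f1 f2 H e"
proof -
  interpret swap: two_summands_pasture M2 M1 p P by (rule swap_pasture)
  from e have e12: "e \<in> E1 \<longleftrightarrow> e \<notin> E2" by (rule ground_N_cases) auto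
  show ?thesis
    using H
  proof (cases rule: hyperplane_N_cases)
    case (left K)
    show ?thesis
      using swap.glue_right[OF left(1,2), of f2 f1 e] glue_left[OF left(1,2), of f1 f2 e] e12
      by (simp add: left(3) Un_commute)
  next
    case (right K)
    show ?thesis
      using swap.glue_left[OF right(1,2), of f2 f1 e] glue_right[OF right(1,2), of f1 f2 e] e12
      by (simp add: right(3) Un_commute)
  next
    case (both A B)
    show ?thesis
      using swap.glue_both[OF both(2,4,1,3), of f2 f1 e] glue_both[OF both(1,3,2,4), of f1 f2 e] e12
      by (simp add: both(5) Un_commute)
  qed
qed

lemma glue_swap_restrict_family:
  "restrict_family (two_sum M2 M1 p) (two_summands_pasture.glue M2 M1 p P f2 f1) = restrict_family N (glue f1 f2)"
  using glue_swap two_sum_commute[of M1 M2 p] by (auto simp: restrict_family_def fun_eq_iff restrict_def)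

text \<open>One formula for both kinds of lifted hyperplane: when \<open>p \<in> K\<close>, the part
  on \<open>E2\<close> vanishes through the factor \<open>f1 K p\<close>, and the missing factor
  \<open>f2 B p\<close> on \<open>E1\<close> is supplied by scaling.\<close>

lemma glue_lift1:
  assumes f1: "f1 \<in> representations M1 P" and f2: "f2 \<in> representations M2 P"
    and B: "B \<in> hyperplanes M2" "p \<notin> B" and K: "K \<in> hyperplanes M1" and e: "e \<in> ground N"
  shows "(if p \<in> K then f2 B p else \<one>) \<otimes> glue f1 f2 (lift1 B K) e =
    (if e \<in> E1 then f2 B p \<otimes> f1 K e else f1 K p \<otimes> f2 B e)"
proof -
  note c = rep_closed[OF f1 K] rep_closed[OF f2 B(1)]
  have z: "f1 K p = zer P \<longleftrightarrow> p \<in> K" using rep_zer_iff[OF f1 K] p_ground by simp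
  show ?thesis
    using e c p_ground z
    by (cases rule: ground_N_cases)
      (auto simp: lift_flat_def glue_left[OF K] glue_both[OF K _ B])
qed

lemma glue_modular:
  assumes f1: "f1 \<in> representations M1 P" and f2: "f2 \<in> representations M2 P"
    and B: "B \<in> hyperplanes M2" "p \<notin> B" and m: "modular_triple M1 K1 K2 K3"
  shows "\<exists>c1\<in>Units P. \<exists>c2\<in>Units P. \<exists>c3\<in>Units P. \<forall>e\<in>ground N.
    {#c1 \<otimes> glue f1 f2 (lift1 B K1) e, c2 \<otimes> glue f1 f2 (lift1 B K2) e,
      c3 \<otimes> glue f1 f2 (lift1 B K3) e#} \<in> nullset P"
proof -
  obtain c1 c2 c3 where c: "c1 \<in> Units P" "c2 \<in> Units P" "c3 \<in> Units P"
    and nl: "\<And>e. e \<in> E1 \<Longrightarrow> {#c1 \<otimes> f1 K1 e, c2 \<otimes> f1 K2 e, c3 \<otimes> f1 K3 e#} \<in> nullset P"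
    using modular_triple_coefficients_Units[OF M1.ranked_axioms f1 m] by metis
  have K: "K1 \<in> hyperplanes M1" "K2 \<in> hyperplanes M1" "K3 \<in> hyperplanes M1"
    using m by (auto simp: modular_triple_def)
  \<comment> \<open>Scaling row \<open>K\<close> by \<open>v K\<close> turns the glued rows into multiples, by factors \<open>w e\<close> independent
    of \<open>K\<close>, of the entries of \<open>f1\<close> at \<open>q e\<close>.\<close>
  define v where "v K = (if p \<in> K then f2 B p else \<one>)" for K
  have u: "f2 B p \<in> Units P" using rep_Units[OF f2 B(1) p_ground(2) B(2)] .
  then have v: "v K \<in> Units P" for K by (simp add: v_def)
  have gc: "glue f1 f2 (lift1 B K) e \<in> carrier P" if "K \<in> hyperplanes M1" "e \<in> ground N" for K e
    using that(2) rep_closed[OF f1 that(1)] rep_closed[OF f2 B(1)] p_ground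
    by (cases rule: ground_N_cases)
      (auto simp: lift_flat_def glue_left[OF that(1)] glue_both[OF that(1) _ B])
  define w where "w e = (if e \<in> E1 then f2 B p else f2 B e)" for e
  define q where "q e = (if e \<in> E1 then e else p)" for e
  have w: "w e \<in> carrier P" "q e \<in> E1" if "e \<in> ground N" for e
    using that rep_closed[OF f2 B(1)] p_ground by (auto simp: w_def q_def ground_N)
  have eq: "(c \<otimes> v K) \<otimes> glue f1 f2 (lift1 B K) e = w e \<otimes> (c \<otimes> f1 K (q e))"
    if "K \<in> hyperplanes M1" "e \<in> ground N" "c \<in> Units P" for c K e
  proof -
    note [simp] = v gc[OF that(1,2)] w[OF that(2)] that(3) rep_closed[OF f1 that(1)]
      rep_closed[OF f2 B(1)]
    have "(c \<otimes> v K) \<otimes> glue f1 f2 (lift1 B K) e = c \<otimes> (v K \<otimes> glue f1 f2 (lift1 B K) e)"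
      by (simp add: m_assoc)
    also have "v K \<otimes> glue f1 f2 (lift1 B K) e = w e \<otimes> f1 K (q e)"
      using that(2) glue_lift1[OF f1 f2 B that(1,2)] p_ground
      by (cases rule: ground_N_cases) (auto simp: v_def w_def q_def m_comm)
    also have "c \<otimes> (w e \<otimes> f1 K (q e)) = w e \<otimes> (c \<otimes> f1 K (q e))" by (simp add: m_lcomm)
    finally show ?thesis .
  qed
  have "{#(c1 \<otimes> v K1) \<otimes> glue f1 f2 (lift1 B K1) e, (c2 \<otimes> v K2) \<otimes> glue f1 f2 (lift1 B K2) e,
      (c3 \<otimes> v K3) \<otimes> glue f1 f2 (lift1 B K3) e#} \<in> nullset P" if e: "e \<in> ground N" for e
    unfolding eq[OF K(1) e c(1)] eq[OF K(2) e c(2)] eq[OF K(3) e c(3)]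
    using w[OF e] nl by (intro null_sum_scale) auto
  then show ?thesis
    using c v by (intro bexI[of _ "c1 \<otimes> v K1"] bexI[of _ "c2 \<otimes> v K2"] bexI[of _ "c3 \<otimes> v K3"]) auto
qed

lemma glue_representation:
  assumes f1: "f1 \<in> representations M1 P" and f2: "f2 \<in> representations M2 P"
  shows "restrict_family N (glue f1 f2) \<in> representations N P"
proof (rule representationI)
  interpret swap: two_summands_pasture M2 M1 p P by (rule swap_pasture)
  have both: "glue f1 f2 H e \<in> carrier P \<and> (glue f1 f2 H e = zer P \<longleftrightarrow> e \<in> H)"
    if H: "H \<in> hyperplanes N" and e: "e \<in> ground N" for H e
    using H
  proof (cases rule: hyperplane_N_cases)
    case (left K)
    show ?thesis using e left rep_closed[OF f1 left(1)] rep_zer_iff[OF f1 left(1)]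
      by (cases rule: ground_N_cases) (auto simp: glue_left)
  next
    case (right K)
    show ?thesis using e right rep_closed[OF f2 right(1)] rep_zer_iff[OF f2 right(1)]
      by (cases rule: ground_N_cases) (auto simp: glue_right)
  next
    case (both A B)
    have "A \<subseteq> E1" "B \<subseteq> E2" using both M1.hyperplane_ground M2.hyperplane_ground by auto
    show ?thesis
      using e both \<open>A \<subseteq> E1\<close> \<open>B \<subseteq> E2\<close> rep_closed[OF f1 both(1)] rep_closed[OF f2 both(2)] p_ground
        rep_zer_iff[OF f1 both(1)] rep_zer_iff[OF f2 both(2)]
      by (cases rule: ground_N_cases) (auto simp: glue_both)
  qed
  then show "glue f1 f2 H e \<in> carrier P" "glue f1 f2 H e = zer P \<longleftrightarrow> e \<in> H"
    if "H \<in> hyperplanes N" "e \<in> ground N" for H e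
    using that by auto
  fix H1 H2 H3 assume m: "modular_triple N H1 H2 H3"
  have H: "H1 \<in> hyperplanes N" "H2 \<in> hyperplanes N" "H3 \<in> hyperplanes N"
    using m by (auto simp: modular_triple_def)
  show "\<exists>c1\<in>Units P. \<exists>c2\<in>Units P. \<exists>c3\<in>Units P. \<forall>e\<in>ground N.
      {#c1 \<otimes> glue f1 f2 H1 e, c2 \<otimes> glue f1 f2 H2 e, c3 \<otimes> glue f1 f2 H3 e#} \<in> nullset P"
    using m
  proof (cases rule: modular_triple_N_cases)
    case (left B K1 K2 K3)
    then show ?thesis using glue_modular[OF f1 f2 left(1-3)] by simp
  next
    case (right B K1 K2 K3)
    have "\<exists>c1\<in>Units P. \<exists>c2\<in>Units P. \<exists>c3\<in>Units P. \<forall>e\<in>ground N.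
      {#c1 \<otimes> swap.glue f2 f1 H1 e, c2 \<otimes> swap.glue f2 f1 H2 e, c3 \<otimes> swap.glue f2 f1 H3 e#} \<in> nullset P"
      using swap.glue_modular[OF f2 f1 right(1-3)] right two_sum_commute[of M1 M2 p] by simp
    then show ?thesis by (simp add: glue_swap[OF H(1)] glue_swap[OF H(2)] glue_swap[OF H(3)])
  qed
qed

lemma glue_rescaling:
  assumes r1: "(f1, g1) \<in> rescaling_rel M1 P" and r2: "(f2, g2) \<in> rescaling_rel M2 P"
  shows "(restrict_family N (glue f1 f2), restrict_family N (glue g1 g2)) \<in> rescaling_rel N P"
proof -
  obtain c d where f1: "f1 \<in> representations M1 P" and g1: "g1 \<in> representations M1 P"
    and cd: "\<forall>H\<in>hyperplanes M1. c H \<in> Units P" "\<forall>e\<in>E1. d e \<in> Units P"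
      "\<forall>H\<in>hyperplanes M1. \<forall>e\<in>E1. g1 H e = c H \<otimes> d e \<otimes> f1 H e"
    using r1 by (rule rescalingE)
  obtain c' d' where f2: "f2 \<in> representations M2 P" and g2: "g2 \<in> representations M2 P"
    and cd': "\<forall>H\<in>hyperplanes M2. c' H \<in> Units P" "\<forall>e\<in>E2. d' e \<in> Units P"
      "\<forall>H\<in>hyperplanes M2. \<forall>e\<in>E2. g2 H e = c' H \<otimes> d' e \<otimes> f2 H e"
    using r2 by (rule rescalingE)
  note [simp] = cd(1,2)[rule_format] cd'(1,2)[rule_format] cd(3)[rule_format] cd'(3)[rule_format]
    p_ground rep_closed[OF f1] rep_closed[OF f2]
  \<comment> \<open>On \<open>A \<union> B\<close> the cross factors contribute \<open>d' p\<close>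
    to entries on \<open>E1\<close> and \<open>d p\<close> to those on \<open>E2\<close>; the column
    scaling absorbs them, leaving the row factor \<open>c A \<otimes> c' B\<close>. Rows of
    one-sided hyperplanes have no cross factor, so there it is divided out again.\<close>
  define D where "D e = (if e \<in> E1 then d' p \<otimes> d e else d p \<otimes> d' e)" for e
  have cancel: "a \<otimes> inv u \<otimes> (u \<otimes> b) \<otimes> x = a \<otimes> b \<otimes> x"
    if "u \<in> Units P" "a \<in> carrier P" "b \<in> carrier P" "x \<in> carrier P" for a u b x
    using that Units_cancel_inv[of u a b] by simp
  show ?thesis
  proof (rule rescalingI[where d=D, OF glue_representation[OF f1 f2] glue_representation[OF g1 g2]])
    show "D e \<in> Units P" if "e \<in> ground N" for e
      using that by (auto simp: D_def ground_N)
    fix H assume H: "H \<in> hyperplanes N"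
    have "\<exists>k\<in>Units P. \<forall>e\<in>ground N. glue g1 g2 H e = k \<otimes> D e \<otimes> glue f1 f2 H e"
      using H
    proof (cases rule: hyperplane_N_cases)
      case (left K)
      note [simp] = left(1)
      have "glue g1 g2 H e = (c K \<otimes> inv (d' p)) \<otimes> D e \<otimes> glue f1 f2 H e" if "e \<in> ground N" for e
        using that by (cases rule: ground_N_cases)
          (auto simp: left(3) glue_left[OF left(1,2)] D_def cancel)
      then show ?thesis by (intro bexI[of _ "c K \<otimes> inv (d' p)"]) auto
    next
      case (right K)
      note [simp] = right(1)
      have "glue g1 g2 H e = (c' K \<otimes> inv (d p)) \<otimes> D e \<otimes> glue f1 f2 H e" if "e \<in> ground N" for e
        using that by (cases rule: ground_N_cases)
          (auto simp: right(3) glue_right[OF right(1,2)] D_def cancel)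
      then show ?thesis by (intro bexI[of _ "c' K \<otimes> inv (d p)"]) auto
    next
      case (both A B)
      note [simp] = both(1,2)
      have "glue g1 g2 H e = (c A \<otimes> c' B) \<otimes> D e \<otimes> glue f1 f2 H e" if "e \<in> ground N" for e
        using that by (cases rule: ground_N_cases)
          (simp_all add: both(5) glue_both[OF both(1,3,2,4)] D_def m_ac)
      then show ?thesis by (intro bexI[of _ "c A \<otimes> c' B"]) auto
    qed
    then show "\<exists>k\<in>Units P. \<forall>e\<in>ground N.
        restrict_family N (glue g1 g2) H e = k \<otimes> D e \<otimes> restrict_family N (glue f1 f2) H e"
      using H by (simp add: restrict_family_def)
  qed
qed

section \<open>Comparing rows of a representation of the 2-sum\<close>

text \<open>A modular triple of \<open>M2\<close> with a member \<open>H\<close> through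
  \<open>p\<close> lifts along \<open>A\<close>. The lift of \<open>H\<close> contains
  \<open>E1 - {p}\<close>, so its row vanishes there and the three-term relation becomes
  proportionality of the other two rows. Connectivity extends this to all \<open>B'\<close>.\<close>

lemma rows_proportional:
  assumes f: "f \<in> representations N P" and A: "A \<in> hyperplanes M1" "p \<notin> A"
    and B: "B \<in> hyperplanes M2" "p \<notin> B" and B': "B' \<in> hyperplanes M2" "p \<notin> B'"
  shows "\<exists>s\<in>Units P. \<forall>e\<in>E1 - {p}. f (A \<union> B') e = s \<otimes> f (A \<union> B) e"
proof -
  interpret swap: two_summands_pasture M2 M1 p P by (rule swap_pasture)
  have hyp: "A \<union> K \<in> hyperplanes N" if "K \<in> hyperplanes M2" "p \<notin> K" for K
    using lift1_hyperplane[OF that A(1)] A by (simp add: lift_flat_def)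
  have "(B, B') \<in> {(K, K'). p \<notin> K \<and> p \<notin> K' \<and> (\<exists>H. p \<in> H \<and> modular_triple M2 H K K')}\<^sup>*"
    by (rule M2.hyperplanes_avoiding_connected[OF B B' p_ground(2)])
  then show ?thesis
  proof (induction rule: rtrancl_induct)
    case base
    have "f (A \<union> B) e \<in> carrier P" if "e \<in> E1 - {p}" for e
      using rep_closed[OF f hyp[OF B]] that by (simp add: ground_N)
    then show ?case by (intro bexI[of _ \<one>]) auto
  next
    case (step K K')
    then obtain H s where m: "modular_triple M2 H K K'" and pH: "p \<in> H" "p \<notin> K" "p \<notin> K'"
      and s: "s \<in> Units P" "\<forall>e\<in>E1 - {p}. f (A \<union> K) e = s \<otimes> f (A \<union> B) e" by blast
    have K: "H \<in> hyperplanes M2" "K \<in> hyperplanes M2" "K' \<in> hyperplanes M2"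
      using m by (auto simp: modular_triple_def)
    have mN: "modular_triple N ((H \<union> E1) - {p}) (A \<union> K) (A \<union> K')"
      using swap.lift1_modular_triple[OF A K] m pH two_sum_commute[of M1 M2 p]
      by (simp add: lift_flat_def Un_commute)
    then have HN: "(H \<union> E1) - {p} \<in> hyperplanes N" by (simp add: modular_triple_def)
    obtain c1 c2 c3 where c: "c1 \<in> Units P" "c2 \<in> Units P" "c3 \<in> Units P"
      and nl: "\<And>e. e \<in> ground N \<Longrightarrow>
        {#c1 \<otimes> f ((H \<union> E1) - {p}) e, c2 \<otimes> f (A \<union> K) e, c3 \<otimes> f (A \<union> K') e#} \<in> nullset P"
      using modular_triple_coefficients_Units[OF ranked_two_sum f mN] by metis
    have "f (A \<union> K') e = (inv c3 \<otimes> minus_one \<otimes> c2 \<otimes> s) \<otimes> f (A \<union> B) e" if e: "e \<in> E1 - {p}" for e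
    proof -
      have eN: "e \<in> ground N" using e by (simp add: ground_N)
      note [simp] = c s(1) rep_closed[OF f hyp[OF K(2) pH(2)] eN] rep_closed[OF f hyp[OF K(3) pH(3)] eN]
        rep_closed[OF f hyp[OF B] eN]
      have "f ((H \<union> E1) - {p}) e = zer P" using rep_zer_iff[OF f HN eN] e by simp
      then have "c3 \<otimes> f (A \<union> K') e = minus_one \<otimes> (c2 \<otimes> f (A \<union> K) e)"
        using nl[OF eN] by (intro null_pair) (auto simp: add_mset_commute)
      also have "f (A \<union> K) e = s \<otimes> f (A \<union> B) e" using s e by simp
      finally have *: "c3 \<otimes> f (A \<union> K') e = minus_one \<otimes> (c2 \<otimes> (s \<otimes> f (A \<union> B) e))" .
      have "f (A \<union> K') e = (\<one> \<otimes> inv c3) \<otimes> (c3 \<otimes> f (A \<union> K') e)"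
        by (subst Units_cancel_inv) auto
      then show ?thesis unfolding * by (simp add: m_assoc)
    qed
    moreover have "inv c3 \<otimes> minus_one \<otimes> c2 \<otimes> s \<in> Units P" using c s by simp
    ultimately show ?case by blast
  qed
qed

text \<open>Restricting \<open>f\<close> to \<open>M1\<close> along \<open>B\<close> and along
  \<open>B'\<close> gives two representations whose rows agree off \<open>p\<close> up to the
  factors \<open>s\<close>. \<open>rep_determined_off_element\<close> then compares their columns at
  \<open>p\<close>, which are the columns of \<open>f\<close> at \<open>y\<close> and
  \<open>y'\<close>.\<close>

lemma rows_ratio:
  assumes f: "f \<in> representations N P"
    and B: "B \<in> hyperplanes M2" "p \<notin> B" and B': "B' \<in> hyperplanes M2" "p \<notin> B'"
  obtains s where "\<And>A. s A \<in> Units P"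
    "\<And>A e. A \<in> hyperplanes M1 \<Longrightarrow> p \<notin> A \<Longrightarrow> e \<in> E1 \<Longrightarrow> e \<noteq> p \<Longrightarrow> f (A \<union> B') e = s A \<otimes> f (A \<union> B) e"
    "\<And>A A' y y'. A \<in> hyperplanes M1 \<Longrightarrow> p \<notin> A \<Longrightarrow> A' \<in> hyperplanes M1 \<Longrightarrow> p \<notin> A' \<Longrightarrow>
      y \<in> E2 - B \<Longrightarrow> y \<noteq> p \<Longrightarrow> y' \<in> E2 - B' \<Longrightarrow> y' \<noteq> p \<Longrightarrow>
      f (A \<union> B') y' \<otimes> s A' \<otimes> f (A' \<union> B) y = f (A' \<union> B') y' \<otimes> s A \<otimes> f (A \<union> B) y"
proof -
  \<comment> \<open>The value \<open>\<one>\<close> for \<open>p \<in> A\<close> fits because the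
    lifts of \<open>A\<close> along \<open>B\<close> and \<open>B'\<close> then coincide.\<close>
  have "\<forall>A. \<exists>s. s \<in> Units P \<and> (A \<in> hyperplanes M1 \<and> p \<notin> A \<longrightarrow>
      (\<forall>e\<in>E1 - {p}. f (A \<union> B') e = s \<otimes> f (A \<union> B) e)) \<and> (p \<in> A \<longrightarrow> s = \<one>)"
    using rows_proportional[OF f _ _ B B'] Units_one_closed by metis
  then obtain s where s: "\<And>A. s A \<in> Units P" "\<And>A. p \<in> A \<Longrightarrow> s A = \<one>"
    and eq: "\<And>A e. A \<in> hyperplanes M1 \<Longrightarrow> p \<notin> A \<Longrightarrow> e \<in> E1 - {p} \<Longrightarrow> f (A \<union> B') e = s A \<otimes> f (A \<union> B) e"
    by metis
  show thesis
  proof (rule that[of s])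
    fix A A' y y'
    assume A: "A \<in> hyperplanes M1" "p \<notin> A" and A': "A' \<in> hyperplanes M1" "p \<notin> A'"
      and y: "y \<in> E2 - B" "y \<noteq> p" and y': "y' \<in> E2 - B'" "y' \<noteq> p"
    let ?f = "pull_rep M1 (lift1 B) (\<lambda>e. if e = p then y else e) f"
    let ?g = "pull_rep M1 (lift1 B') (\<lambda>e. if e = p then y' else e) f"
    have rf: "?f \<in> representations M1 P"
      by (rule pull_representation[OF ranked_two_sum embedding1[OF B y] f])
    have rg: "?g \<in> representations M1 P"
      by (rule pull_representation[OF ranked_two_sum embedding1[OF B' y'] f])
    have row: "?g H e = s H \<otimes> ?f H e" if H: "H \<in> hyperplanes M1" "e \<in> E1" "e \<noteq> p" for H e
    proof (cases "p \<in> H")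
      case True
      have "f (lift1 B H) e \<in> carrier P"
        using rep_closed[OF f lift1_hyperplane[OF B H(1)]] H by (simp add: ground_N)
      then show ?thesis using True H s(2)[OF True] by (simp add: pull_rep_apply lift_flat_def)
    next
      case False
      then show ?thesis using eq[OF H(1) False] H by (simp add: pull_rep_apply lift_flat_def)
    qed
    have "?g A p \<otimes> s A' \<otimes> ?f A' p = ?g A' p \<otimes> s A \<otimes> ?f A p"
      by (rule rep_determined_off_element[OF M1.circuit_matroid_axioms rf rg s(1) row p_ground(1) A A'])
    then show "f (A \<union> B') y' \<otimes> s A' \<otimes> f (A' \<union> B) y = f (A' \<union> B') y' \<otimes> s A \<otimes> f (A \<union> B) y"
      using A A' p_ground by (simp add: pull_rep_apply lift_flat_def)
  qed (use s eq in auto)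
qed

end

section \<open>Restriction to the summands, inverse to gluing\<close>

locale based_two_summands = two_summands M1 M2 p
  for M1 M2 :: "'e matroid" and p :: 'e +
  fixes A0 B0 :: "'e set" and x0 y0 :: 'e
  assumes A0: "A0 \<in> hyperplanes M1" "p \<notin> A0" and B0: "B0 \<in> hyperplanes M2" "p \<notin> B0"
    and x0: "x0 \<in> ground M1 - A0" "x0 \<noteq> p" and y0: "y0 \<in> ground M2 - B0" "y0 \<noteq> p"
begin

lemma swap_based: "based_two_summands M2 M1 p B0 A0 y0 x0"
  using swap A0 B0 x0 y0
  by (simp add: based_two_summands_def based_two_summands_axioms_def)

definition res1 :: "('e set \<Rightarrow> 'e \<Rightarrow> 'u) \<Rightarrow> 'e set \<Rightarrow> 'e \<Rightarrow> 'u" where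
  "res1 = pull_rep M1 (lift1 B0) (\<lambda>e. if e = p then y0 else e)"

definition res2 :: "('e set \<Rightarrow> 'e \<Rightarrow> 'u) \<Rightarrow> 'e set \<Rightarrow> 'e \<Rightarrow> 'u" where
  "res2 = pull_rep M2 (lift2 A0) (\<lambda>e. if e = p then x0 else e)"

lemma embedding_B0: "hyperplane_embedding M1 N (lift1 B0) (\<lambda>e. if e = p then y0 else e)"
  by (rule embedding1[OF B0 y0])

lemma embedding_A0: "hyperplane_embedding M2 N (lift2 A0) (\<lambda>e. if e = p then x0 else e)"
proof -
  interpret swap: based_two_summands M2 M1 p B0 A0 y0 x0 by (rule swap_based)
  show ?thesis using swap.embedding_B0 two_sum_commute[of M1 M2 p] by simp
qed

end

locale based_two_summands_pasture =
  based_two_summands M1 M2 p A0 B0 x0 y0 + two_summands_pasture M1 M2 p P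
  for M1 M2 :: "'e matroid" and p :: 'e and A0 B0 :: "'e set" and x0 y0 :: 'e
    and P :: "'u pasture" (structure)
begin

lemma swap_based_pasture: "based_two_summands_pasture M2 M1 p B0 A0 y0 x0 P"
  using swap_based swap_pasture by (simp add: based_two_summands_pasture_def)

lemma res_representation:
  assumes "f \<in> representations N P"
  shows "res1 f \<in> representations M1 P" "res2 f \<in> representations M2 P"
  using assms pull_representation[OF ranked_two_sum] embedding_A0 embedding_B0
  by (simp_all add: res1_def res2_def)

lemma res_rescaling:
  assumes "(f, g) \<in> rescaling_rel N P"
  shows "(res1 f, res1 g) \<in> rescaling_rel M1 P" "(res2 f, res2 g) \<in> rescaling_rel M2 P"
  using assms pull_rescaling[OF ranked_two_sum] embedding_A0 embedding_B0
  by (simp_all add: res1_def res2_def)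

lemma res1_glue:
  assumes f1: "f1 \<in> representations M1 P" and f2: "f2 \<in> representations M2 P"
  shows "(res1 (restrict_family N (glue f1 f2)), f1) \<in> rescaling_rel M1 P"
proof -
  have u: "f2 B0 p \<in> Units P" "f2 B0 y0 \<in> Units P"
    using rep_Units[OF f2 B0(1)] p_ground B0 y0 by blast+
  note [simp] = u
  \<comment> \<open>The column of \<open>p\<close> is read off at \<open>y0\<close>, where the glued
    row carries \<open>f2 B0 y0\<close> in place of the factor \<open>f2 B0 p\<close> common to the
    other columns.\<close>
  define d where "d e = (if e = p then f2 B0 y0 \<otimes> inv (f2 B0 p) else \<one>)" for e
  have y0E: "y0 \<notin> E1" using y0 ground_Int by blast
  have "(f1, res1 (restrict_family N (glue f1 f2))) \<in> rescaling_rel M1 P"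
  proof (rule rescalingI[where d=d, OF f1 res_representation(1)[OF glue_representation[OF f1 f2]]])
    show "d e \<in> Units P" for e by (simp add: d_def)
    fix K assume K: "K \<in> hyperplanes M1"
    have hyp: "lift1 B0 K \<in> hyperplanes N" by (rule lift1_hyperplane[OF B0 K])
    have res: "res1 (restrict_family N (glue f1 f2)) K e = glue f1 f2 (lift1 B0 K) (if e = p then y0 else e)"
      if e: "e \<in> E1" for e
      using e hyp K y0 by (simp add: res1_def pull_rep_apply restrict_family_def ground_N)
    have z: "f1 K p = zer P \<longleftrightarrow> p \<in> K" using rep_zer_iff[OF f1 K] p_ground by simp
    have "res1 (restrict_family N (glue f1 f2)) K e = (if p \<in> K then \<one> else f2 B0 p) \<otimes> d e \<otimes> f1 K e"
      if e: "e \<in> E1" for e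
    proof (cases "p \<in> K")
      case True
      then show ?thesis
        using e z rep_closed[OF f1 K] y0E
        by (auto simp: res lift_flat_def glue_left[OF K True] d_def)
    next
      case False
      have "f2 B0 p \<otimes> (f2 B0 y0 \<otimes> inv (f2 B0 p)) \<otimes> f1 K p = f1 K p \<otimes> f2 B0 y0"
      proof -
        have [simp]: "f1 K p \<in> carrier P" using rep_closed[OF f1 K] p_ground by simp
        have "f2 B0 p \<otimes> (f2 B0 y0 \<otimes> inv (f2 B0 p)) \<otimes> f1 K p =
            (f2 B0 y0 \<otimes> inv (f2 B0 p)) \<otimes> (f2 B0 p \<otimes> f1 K p)"
          by (simp add: m_ac del: Units_l_inv Units_r_inv)
        also have "\<dots> = f2 B0 y0 \<otimes> f1 K p" by (rule Units_cancel_inv) auto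
        finally show ?thesis by (simp add: m_comm)
      qed
      then show ?thesis
        using e False rep_closed[OF f1 K] y0E
        by (auto simp: res lift_flat_def glue_both[OF K False B0] d_def)
    qed
    then show "\<exists>c\<in>Units P. \<forall>e\<in>E1. res1 (restrict_family N (glue f1 f2)) K e = c \<otimes> d e \<otimes> f1 K e"
      by (intro bexI[of _ "if p \<in> K then \<one> else f2 B0 p"]) auto
  qed
  then show ?thesis using equiv_rescaling by (meson equivE symD)
qed

lemma res2_glue:
  assumes f1: "f1 \<in> representations M1 P" and f2: "f2 \<in> representations M2 P"
  shows "(res2 (restrict_family N (glue f1 f2)), f2) \<in> rescaling_rel M2 P"
proof -
  interpret swap: based_two_summands_pasture M2 M1 p B0 A0 y0 x0 P by (rule swap_based_pasture)
  show ?thesis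
    using swap.res1_glue[OF f2 f1] by (simp add: glue_swap_restrict_family swap.res1_def res2_def)
qed

text \<open>The delicate rows are those at \<open>A \<union> B\<close>: gluing knows
  \<open>f\<close> only at \<open>A \<union> B0\<close> and \<open>A0 \<union> B\<close>, and
  \<open>rows_ratio\<close> recovers the row at \<open>A \<union> B\<close> from these.\<close>

lemma glue_res:
  assumes f: "f \<in> representations N P"
  shows "(restrict_family N (glue (res1 f) (res2 f)), f) \<in> rescaling_rel N P"
proof -
  note r = res_representation[OF f]
  have hypN: "A \<union> B \<in> hyperplanes N"
    if "A \<in> hyperplanes M1" "p \<notin> A" "B \<in> hyperplanes M2" "p \<notin> B" for A B
    using lift1_hyperplane[OF that(3,4,1)] that by (simp add: lift_flat_def)
  define a b where "a = f (A0 \<union> B0) x0" and "b = f (A0 \<union> B0) y0"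
  have g0: "A0 \<subseteq> E1" "B0 \<subseteq> E2" using A0 B0 M1.hyperplane_ground M2.hyperplane_ground by auto
  have xy: "x0 \<in> ground N" "y0 \<in> ground N" "x0 \<notin> A0 \<union> B0" "y0 \<notin> A0 \<union> B0"
    using x0 y0 g0 ground_Int by (auto simp: ground_N)
  have ab: "a \<in> Units P" "b \<in> Units P"
    using rep_Units[OF f hypN[OF A0 B0]] xy by (auto simp: a_def b_def)
  \<comment> \<open>The restrictions read the role of \<open>p\<close> at different elements
    \<open>y0\<close> and \<open>x0\<close>; the factor on \<open>E2\<close> corrects for the two
    values of the base row there.\<close>
  define d where "d e = (if e \<in> E1 then \<one> else a \<otimes> inv b)" for e
  show ?thesis
  proof (rule rescalingI[where d=d, OF glue_representation[OF r] f])
    show "d e \<in> Units P" for e using ab by (simp add: d_def)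
    fix H assume H: "H \<in> hyperplanes N"
    have "\<exists>c\<in>Units P. \<forall>e\<in>ground N. f H e = c \<otimes> d e \<otimes> glue (res1 f) (res2 f) H e"
      using H
    proof (cases rule: hyperplane_N_cases)
      case (left K)
      have "f H e = \<one> \<otimes> d e \<otimes> glue (res1 f) (res2 f) H e" if e: "e \<in> ground N" for e
        using e rep_closed[OF f H e] rep_zer_iff[OF f H e] ab left
        by (cases rule: ground_N_cases)
          (simp_all add: glue_left d_def res1_def pull_rep_apply lift_flat_def)
      then show ?thesis by blast
    next
      case (right K)
      have "f H e = (b \<otimes> inv a) \<otimes> d e \<otimes> glue (res1 f) (res2 f) H e" if e: "e \<in> ground N" for e
        using e
      proof (cases rule: ground_N_cases)
        case 1
        then show ?thesis
          using rep_zer_iff[OF f H e] ab right by (simp add: glue_right d_def)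
      next
        case 2
        have "(b \<otimes> inv a) \<otimes> (a \<otimes> inv b) = \<one>" using ab by (subst Units_cancel_inv) auto
        moreover have "glue (res1 f) (res2 f) H e = res2 f K e"
          using 2 by (simp add: right(3) glue_right[OF right(1,2)])
        moreover have "res2 f K e = f H e"
          using 2 right by (simp add: res2_def pull_rep_apply lift_flat_def Un_commute)
        ultimately show ?thesis using 2 rep_closed[OF f H e] by (simp add: d_def)
      qed
      then show ?thesis using ab by (intro bexI[of _ "b \<otimes> inv a"]) auto
    next
      case (both A B)
      note A = both(1,3) and B = both(2,4)
      have g: "A \<subseteq> E1" "B \<subseteq> E2" using A B M1.hyperplane_ground M2.hyperplane_ground by auto
      obtain s where s: "\<And>A. s A \<in> Units P"
        and row: "\<And>A e. A \<in> hyperplanes M1 \<Longrightarrow> p \<notin> A \<Longrightarrow> e \<in> E1 \<Longrightarrow> e \<noteq> p \<Longrightarrow>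
          f (A \<union> B) e = s A \<otimes> f (A \<union> B0) e"
        and ratio: "\<And>A A' y y'. A \<in> hyperplanes M1 \<Longrightarrow> p \<notin> A \<Longrightarrow> A' \<in> hyperplanes M1 \<Longrightarrow> p \<notin> A' \<Longrightarrow>
          y \<in> E2 - B0 \<Longrightarrow> y \<noteq> p \<Longrightarrow> y' \<in> E2 - B \<Longrightarrow> y' \<noteq> p \<Longrightarrow>
          f (A \<union> B) y' \<otimes> s A' \<otimes> f (A' \<union> B0) y = f (A' \<union> B) y' \<otimes> s A \<otimes> f (A \<union> B0) y"
        using rows_ratio[OF f B0 B] by metis
      define X where "X = f (A0 \<union> B) x0"
      have "x0 \<notin> A0 \<union> B" using x0 g ground_Int by auto
      then have X: "X \<in> Units P" using rep_Units[OF f hypN[OF A0 B] xy(1)] by (simp add: X_def)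
      have X_eq: "X = s A0 \<otimes> a" using row[OF A0] x0 by (simp add: X_def a_def)
      have gl: "glue (res1 f) (res2 f) H e =
          (if e \<in> E1 then X \<otimes> f (A \<union> B0) e else f (A \<union> B0) y0 \<otimes> f (A0 \<union> B) e)"
        if e: "e \<in> ground N" for e
        using e A B A0 B0 p_ground
        by (cases rule: ground_N_cases)
          (simp_all add: both(5) glue_both res1_def res2_def pull_rep_apply lift_flat_def X_def Un_commute)
      \<comment> \<open>On \<open>E1\<close> the glued row is \<open>X\<close> times the row at
        \<open>A \<union> B0\<close>, which forces this row factor. What remains is to see that the
        same factor works on \<open>E2\<close>.\<close>
      have "f H e = (s A \<otimes> inv X) \<otimes> d e \<otimes> glue (res1 f) (res2 f) H e" if e: "e \<in> ground N" for e
        using e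
      proof (cases rule: ground_N_cases)
        case 1
        have c: "f (A \<union> B0) e \<in> carrier P" using rep_closed[OF f hypN[OF A B0] e] .
        have "(s A \<otimes> inv X) \<otimes> (X \<otimes> f (A \<union> B0) e) = s A \<otimes> f (A \<union> B0) e"
          using s X c by (intro Units_cancel_inv) auto
        then show ?thesis using row[OF A 1(1,3)] 1 s X by (simp add: gl[OF e, unfolded both(5)] d_def both(5))
      next
        case 2
        define Y Z W where "Y = f (A \<union> B0) y0" and "Z = f (A0 \<union> B) e" and "W = f (A \<union> B) e"
        have c: "Y \<in> carrier P" "Z \<in> carrier P" "W \<in> carrier P"
          using rep_closed[OF f hypN[OF A B0] xy(2)] rep_closed[OF f hypN[OF A0 B] e]
            rep_closed[OF f hypN[OF A B] e] by (simp_all add: Y_def Z_def W_def)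
        note [simp] = s X ab c
        have "W = (s A \<otimes> inv X) \<otimes> (a \<otimes> inv b) \<otimes> (Y \<otimes> Z)"
        proof (cases "e \<in> B")
          case True
          then have "W = zer P" "Z = zer P"
            using rep_zer_iff[OF f hypN[OF A B] e] rep_zer_iff[OF f hypN[OF A0 B] e]
            by (simp_all add: W_def Z_def)
          then show ?thesis by simp
        next
          case False
          \<comment> \<open>The ratio identity with \<open>A0\<close> as second hyperplane and
            \<open>e\<close> in the role of \<open>y'\<close>. As \<open>X\<close> is
            \<open>s A0 \<otimes> a\<close>, this is the claim after clearing denominators.\<close>
          have rt: "W \<otimes> s A0 \<otimes> b = Z \<otimes> s A \<otimes> Y"
            using ratio[OF A A0 y0, of e] 2 False by (simp add: W_def Z_def Y_def b_def)
          have c1: "(a \<otimes> inv b) \<otimes> (b \<otimes> (Y \<otimes> Z)) = a \<otimes> (Y \<otimes> Z)"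
            by (rule Units_cancel_inv) auto
          have c2: "(s A \<otimes> inv X) \<otimes> (X \<otimes> (a \<otimes> (Y \<otimes> Z))) = s A \<otimes> (a \<otimes> (Y \<otimes> Z))"
            by (rule Units_cancel_inv) auto
          show ?thesis
          proof (rule mult_cancel[of "X \<otimes> b"])
            have "(X \<otimes> b) \<otimes> W = a \<otimes> (W \<otimes> s A0 \<otimes> b)" unfolding X_eq by (simp add: m_ac)
            also have "\<dots> = (s A \<otimes> a) \<otimes> (Y \<otimes> Z)" unfolding rt by (simp add: m_ac)
            also have "\<dots> = (s A \<otimes> inv X) \<otimes> (X \<otimes> ((a \<otimes> inv b) \<otimes> (b \<otimes> (Y \<otimes> Z))))"
              unfolding c1 c2 by (simp add: m_assoc)
            also have "\<dots> = (X \<otimes> b) \<otimes> ((s A \<otimes> inv X) \<otimes> (a \<otimes> inv b) \<otimes> (Y \<otimes> Z))"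
              by (simp add: m_ac del: Units_l_inv Units_r_inv)
            finally show "(X \<otimes> b) \<otimes> W = (X \<otimes> b) \<otimes> ((s A \<otimes> inv X) \<otimes> (a \<otimes> inv b) \<otimes> (Y \<otimes> Z))" .
          qed simp_all
        qed
        then show ?thesis using 2 by (simp add: gl[OF e, unfolded both(5)] d_def both(5) W_def Y_def Z_def)
      qed
      then show ?thesis using s X by (intro bexI[of _ "s A \<otimes> inv X"]) auto
    qed
    then show "\<exists>c\<in>Units P. \<forall>e\<in>ground N. f H e = c \<otimes> d e \<otimes> restrict_family N (glue (res1 f) (res2 f)) H e"
      using H by (simp add: restrict_family_def)
  qed
qed

text \<open>Both families are equivalent to the gluing of their restrictions, and gluing respects
  rescaling.\<close>

lemma res_injective:
  assumes f: "f \<in> representations N P" and g: "g \<in> representations N P"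
    and "(res1 f, res1 g) \<in> rescaling_rel M1 P" "(res2 f, res2 g) \<in> rescaling_rel M2 P"
  shows "(f, g) \<in> rescaling_rel N P"
  using glue_res[OF f] glue_res[OF g] glue_rescaling[OF assms(3,4)] equiv_rescaling
  by (meson equivE symD transD)

end

section \<open>The foundation of the 2-sum as a coproduct\<close>

context two_summands
begin

text \<open>The coprojections \<open>i\<close> and \<open>j\<close> classify the two restrictions of
  the universal representation \<open>u\<close> of the 2-sum. A pair of morphisms to
  \<open>R\<close> is a pair of classes over \<open>R\<close>, which glue to one class on the 2-sum
  and thus to one morphism from \<open>F\<close>.\<close>

lemma foundation_is_tensor_product:
  fixes F1 F2 F :: "'u pasture"
  assumes F1: "is_foundation M1 F1" and F2: "is_foundation M2 F2" and F: "is_foundation N F"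
  shows "is_tensor_product F1 F2 F"
proof -
  obtain A0 where A0: "A0 \<in> hyperplanes M1" "p \<notin> A0"
    using M1.hyperplane_avoiding_nonloop[OF p_ground(1) not_loop1] by blast
  obtain B0 where B0: "B0 \<in> hyperplanes M2" "p \<notin> B0"
    using M2.hyperplane_avoiding_nonloop[OF p_ground(2) not_loop2] by blast
  obtain x0 y0 where x0: "x0 \<in> E1 - A0" "x0 \<noteq> p" and y0: "y0 \<in> E2 - B0" "y0 \<noteq> p"
    using hyperplane_not_all1[OF A0(1)] hyperplane_not_all2[OF B0(1)] by blast
  interpret based_two_summands M1 M2 p A0 B0 x0 y0
    using A0 B0 x0 y0 by unfold_locales
  have pF: "pasture F1" "pasture F2" "pasture F"
    using F1 F2 F by (simp_all add: is_foundation_def)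
  obtain u1 where u1: "u1 \<in> representations M1 F1"
    and ex1: "\<And>(R :: 'u pasture) f. pasture R \<Longrightarrow> f \<in> representations M1 R \<Longrightarrow>
      \<exists>!h. h \<in> pasture_hom F1 R \<and> (push_rep M1 h u1, f) \<in> rescaling_rel M1 R"
    using foundation_universal[OF F1 M1.ranked_axioms] by blast
  obtain u2 where u2: "u2 \<in> representations M2 F2"
    and ex2: "\<And>(R :: 'u pasture) f. pasture R \<Longrightarrow> f \<in> representations M2 R \<Longrightarrow>
      \<exists>!h. h \<in> pasture_hom F2 R \<and> (push_rep M2 h u2, f) \<in> rescaling_rel M2 R"
    using foundation_universal[OF F2 M2.ranked_axioms] by blast
  obtain u where u: "u \<in> representations N F"
    and ex: "\<And>(R :: 'u pasture) f. pasture R \<Longrightarrow> f \<in> representations N R \<Longrightarrow>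
      \<exists>!h. h \<in> pasture_hom F R \<and> (push_rep N h u, f) \<in> rescaling_rel N R"
    using foundation_universal[OF F ranked_two_sum] by blast
  have loc: "based_two_summands_pasture M1 M2 p A0 B0 x0 y0 R" if "pasture R" for R :: "'u pasture"
    using that based_two_summands_axioms two_summands_axioms
    by (simp add: based_two_summands_pasture_def two_summands_pasture_def pasture_struct_def)
  interpret F: based_two_summands_pasture M1 M2 p A0 B0 x0 y0 F by (rule loc[OF pF(3)])
  obtain i where i: "i \<in> pasture_hom F1 F" "(push_rep M1 i u1, res1 u) \<in> rescaling_rel M1 F"
    using ex1[OF pF(3) F.res_representation(1)[OF u]] by blast
  obtain j where j: "j \<in> pasture_hom F2 F" "(push_rep M2 j u2, res2 u) \<in> rescaling_rel M2 F"
    using ex2[OF pF(3) F.res_representation(2)[OF u]] by blast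
  have "\<exists>!h. h \<in> pasture_hom F R \<and> compose (carrier F1) h i = f \<and> compose (carrier F2) h j = g"
    if R: "pasture R" and f: "f \<in> pasture_hom F1 R" and g: "g \<in> pasture_hom F2 R"
    for R :: "'u pasture" and f g
  proof -
    interpret R: based_two_summands_pasture M1 M2 p A0 B0 x0 y0 R by (rule loc[OF R])
    interpret F1: pasture_struct F1 by unfold_locales (rule pF(1))
    interpret F2: pasture_struct F2 by unfold_locales (rule pF(2))
    interpret f: pasture_map F1 R f by unfold_locales (rule f)
    interpret g: pasture_map F2 R g by unfold_locales (rule g)
    have trans: "(x, z) \<in> rescaling_rel M R" if "(x, y) \<in> rescaling_rel M R" "(y, z) \<in> rescaling_rel M R"
      for M :: "'e matroid" and x y z
      using R.equiv_rescaling[of M] that by (meson equivE transD)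
    have sym: "(y, x) \<in> rescaling_rel M R" if "(x, y) \<in> rescaling_rel M R"
      for M :: "'e matroid" and x y
      using R.equiv_rescaling[of M] that by (meson equivE symD)
    have f1: "push_rep M1 f u1 \<in> representations M1 R"
      by (rule f.push_representation[OF M1.ranked_axioms u1])
    have g2: "push_rep M2 g u2 \<in> representations M2 R"
      by (rule g.push_representation[OF M2.ranked_axioms u2])
    \<comment> \<open>Restriction commutes with pushing forward, so
      \<open>compose (carrier F1) h i\<close> classifies the restriction of
      \<open>push_rep N h u\<close>; uniqueness of classifying morphisms gives the
      equivalence.\<close>
    have res1: "compose (carrier F1) h i = f \<longleftrightarrow>
        (res1 (push_rep N h u), push_rep M1 f u1) \<in> rescaling_rel M1 R"
      and res2: "compose (carrier F2) h j = g \<longleftrightarrow>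
        (res2 (push_rep N h u), push_rep M2 g u2) \<in> rescaling_rel M2 R"
      if h: "h \<in> pasture_hom F R" for h
    proof -
      interpret h: pasture_map F R h by unfold_locales (rule h)
      have "(push_rep M1 h (push_rep M1 i u1), push_rep M1 h (res1 u)) \<in> rescaling_rel M1 R"
        by (rule h.push_rescaling[OF M1.ranked_axioms i(2)])
      then have 1: "(push_rep M1 (compose (carrier F1) h i) u1, res1 (push_rep N h u)) \<in> rescaling_rel M1 R"
        by (simp add: push_rep_compose[OF pF(1) u1] res1_def push_pull_rep[OF embedding_B0])
      have hi: "compose (carrier F1) h i \<in> pasture_hom F1 R"
        by (rule pasture_hom_compose[OF pF(1,3) R i(1) h])
      show "compose (carrier F1) h i = f \<longleftrightarrow>
          (res1 (push_rep N h u), push_rep M1 f u1) \<in> rescaling_rel M1 R"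
      proof
        assume "(res1 (push_rep N h u), push_rep M1 f u1) \<in> rescaling_rel M1 R"
        then show "compose (carrier F1) h i = f"
          using ex1_unique[OF ex1[OF R f1], of "compose (carrier F1) h i" f] hi f trans[OF 1]
            R.equiv_rescaling[of M1] f1 by (meson equivE refl_onD)
      qed (use sym[OF 1] in simp)
      have "(push_rep M2 h (push_rep M2 j u2), push_rep M2 h (res2 u)) \<in> rescaling_rel M2 R"
        by (rule h.push_rescaling[OF M2.ranked_axioms j(2)])
      then have 2: "(push_rep M2 (compose (carrier F2) h j) u2, res2 (push_rep N h u)) \<in> rescaling_rel M2 R"
        by (simp add: push_rep_compose[OF pF(2) u2] res2_def push_pull_rep[OF embedding_A0])
      have hj: "compose (carrier F2) h j \<in> pasture_hom F2 R"
        by (rule pasture_hom_compose[OF pF(2,3) R j(1) h])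
      show "compose (carrier F2) h j = g \<longleftrightarrow>
          (res2 (push_rep N h u), push_rep M2 g u2) \<in> rescaling_rel M2 R"
      proof
        assume "(res2 (push_rep N h u), push_rep M2 g u2) \<in> rescaling_rel M2 R"
        then show "compose (carrier F2) h j = g"
          using ex1_unique[OF ex2[OF R g2], of "compose (carrier F2) h j" g] hj g trans[OF 2]
            R.equiv_rescaling[of M2] g2 by (meson equivE refl_onD)
      qed (use sym[OF 2] in simp)
    qed
    define k where "k = restrict_family N (R.glue (push_rep M1 f u1) (push_rep M2 g u2))"
    have k: "k \<in> representations N R" unfolding k_def by (rule R.glue_representation[OF f1 g2])
    have k1: "(res1 k, push_rep M1 f u1) \<in> rescaling_rel M1 R"
      and k2: "(res2 k, push_rep M2 g u2) \<in> rescaling_rel M2 R"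
      unfolding k_def by (rule R.res1_glue[OF f1 g2], rule R.res2_glue[OF f1 g2])
    \<comment> \<open>Restrictions respect rescaling and jointly determine the class, so matching
      \<open>k\<close> is the same as matching both of its restrictions.\<close>
    have iff: "(push_rep N h u, k) \<in> rescaling_rel N R \<longleftrightarrow>
        compose (carrier F1) h i = f \<and> compose (carrier F2) h j = g"
      if h: "h \<in> pasture_hom F R" for h
    proof -
      interpret h: pasture_map F R h by unfold_locales (rule h)
      have hu: "push_rep N h u \<in> representations N R"
        by (rule h.push_representation[OF ranked_two_sum u])
      show ?thesis
        unfolding res1[OF h] res2[OF h]
        using R.res_rescaling[of "push_rep N h u" k] R.res_injective[OF hu k] trans sym k1 k2 by meson
    qed
    obtain h where h: "h \<in> pasture_hom F R" "(push_rep N h u, k) \<in> rescaling_rel N R"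
      using ex[OF R k] by blast
    show ?thesis
    proof (rule ex1I[of _ h])
      show "h \<in> pasture_hom F R \<and> compose (carrier F1) h i = f \<and> compose (carrier F2) h j = g"
        using h iff by blast
      show "h' = h" if h': "h' \<in> pasture_hom F R \<and> compose (carrier F1) h' i = f \<and>
          compose (carrier F2) h' j = g" for h'
        using ex1_unique[OF ex[OF R k], of h' h] h h' iff[of h'] by blast
    qed
  qed
  then show ?thesis
    unfolding is_tensor_product_def using pF(3) i(1) j(1) by blast
qed

end

theorem theorem4p2:
  fixes M1 M2 :: "'e matroid" and p :: 'e and F1 F2 F T :: "'u pasture"
  assumes "matroid M1" and "matroid M2"
    and "ground M1 \<inter> ground M2 = {p}"
    and "\<not> loop M1 p" and "\<not> coloop M1 p"
    and "\<not> loop M2 p" and "\<not> coloop M2 p"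
    and "is_foundation M1 F1" and "is_foundation M2 F2"
    and "is_foundation (two_sum M1 M2 p) F"
    and "is_tensor_product F1 F2 T"
  shows "pasture_isomorphic F T"
proof -
  interpret two_summands M1 M2 p
    using assms by unfold_locales
  have "pasture F1" "pasture F2" using assms(8,9) by (simp_all add: is_foundation_def)
  then show ?thesis
    using tensor_product_unique[OF foundation_is_tensor_product] assms(8-11) by blast
qed

end
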